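(* Let $H$ and $G$ be separable Hilbert spaces of infinite dimension and let $\mathcal M$ be a complete smooth Riemannian manifold. Then the map $$\Phi:C^1_b(\mathcal M,\mathcal L(H,G))\to\mathrm{Mor}\big(C^1_0(\mathcal M,H),C^1_0(\mathcal M,G)\big),\qquad \Phi(\alpha)(s)(x):=\alpha(x)(s(x)),$$ is well-defined and bijective. Furthermore, $\Phi(\alpha)^*=\Phi(\alpha^* )$ and $$\|\Phi(\alpha)\|_{\mathrm{cb}}\le\|\alpha\|_1\le2\cdot\|\Phi(\alpha)\|_{\mathrm{cb}}$$ for all $\alpha\in C^1_b(\mathcal M,\mathcal L(H,G))$.
   Context: $\mathcal M$ has finite dimension $N$ and $T^*\mathcal M$ is the complexified cotangent bundle with the hermitian inner products induced by the metric. A map $\alpha:\mathcal M\to\mathcal L(H,G)$ is strongly differentiable if $x\mapsto\alpha(x)\xi$ is $C^1$ for every $\xi\in H$; it is $*$-strongly differentiable if also $\alpha^*:x\mapsto\alpha(x)^*$ is strongly differentiable. The strong derivative is the bounded operator $(d\alpha)(x):H\to G\otimes T_x^*\mathcal M$, $\xi\mapsto d(\alpha(\cdot)\xi)(x)$. $C^1_b(\mathcal M,\mathcal L(H,G))$ is the space of $*$-strongly differentiable maps $\alpha$ with $\|\alpha\|_1:=\sup_x\|\pi(\alpha)(x)\|_\infty<\infty$ (operator norm), where $$\pi(\alpha)(x)=\begin{pmatrix}\alpha(x)&0\\(d\alpha)(x)&\alpha(x)\otimes1\end{pmatrix}:H\oplus(H\otimes T_x^*\mathcal M)\to G\oplus(G\otimes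 T_x^*\mathcal M).$$ $C^1_0(\mathcal M)$ is the $*$-algebra of $C^1$-functions $f:\mathcal M\to\mathbb C$ such that for each $\varepsilon>0$ there is a compact $K$ with $\sup_{x\notin K}(|f(x)|+\|df(x)\|)<\varepsilon$. $C^1_0(\mathcal M,H)$ is the right $C^1_0(\mathcal M)$-module of $C^1$-maps $s:\mathcal M\to H$ such that for each $\varepsilon>0$ there is a compact $K$ with $\sup_{x\notin K}(\|s(x)\|_H+\|(ds)(x)\|_{H\otimes T_x^*\mathcal M})<\varepsilon$, $(ds)(x)=\sum_i\frac{\partial s}{\partial\phi_i}(x)\otimes(d\phi_i)(x)$. For a Hilbert space $E$ and a finite matrix $\xi$ over $E$, $\|\xi\|_E:=\|\langle\xi,\xi\rangle\|^{1/2}$ with $\langle\xi,\xi\rangle_{ij}=\sum_k\langle\xi_{ki},\xi_{kj}\rangle$. Finite matrices $s$ over $C^1_0(\mathcal M,H)$ have norm $\|s\|_1:=\sup_x\|(s(x),(ds)(x))\|_{H\oplus(H\otimes T_x^*\mathcal M)}$ (with $d$ entrywise). The hermitian form is $\langle s,t\rangle(x)=\langle s(x),t(x)\rangle_H$, valued in $C^1_0(\mathcal M)$. With this structure $C^1_0(\mathcal M,H)$ is (isomorphic to) the standard hermitian module $C^1_0(\mathcal M)^\infty$. $\mathrm{Mor}(X,Y)$ denotes the $C^1_0(\mathcal M)$-module maps $\beta:X\to Y$ which are completely bounded, i.e. $\|\beta\|_{\mathrm{cb}}:=\sup_n\|\beta_n:M_n(X)\to M_n(Y)\|<\infty$ (entrywise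 amplifications), and for which there is a completely bounded module map $\beta^*:Y\to X$ (unique adjoint) with $\langle\beta(s),t\rangle=\langle s,\beta^*(t)\rangle$ for all $s\in X,t\in Y$. *)

theory Defs
  imports "HOL-Analysis.Analysis"
begin

section \<open>Complex Hilbert spaces\<close>

text \<open>Inner products are conjugate linear in the first and linear in the second variable, the
  convention for right modules.\<close>

class complex_hilbert_space = banach +
  fixes scaleC :: "complex \<Rightarrow> 'a \<Rightarrow> 'a" (infixr "*\<^sub>C" 75)
    and cinner :: "'a \<Rightarrow> 'a \<Rightarrow> complex"
  assumes scaleC_add_right: "c *\<^sub>C (x + y) = c *\<^sub>C x + c *\<^sub>C y"
    and scaleC_add_left: "(c + d) *\<^sub>C x = c *\<^sub>C x + d *\<^sub>C x"
    and scaleC_scaleC: "c *\<^sub>C d *\<^sub>C x = (c * d) *\<^sub>C x"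
    and scaleR_scaleC: "scaleR r x = complex_of_real r *\<^sub>C x"
    and cinner_commute: "cinner x y = cnj (cinner y x)"
    and cinner_add_right: "cinner x (y + z) = cinner x y + cinner x z"
    and cinner_scaleC_right: "cinner x (c *\<^sub>C y) = c * cinner x y"
    and cinner_self: "cinner x x = complex_of_real ((norm x)\<^sup>2)"

instantiation complex :: complex_hilbert_space
begin

definition scaleC_complex :: "complex \<Rightarrow> complex \<Rightarrow> complex" where
  "scaleC_complex c z = c * z"

definition cinner_complex :: "complex \<Rightarrow> complex \<Rightarrow> complex" where
  "cinner_complex z w = cnj z * w"

instance
  by standard
    (auto simp: scaleC_complex_def cinner_complex_def algebra_simps scaleR_conv_of_real
      simp flip: complex_norm_square of_real_power)

end

global_interpretation complex_vector:
  vector_space "scaleC :: complex \<Rightarrow> 'a \<Rightarrow> 'a :: complex_hilbert_space"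
proof
  show "1 *\<^sub>C x = x" for x :: 'a
    using scaleR_scaleC[of 1 x] by simp
qed (simp_all add: scaleC_add_right scaleC_add_left scaleC_scaleC)

definition infinite_dimensional :: "'h::complex_hilbert_space itself \<Rightarrow> bool" where
  "infinite_dimensional _ \<longleftrightarrow> \<not> (\<exists>B::'h set. finite B \<and> complex_vector.span B = UNIV)"

text \<open>An element of \<open>\<L>(H,G)\<close> is an element of the library type of bounded real-linear maps that is
  in addition complex linear.\<close>

definition complex_linear :: "('h::complex_hilbert_space \<Rightarrow>\<^sub>L 'g::complex_hilbert_space) \<Rightarrow> bool" where
  "complex_linear a \<longleftrightarrow> (\<forall>c \<xi>. blinfun_apply a (c *\<^sub>C \<xi>) = c *\<^sub>C blinfun_apply a \<xi>)"

definition hilbert_adj ::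
  "('h::complex_hilbert_space \<Rightarrow>\<^sub>L 'g::complex_hilbert_space) \<Rightarrow> ('g \<Rightarrow>\<^sub>L 'h)" where
  "hilbert_adj a = (THE b. \<forall>\<xi> \<eta>. cinner (blinfun_apply a \<xi>) \<eta> = cinner \<xi> (blinfun_apply b \<eta>))"


section \<open>Smooth manifolds\<close>

text \<open>The coordinate space is a finite-dimensional real inner product space (rather than an instance
  of \<^class>\<open>euclidean_space\<close>) so that manifolds of dimension zero are included.  A chart is a
  pair of its domain and its coordinate map; the values of the latter outside of the domain are
  irrelevant.\<close>

type_synonym ('m, 'e) chart = "'m set \<times> ('m \<Rightarrow> 'e)"

definition chart_image :: "('m, 'e) chart \<Rightarrow> 'e set" where
  "chart_image c = snd c ` fst c"

definition local_rep :: "('m, 'e) chart \<Rightarrow> ('m \<Rightarrow> 'b) \<Rightarrow> 'e \<Rightarrow> 'b" where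
  "local_rep c f = f \<circ> inv_into (fst c) (snd c)"

text \<open>Only applied to open subsets of finite-dimensional spaces, where continuity of all directional
  derivatives is continuity of the derivative.\<close>

primrec Ck_on :: "nat \<Rightarrow> 'a::real_normed_vector set \<Rightarrow> ('a \<Rightarrow> 'b::real_normed_vector) \<Rightarrow> bool" where
  "Ck_on 0 S f \<longleftrightarrow> continuous_on S f"
| "Ck_on (Suc k) S f \<longleftrightarrow>
     (\<forall>p\<in>S. f differentiable (at p)) \<and> (\<forall>v. Ck_on k S (\<lambda>p. frechet_derivative f (at p) v))"

definition smooth_atlas ::
  "('m::{t2_space,second_countable_topology}, 'e::real_inner) chart set \<Rightarrow> bool" where
  "smooth_atlas A \<longleftrightarrow>
     (\<exists>B::'e set. finite B \<and> span B = UNIV) \<and>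
     (\<Union>c\<in>A. fst c) = UNIV \<and>
     (\<forall>c\<in>A. open (fst c) \<and> open (chart_image c) \<and>
        homeomorphism (fst c) (chart_image c) (snd c) (inv_into (fst c) (snd c))) \<and>
     (\<forall>c\<in>A. \<forall>d\<in>A. \<forall>k. Ck_on k (snd c ` (fst c \<inter> fst d)) (local_rep c (snd d)))"

text \<open>The tangent space at \<open>x\<close> is identified with the coordinate space by means of one fixed chart
  around \<open>x\<close>.  The choice is made pointwise, so nothing is claimed about how it depends on \<open>x\<close>; the
  norms and inner products below do not depend on it.\<close>

definition chart_at :: "('m, 'e) chart set \<Rightarrow> 'm \<Rightarrow> ('m, 'e) chart" where
  "chart_at A x = (SOME c. c \<in> A \<and> x \<in> fst c)"

definition C1_map ::
  "('m, 'e::real_inner) chart set \<Rightarrow> ('m \<Rightarrow> 'h::real_normed_vector) \<Rightarrow> bool" where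
  "C1_map A s \<longleftrightarrow> (\<forall>c\<in>A. Ck_on 1 (chart_image c) (local_rep c s))"

text \<open>The differential \<open>(ds)(x)\<close> as a real-linear map on the tangent space at \<open>x\<close>.\<close>

definition diff_at ::
  "('m, 'e::real_inner) chart set \<Rightarrow> ('m \<Rightarrow> 'h::real_normed_vector) \<Rightarrow> 'm \<Rightarrow> 'e \<Rightarrow> 'h" where
  "diff_at A s x =
     frechet_derivative (local_rep (chart_at A x) s) (at (snd (chart_at A x) x))"


section \<open>Complete Riemannian metrics\<close>

text \<open>A Riemannian metric is given by its local expressions: \<open>g c x v w\<close> is the inner product of the
  tangent vectors at \<open>x\<close> with coordinates \<open>v\<close> and \<open>w\<close> in the chart \<open>c\<close>.\<close>

type_synonym ('m, 'e) local_metric = "('m, 'e) chart \<Rightarrow> 'm \<Rightarrow> 'e \<Rightarrow> 'e \<Rightarrow> real"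

definition riemannian_metric ::
  "('m, 'e::real_inner) chart set \<Rightarrow> ('m, 'e) local_metric \<Rightarrow> bool" where
  "riemannian_metric A g \<longleftrightarrow>
     (\<forall>c\<in>A. \<forall>x\<in>fst c. bilinear (g c x) \<and> (\<forall>v w. g c x v w = g c x w v) \<and>
        (\<forall>v. v \<noteq> 0 \<longrightarrow> 0 < g c x v v)) \<and>
     (\<forall>c\<in>A. \<forall>v w k. Ck_on k (chart_image c) (local_rep c (\<lambda>x. g c x v w))) \<and>
     (\<forall>c\<in>A. \<forall>d\<in>A. \<forall>x\<in>fst c \<inter> fst d. \<forall>v w.
        g c x v w = g d x (frechet_derivative (local_rep c (snd d)) (at (snd c x)) v)
                          (frechet_derivative (local_rep c (snd d)) (at (snd c x)) w))"

definition C1_curve ::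
  "('m::topological_space, 'e::real_inner) chart set \<Rightarrow> (real \<Rightarrow> 'm) \<Rightarrow> bool" where
  "C1_curve A \<gamma> \<longleftrightarrow> continuous_on {0..1} \<gamma> \<and>
     (\<forall>c\<in>A. \<exists>D. continuous_on {t\<in>{0..1}. \<gamma> t \<in> fst c} D \<and>
        (\<forall>t\<in>{t\<in>{0..1}. \<gamma> t \<in> fst c}.
           ((\<lambda>u. snd c (\<gamma> u)) has_vector_derivative D t) (at t within {0..1})))"

definition curve_length ::
  "('m, 'e::real_inner) chart set \<Rightarrow> ('m, 'e) local_metric \<Rightarrow> (real \<Rightarrow> 'm) \<Rightarrow> real" where
  "curve_length A g \<gamma> = integral {0..1} (\<lambda>t.
     let c = chart_at A (\<gamma> t);
         v = vector_derivative (\<lambda>u. snd c (\<gamma> u)) (at t within {0..1})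
     in sqrt (g c (\<gamma> t) v v))"

text \<open>The manifold need not be connected: the distance between different components is \<open>\<infinity>\<close>.\<close>

definition riemannian_dist ::
  "('m::topological_space, 'e::real_inner) chart set \<Rightarrow> ('m, 'e) local_metric \<Rightarrow> 'm \<Rightarrow> 'm \<Rightarrow> ennreal"
  where
  "riemannian_dist A g x y =
     (INF \<gamma>\<in>{\<gamma>. C1_curve A \<gamma> \<and> \<gamma> 0 = x \<and> \<gamma> 1 = y}. ennreal (curve_length A g \<gamma>))"

definition complete_riemannian_manifold ::
  "('m::{t2_space,second_countable_topology}, 'e::real_inner) chart set \<Rightarrow>
     ('m, 'e) local_metric \<Rightarrow> bool" where
  "complete_riemannian_manifold A g \<longleftrightarrow>
     smooth_atlas A \<and> riemannian_metric A g \<and>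
     (\<forall>X. (\<forall>\<epsilon>>0. \<exists>K. \<forall>m\<ge>K. \<forall>n\<ge>K. riemannian_dist A g (X m) (X n) < \<epsilon>) \<longrightarrow>
          (\<exists>x. (\<lambda>n. riemannian_dist A g (X n) x) \<longlonglongrightarrow> 0))"


section \<open>The Hilbert spaces \<open>H \<otimes> T\<^sup>*\<^sub>x\<M>\<close> and \<open>H \<oplus> (H \<otimes> T\<^sup>*\<^sub>x\<M>)\<close>\<close>

text \<open>\<open>H \<otimes> T\<^sup>*\<^sub>x\<M>\<close>, with \<open>T\<^sup>*\<^sub>x\<M>\<close> the complexified cotangent space, is realized as the space of
  real-linear maps from the tangent space to \<open>H\<close>; the elementary tensor \<open>\<xi> \<otimes> \<omega>\<close> is the map
  \<open>v \<mapsto> \<omega>(v) \<xi>\<close>.  For \<open>H = \<complex>\<close> this is the complexified cotangent space itself.\<close>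

definition orthonormal_frame ::
  "('m, 'e::real_inner) chart set \<Rightarrow> ('m, 'e) local_metric \<Rightarrow> 'm \<Rightarrow> 'e set" where
  "orthonormal_frame A g x = (SOME E. finite E \<and> span E = UNIV \<and>
     (\<forall>u\<in>E. \<forall>v\<in>E. g (chart_at A x) x u v = (if u = v then 1 else 0)))"

definition cot_inner ::
  "('m, 'e::real_inner) chart set \<Rightarrow> ('m, 'e) local_metric \<Rightarrow> 'm \<Rightarrow>
     ('e \<Rightarrow> 'h::complex_hilbert_space) \<Rightarrow> ('e \<Rightarrow> 'h) \<Rightarrow> complex" where
  "cot_inner A g x S T = (\<Sum>e\<in>orthonormal_frame A g x. cinner (S e) (T e))"

definition cot_norm ::
  "('m, 'e::real_inner) chart set \<Rightarrow> ('m, 'e) local_metric \<Rightarrow> 'm \<Rightarrow>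
     ('e \<Rightarrow> 'h::complex_hilbert_space) \<Rightarrow> real" where
  "cot_norm A g x S = sqrt (Re (cot_inner A g x S S))"

lemma cot_inner_elementary_tensor:
  fixes \<xi> \<eta> :: "'h::complex_hilbert_space" and \<omega> \<theta> :: "'e::real_inner \<Rightarrow> complex"
  shows "cot_inner A g x (\<lambda>v. \<omega> v *\<^sub>C \<xi>) (\<lambda>v. \<theta> v *\<^sub>C \<eta>) = cinner \<xi> \<eta> * cot_inner A g x \<omega> \<theta>"
proof -
  have "cinner (a *\<^sub>C \<xi>) (b *\<^sub>C \<eta>) = cinner \<xi> \<eta> * cinner a b" for a b
    by (subst cinner_scaleC_right, subst cinner_commute, subst cinner_scaleC_right)
       (simp add: cinner_complex_def cinner_commute[of \<xi> \<eta>])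
  then show ?thesis
    by (simp add: cot_inner_def sum_distrib_left)
qed

definition jet_inner ::
  "('m, 'e::real_inner) chart set \<Rightarrow> ('m, 'e) local_metric \<Rightarrow> 'm \<Rightarrow>
     'h::complex_hilbert_space \<times> ('e \<Rightarrow> 'h) \<Rightarrow> 'h \<times> ('e \<Rightarrow> 'h) \<Rightarrow> complex" where
  "jet_inner A g x p q = cinner (fst p) (fst q) + cot_inner A g x (snd p) (snd q)"

definition jet_norm ::
  "('m, 'e::real_inner) chart set \<Rightarrow> ('m, 'e) local_metric \<Rightarrow> 'm \<Rightarrow>
     'h::complex_hilbert_space \<times> ('e \<Rightarrow> 'h) \<Rightarrow> real" where
  "jet_norm A g x p = sqrt (Re (jet_inner A g x p p))"


section \<open>The maps \<open>C\<^sup>1\<^sub>b(\<M>, \<L>(H,G))\<close>\<close>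

definition strongly_differentiable ::
  "('m, 'e::real_inner) chart set \<Rightarrow>
     ('m \<Rightarrow> ('h::complex_hilbert_space \<Rightarrow>\<^sub>L 'g::complex_hilbert_space)) \<Rightarrow> bool" where
  "strongly_differentiable A \<alpha> \<longleftrightarrow> (\<forall>\<xi>. C1_map A (\<lambda>x. blinfun_apply (\<alpha> x) \<xi>))"

definition ptw_adj ::
  "('m \<Rightarrow> ('h::complex_hilbert_space \<Rightarrow>\<^sub>L 'g::complex_hilbert_space)) \<Rightarrow> 'm \<Rightarrow> ('g \<Rightarrow>\<^sub>L 'h)" where
  "ptw_adj \<alpha> = (\<lambda>x. hilbert_adj (\<alpha> x))"

definition star_strongly_differentiable ::
  "('m, 'e::real_inner) chart set \<Rightarrow>
     ('m \<Rightarrow> ('h::complex_hilbert_space \<Rightarrow>\<^sub>L 'g::complex_hilbert_space)) \<Rightarrow> bool" where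
  "star_strongly_differentiable A \<alpha> \<longleftrightarrow>
     strongly_differentiable A \<alpha> \<and> strongly_differentiable A (ptw_adj \<alpha>)"

definition strong_deriv ::
  "('m, 'e::real_inner) chart set \<Rightarrow>
     ('m \<Rightarrow> ('h::complex_hilbert_space \<Rightarrow>\<^sub>L 'g::complex_hilbert_space)) \<Rightarrow> 'm \<Rightarrow> 'h \<Rightarrow> 'e \<Rightarrow> 'g" where
  "strong_deriv A \<alpha> x \<xi> = diff_at A (\<lambda>y. blinfun_apply (\<alpha> y) \<xi>) x"

text \<open>The lower triangular operator matrix \<open>\<pi>(\<alpha>)(x)\<close>; under the identification above
  \<open>\<alpha>(x) \<otimes> 1\<close> is composition with \<open>\<alpha>(x)\<close>.\<close>

definition pi_op ::
  "('m, 'e::real_inner) chart set \<Rightarrow>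
     ('m \<Rightarrow> ('h::complex_hilbert_space \<Rightarrow>\<^sub>L 'g::complex_hilbert_space)) \<Rightarrow> 'm \<Rightarrow>
     'h \<times> ('e \<Rightarrow> 'h) \<Rightarrow> 'g \<times> ('e \<Rightarrow> 'g)" where
  "pi_op A \<alpha> x p =
     (blinfun_apply (\<alpha> x) (fst p), \<lambda>v. strong_deriv A \<alpha> x (fst p) v + blinfun_apply (\<alpha> x) (snd p v))"

definition pi_opnorm ::
  "('m, 'e::real_inner) chart set \<Rightarrow> ('m, 'e) local_metric \<Rightarrow>
     ('m \<Rightarrow> ('h::complex_hilbert_space \<Rightarrow>\<^sub>L 'g::complex_hilbert_space)) \<Rightarrow> 'm \<Rightarrow> ennreal" where
  "pi_opnorm A g \<alpha> x =
     (SUP p\<in>{p. linear (snd p) \<and> jet_norm A g x p \<le> 1}. ennreal (jet_norm A g x (pi_op A \<alpha> x p)))"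

definition C1b_norm ::
  "('m, 'e::real_inner) chart set \<Rightarrow> ('m, 'e) local_metric \<Rightarrow>
     ('m \<Rightarrow> ('h::complex_hilbert_space \<Rightarrow>\<^sub>L 'g::complex_hilbert_space)) \<Rightarrow> ennreal" where
  "C1b_norm A g \<alpha> = (SUP x. pi_opnorm A g \<alpha> x)"

definition C1b ::
  "('m, 'e::real_inner) chart set \<Rightarrow> ('m, 'e) local_metric \<Rightarrow>
     ('m \<Rightarrow> ('h::complex_hilbert_space \<Rightarrow>\<^sub>L 'g::complex_hilbert_space)) set" where
  "C1b A g = {\<alpha>. (\<forall>x. complex_linear (\<alpha> x)) \<and> star_strongly_differentiable A \<alpha> \<and>
     C1b_norm A g \<alpha> < \<infinity>}"


section \<open>The hermitian modules \<open>C\<^sup>1\<^sub>0(\<M>, H)\<close>\<close>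

text \<open>For \<open>H = \<complex>\<close> this is the algebra \<open>C\<^sup>1\<^sub>0(\<M>)\<close>.\<close>

definition C10 ::
  "('m::topological_space, 'e::real_inner) chart set \<Rightarrow> ('m, 'e) local_metric \<Rightarrow>
     ('m \<Rightarrow> 'h::complex_hilbert_space) set" where
  "C10 A g = {s. C1_map A s \<and>
     (\<forall>\<epsilon>>0. \<exists>K. compact K \<and>
        (SUP x\<in>- K. ennreal (norm (s x) + cot_norm A g x (diff_at A s x))) < ennreal \<epsilon>)}"

definition hermitian_form ::
  "('m \<Rightarrow> 'h::complex_hilbert_space) \<Rightarrow> ('m \<Rightarrow> 'h) \<Rightarrow> 'm \<Rightarrow> complex" where
  "hermitian_form s t = (\<lambda>x. cinner (s x) (t x))"

text \<open>Square matrices of size \<open>n\<close> are functions of two indices, of which only the values at indices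
  below \<open>n\<close> matter.\<close>

definition matrix_opnorm :: "nat \<Rightarrow> (nat \<Rightarrow> nat \<Rightarrow> complex) \<Rightarrow> real" where
  "matrix_opnorm n a =
     (SUP v\<in>{v :: nat \<Rightarrow> complex. (\<Sum>j<n. (cmod (v j))\<^sup>2) \<le> 1}.
        sqrt (\<Sum>i<n. (cmod (\<Sum>j<n. a i j * v j))\<^sup>2))"

text \<open>The norm of a matrix over a Hilbert space with inner product \<open>ip\<close>.\<close>

definition hilbert_matrix_norm :: "('x \<Rightarrow> 'x \<Rightarrow> complex) \<Rightarrow> nat \<Rightarrow> (nat \<Rightarrow> nat \<Rightarrow> 'x) \<Rightarrow> real" where
  "hilbert_matrix_norm ip n \<xi> = sqrt (matrix_opnorm n (\<lambda>i j. \<Sum>k<n. ip (\<xi> k i) (\<xi> k j)))"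

definition C10_matrix_norm ::
  "('m, 'e::real_inner) chart set \<Rightarrow> ('m, 'e) local_metric \<Rightarrow> nat \<Rightarrow>
     (nat \<Rightarrow> nat \<Rightarrow> 'm \<Rightarrow> 'h::complex_hilbert_space) \<Rightarrow> ennreal" where
  "C10_matrix_norm A g n s =
     (SUP x. ennreal (hilbert_matrix_norm (jet_inner A g x) n (\<lambda>i j. (s i j x, diff_at A (s i j) x))))"


section \<open>Completely bounded adjointable module maps\<close>

definition cb_norm ::
  "('m::topological_space, 'e::real_inner) chart set \<Rightarrow> ('m, 'e) local_metric \<Rightarrow>
     (('m \<Rightarrow> 'h::complex_hilbert_space) \<Rightarrow> ('m \<Rightarrow> 'g::complex_hilbert_space)) \<Rightarrow> ennreal" where
  "cb_norm A g \<beta> =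
     (SUP n\<in>{1..}. SUP s\<in>{s. (\<forall>i<n. \<forall>j<n. s i j \<in> C10 A g) \<and> C10_matrix_norm A g n s \<le> 1}.
        C10_matrix_norm A g n (\<lambda>i j. \<beta> (s i j)))"

text \<open>Module maps are taken to be extensional, i.e. undefined outside of \<^term>\<open>C10 A g\<close>, so
  that equality of functions is equality of maps between the modules.\<close>

definition cb_module_maps ::
  "('m::topological_space, 'e::real_inner) chart set \<Rightarrow> ('m, 'e) local_metric \<Rightarrow>
     (('m \<Rightarrow> 'h::complex_hilbert_space) \<Rightarrow> ('m \<Rightarrow> 'g::complex_hilbert_space)) set" where
  "cb_module_maps A g = {\<beta> \<in> C10 A g \<rightarrow>\<^sub>E C10 A g.
     (\<forall>s\<in>C10 A g. \<forall>t\<in>C10 A g. \<beta> (\<lambda>x. s x + t x) = (\<lambda>x. \<beta> s x + \<beta> t x)) \<and>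
     (\<forall>s\<in>C10 A g. \<forall>c. \<beta> (\<lambda>x. c *\<^sub>C s x) = (\<lambda>x. c *\<^sub>C \<beta> s x)) \<and>
     (\<forall>s\<in>C10 A g. \<forall>f\<in>C10 A g. \<beta> (\<lambda>x. f x *\<^sub>C s x) = (\<lambda>x. f x *\<^sub>C \<beta> s x)) \<and>
     cb_norm A g \<beta> < \<infinity>}"

definition is_adjoint ::
  "('m::topological_space, 'e::real_inner) chart set \<Rightarrow> ('m, 'e) local_metric \<Rightarrow>
     (('m \<Rightarrow> 'h::complex_hilbert_space) \<Rightarrow> ('m \<Rightarrow> 'g::complex_hilbert_space)) \<Rightarrow>
     (('m \<Rightarrow> 'g) \<Rightarrow> ('m \<Rightarrow> 'h)) \<Rightarrow> bool" where
  "is_adjoint A g \<beta> \<gamma> \<longleftrightarrow> \<gamma> \<in> cb_module_maps A g \<and>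
     (\<forall>s\<in>C10 A g. \<forall>t\<in>C10 A g. hermitian_form (\<beta> s) t = hermitian_form s (\<gamma> t))"

definition Mor ::
  "('m::topological_space, 'e::real_inner) chart set \<Rightarrow> ('m, 'e) local_metric \<Rightarrow>
     (('m \<Rightarrow> 'h::complex_hilbert_space) \<Rightarrow> ('m \<Rightarrow> 'g::complex_hilbert_space)) set" where
  "Mor A g = {\<beta> \<in> cb_module_maps A g. \<exists>\<gamma>. is_adjoint A g \<beta> \<gamma>}"

definition mor_adj ::
  "('m::topological_space, 'e::real_inner) chart set \<Rightarrow> ('m, 'e) local_metric \<Rightarrow>
     (('m \<Rightarrow> 'h::complex_hilbert_space) \<Rightarrow> ('m \<Rightarrow> 'g::complex_hilbert_space)) \<Rightarrow>
     ('m \<Rightarrow> 'g) \<Rightarrow> ('m \<Rightarrow> 'h)" where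
  "mor_adj A g \<beta> = (THE \<gamma>. is_adjoint A g \<beta> \<gamma>)"

definition Phi ::
  "('m::topological_space, 'e::real_inner) chart set \<Rightarrow> ('m, 'e) local_metric \<Rightarrow>
     ('m \<Rightarrow> ('h::complex_hilbert_space \<Rightarrow>\<^sub>L 'g::complex_hilbert_space)) \<Rightarrow>
     ('m \<Rightarrow> 'h) \<Rightarrow> ('m \<Rightarrow> 'g)" where
  "Phi A g \<alpha> = restrict (\<lambda>s x. blinfun_apply (\<alpha> x) (s x)) (C10 A g)"

end

theory Submission
  imports Defs
begin

text \<open>Completeness enters through cutoff functions: for every \<open>\<epsilon> > 0\<close> and every point there is a
  compactly supported \<open>C\<^sup>1\<close>-function with values in \<open>[0,1]\<close>, equal to \<open>1\<close> near the point and with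
  gradient at most \<open>\<epsilon>\<close>.  It is obtained by smoothing a Lipschitz function of the distance, whose
  balls are relatively compact by the theorem of Hopf and Rinow; distances are measured along chains
  of coordinate segments, which avoids any analysis of geodesics.

  Multiplying \<open>\<xi>\<close> by cutoff functions gives
  \<open>\<parallel>(\<alpha>(x)\<xi>, d\<alpha>(x)\<xi>)\<parallel> \<le> \<parallel>\<Phi>(\<alpha>)\<parallel> \<parallel>\<xi>\<parallel>\<close>, so that both columns of \<open>\<pi>(\<alpha>)(x)\<close>, the second
  being \<open>\<alpha>(x) \<otimes> 1\<close>, are bounded by \<open>\<parallel>\<Phi>(\<alpha>)\<parallel>\<close>, whence the factor \<open>2\<close>.  The other estimate holds
  because \<open>\<pi>(\<alpha>)(x)\<close> maps the jet of \<open>s\<close> at \<open>x\<close> to that of \<open>\<Phi>(\<alpha>)(s)\<close>.  Finally, a map \<open>\<beta>\<close> with an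
  adjoint is local in the strongest sense, \<open>\<beta>(s)(x)\<close> depending only on \<open>s(x)\<close>, and therefore is of
  the form \<open>\<Phi>(\<alpha>)\<close>.\<close>

section \<open>Inner product calculus, Riesz representation and adjoints\<close>

section \<open>Complex Hilbert spaces\<close>

text \<open>A cutoff f enlarges the norm of the section f \<xi> by its gradient. A merely bounded
  gradient would spoil the constant 2, while small gradients give sections of norm at most (1 +
  \<epsilon>) \<parallel>\<xi>\<parallel>, and \<epsilon> is removed in the end. Completeness is
  stated with lengths of curves. Chains are tied to curves by two facts: a chain of length L yields
  a curve of length at most 2 L, and a short curve with one end near the center of a small
  coordinate ball stays in the ball. The factors 2 come from freezing the metric at the center; they
  disappear in the choice of \<epsilon>. Since \<alpha> is differentiable only strongly, the product
  rule for \<alpha>(x)(s(x)) rests on the uniform bound for \<pi>(\<alpha>), which controls the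
  Taylor remainder of s. For surjectivity the adjoint is used twice: it makes \<beta> act pointwise,
  and, treated like \<beta>, it shows that \<open>ptw_adj \<alpha>\<close> is strongly
  differentiable. Boundedness of \<open>ptw_adj \<alpha>\<close> needs its own argument, because
  adjoints do not preserve the triangular form of \<pi>.\<close>

lemma cinner_add_left: "cinner (x + y) z = cinner x z + cinner y z"
  by (metis cinner_commute cinner_add_right complex_cnj_add)

lemma cinner_scaleC_left: "cinner (c *\<^sub>C x) y = cnj c * cinner x y"
  by (metis cinner_commute cinner_scaleC_right complex_cnj_mult)

lemma cinner_scaleR_right: "cinner x (r *\<^sub>R y) = r *\<^sub>R cinner x y"
  by (simp add: scaleR_scaleC[of r y] cinner_scaleC_right scaleR_conv_of_real)

lemma cinner_scaleR_left: "cinner (r *\<^sub>R x) y = r *\<^sub>R cinner x y"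
  by (simp add: scaleR_scaleC[of r x] cinner_scaleC_left scaleR_conv_of_real)

lemma norm_scaleC: "norm (c *\<^sub>C x) = cmod c * norm x"
proof -
  have "complex_of_real ((norm (c *\<^sub>C x))\<^sup>2) = cnj c * c * cinner x x"
    by (simp only: cinner_self[symmetric] cinner_scaleC_left cinner_scaleC_right ac_simps)
  also have "\<dots> = complex_of_real ((cmod c * norm x)\<^sup>2)"
    using complex_norm_square[of c] by (simp add: cinner_self power_mult_distrib mult.commute)
  finally show ?thesis
    by (metis (mono_tags) norm_ge_zero of_real_eq_iff power2_eq_imp_eq zero_le_mult_iff)
qed

lemma norm_add_square_cinner:
  "(norm (x + y))\<^sup>2 = (norm x)\<^sup>2 + (norm y)\<^sup>2 + 2 * Re (cinner x y)"
proof -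
  have "complex_of_real ((norm (x + y))\<^sup>2) = cinner x x + cinner y y + (cinner x y + cinner y x)"
    by (simp only: cinner_self[symmetric] cinner_add_left cinner_add_right ac_simps)
  then have "Re (complex_of_real ((norm (x + y))\<^sup>2))
      = Re (cinner x x + cinner y y + (cinner x y + cinner y x))"
    by simp
  then show ?thesis
    using cinner_commute[of y x] by (simp add: cinner_self)
qed

text \<open>The norm is part of the class, so its triangle inequality is at hand; squaring it bounds
  the real part, and rotating y by a unimodular scalar turns the real part into the modulus.\<close>

lemma cmod_cinner_le: "cmod (cinner x y) \<le> norm x * norm y"
proof -
  have Re: "Re (cinner x z) \<le> norm x * norm z" for z
    using norm_add_square_cinner[of x z] power_mono[OF norm_triangle_ineq[of x z], of 2]
    by (simp add: power2_sum)
  obtain c where c: "cmod c = 1" "c * cinner x y = complex_of_real (cmod (cinner x y))"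
  proof (cases "cinner x y = 0")
    case True
    then show ?thesis using that[of 1] by simp
  next
    case False
    show ?thesis
      by (rule that[of "cnj (cinner x y) / cmod (cinner x y)"])
        (use False in \<open>auto simp: norm_divide field_simps power2_eq_square simp flip: complex_norm_square\<close>)
  qed
  then show ?thesis
    using Re[of "c *\<^sub>C y"] by (simp add: cinner_scaleC_right norm_scaleC)
qed

lemma bounded_bilinear_cinner: "bounded_bilinear (cinner :: 'a::complex_hilbert_space \<Rightarrow> _)"
  by standard (auto simp: cinner_add_left cinner_add_right cinner_scaleR_left cinner_scaleR_right
      intro!: exI[of _ 1] cmod_cinner_le)

lemma bounded_bilinear_scaleC:
  "bounded_bilinear (scaleC :: complex \<Rightarrow> 'a::complex_hilbert_space \<Rightarrow> 'a)"
  by standard (auto simp: scaleC_add_left scaleC_add_right scaleR_scaleC[where 'a='a] scaleC_scaleC norm_scaleC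
      scaleR_conv_of_real mult.commute intro!: exI[of _ 1])

interpretation cinner: bounded_bilinear "cinner :: 'a::complex_hilbert_space \<Rightarrow> 'a \<Rightarrow> complex"
  by (rule bounded_bilinear_cinner)

interpretation scaleC: bounded_bilinear "scaleC :: complex \<Rightarrow> 'a::complex_hilbert_space \<Rightarrow> 'a"
  by (rule bounded_bilinear_scaleC)

lemma cinner_eq_zeroD: "cinner x x = 0 \<Longrightarrow> x = 0"
  by (simp add: cinner_self)

lemma cinner_ext:
  assumes "\<And>x. cinner x y = cinner x z"
  shows "y = z"
proof -
  have "cinner (y - z) (y - z) = 0"
    using assms[of "y - z"] by (simp add: cinner.diff_right)
  then show ?thesis using cinner_eq_zeroD by fastforce
qed

lemma parallelogram_law:
  fixes x y :: "'a::complex_hilbert_space"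
  shows "(norm (x - y))\<^sup>2 + (norm (x + y))\<^sup>2 = 2 * (norm x)\<^sup>2 + 2 * (norm y)\<^sup>2"
  using norm_add_square_cinner[of x y] norm_add_square_cinner[of x "- y"]
  by (simp add: cinner.minus_right)

text \<open>The closed hyperplane f = 1 has a point of least norm by completeness; it is orthogonal
  to the kernel of f, and a multiple of it represents f.\<close>

theorem riesz_representation:
  fixes f :: "'h::complex_hilbert_space \<Rightarrow> complex"
  assumes lin: "bounded_linear f" and hom: "\<And>c x. f (c *\<^sub>C x) = c * f x"
  shows "\<exists>z. \<forall>x. f x = cinner z x"
proof (cases "\<forall>x. f x = 0")
  case True
  then show ?thesis by (intro exI[of _ 0]) (simp add: cinner.zero_left)
next
  case False
  interpret f: bounded_linear f by (rule lin)
  define S where "S = {x. f x = 1}"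
  from False obtain a where "f a \<noteq> 0" by blast
  then have "inverse (f a) *\<^sub>C a \<in> S" by (simp add: S_def hom)
  then have ne: "S \<noteq> {}" by blast
  define d where "d = Inf (norm ` S)"
  have bdd: "bdd_below (norm ` S)" by (rule bdd_belowI[of _ 0]) auto
  have d_le: "d \<le> norm x" if "x \<in> S" for x
    unfolding d_def using bdd that by (intro cInf_lower) auto
  have d0: "0 \<le> d" unfolding d_def using ne by (intro cInf_greatest) auto
  have "\<exists>x\<in>S. norm x < d + 1 / Suc n" for n
    using cInf_lessD[of "norm ` S" "d + 1 / Suc n"] ne unfolding d_def by auto
  then obtain X where X: "\<And>n. X n \<in> S" "\<And>n. norm (X n) < d + 1 / Suc n" by metis
  \<comment> \<open>Midpoints stay in S, so the parallelogram law forces almost minimal vectors to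
    be close to each other.\<close>
  have est: "(norm (X m - X n))\<^sup>2 \<le> 4 * ((d + 1 / Suc N)\<^sup>2 - d\<^sup>2)" if "N \<le> m" "N \<le> n" for m n N
  proof -
    have le: "(norm (X k))\<^sup>2 \<le> (d + 1 / Suc N)\<^sup>2" if "N \<le> k" for k
    proof (rule power_mono)
      have "1 / real (Suc k) \<le> 1 / Suc N" using that by (simp add: frac_le)
      then show "norm (X k) \<le> d + 1 / Suc N" using X(2)[of k] by linarith
    qed simp
    have "(1/2) *\<^sub>R (X m + X n) \<in> S"
      using X(1) by (simp add: S_def f.scaleR f.add scaleR_conv_of_real)
    then have "d\<^sup>2 \<le> (norm ((1/2) *\<^sub>R (X m + X n)))\<^sup>2"
      by (intro power_mono d_le d0)
    then have "4 * d\<^sup>2 \<le> (norm (X m + X n))\<^sup>2" by (simp add: power_divide)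
    then show ?thesis
      using parallelogram_law[of "X m" "X n"] le[OF that(1)] le[OF that(2)] by argo
  qed
  have lim0: "(\<lambda>N. 4 * ((d + 1 / Suc N)\<^sup>2 - d\<^sup>2)) \<longlonglongrightarrow> 4 * ((d + 0)\<^sup>2 - d\<^sup>2)"
    by (intro tendsto_intros LIMSEQ_Suc lim_1_over_n)
  have "Cauchy X"
  proof (rule metric_CauchyI)
    fix e :: real assume "0 < e"
    then have "\<forall>\<^sub>F N in sequentially. 4 * ((d + 1 / Suc N)\<^sup>2 - d\<^sup>2) < e\<^sup>2"
      using order_tendstoD(2)[OF lim0, of "e\<^sup>2"] by simp
    then obtain N where N: "4 * ((d + 1 / Suc N)\<^sup>2 - d\<^sup>2) < e\<^sup>2"
      by (auto simp: eventually_sequentially)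
    have "dist (X m) (X n) < e" if "N \<le> m" "N \<le> n" for m n
    proof -
      have "(norm (X m - X n))\<^sup>2 < e\<^sup>2" using est[OF that] N by simp
      then show ?thesis using \<open>0 < e\<close> by (simp add: dist_norm power_less_imp_less_base)
    qed
    then show "\<exists>M. \<forall>m\<ge>M. \<forall>n\<ge>M. dist (X m) (X n) < e" by blast
  qed
  then obtain x where x: "X \<longlonglongrightarrow> x" using Cauchy_convergent convergent_def by blast
  have "(\<lambda>n. f (X n)) \<longlonglongrightarrow> f x" by (rule f.tendsto[OF x])
  then have fx: "f x = 1" using X(1) by (simp add: S_def LIMSEQ_const_iff)
  have "norm x \<le> d + 0"
  proof (rule LIMSEQ_le[OF tendsto_norm[OF x]])
    show "(\<lambda>n. d + 1 / Suc n) \<longlonglongrightarrow> d + 0" by (intro tendsto_intros LIMSEQ_Suc lim_1_over_n)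
  qed (use X(2) in \<open>auto intro: less_imp_le\<close>)
  then have min: "norm x \<le> norm y" if "f y = 1" for y
    using d_le[of y] that by (simp add: S_def)
  have x0: "x \<noteq> 0" using fx f.zero by auto
  have Re0: "0 \<le> Re (cinner x y)" if "f y = 0" for y
  proof (rule ccontr)
    assume neg: "\<not> 0 \<le> Re (cinner x y)"
    then have y0: "y \<noteq> 0" by (auto simp: cinner.zero_right)
    \<comment> \<open>The minimizer of t \<mapsto> \<parallel>x + t y\<parallel>^2; a negative real
      part would push the value below the minimum.\<close>
    define t where "t = - Re (cinner x y) / (norm y)\<^sup>2"
    have t: "0 < t" using neg y0 by (simp add: t_def divide_neg_pos)
    have "(norm x)\<^sup>2 \<le> (norm (x + t *\<^sub>R y))\<^sup>2"
      using that fx by (intro power_mono min) (auto simp: f.add f.scaleR)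
    also have "\<dots> = (norm x)\<^sup>2 + t * (t * (norm y)\<^sup>2 + 2 * Re (cinner x y))"
      by (subst norm_add_square_cinner)
        (simp add: cinner.scaleR_right power_mult_distrib algebra_simps power2_eq_square)
    also have "t * (norm y)\<^sup>2 = - Re (cinner x y)" using y0 by (simp add: t_def)
    finally have "0 \<le> t * Re (cinner x y)" by (simp add: algebra_simps)
    then show False using t neg by (simp add: zero_le_mult_iff)
  qed
  \<comment> \<open>The kernel is a complex subspace: the inequality for y, -y, i y and -i y gives
    equality.\<close>
  have orth: "cinner x y = 0" if "f y = 0" for y
  proof -
    have "0 \<le> Re (cinner x (c *\<^sub>C y))" for c
      by (rule Re0) (simp add: hom that)
    then have *: "0 \<le> Re (c * cinner x y)" for c by (simp add: cinner_scaleC_right)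
    show ?thesis using *[of 1] *[of "-1"] *[of \<i>] *[of "-\<i>"] by (simp add: complex_eq_iff)
  qed
  have eq: "cinner x y = f y * (norm x)\<^sup>2" for y
  proof -
    have "cinner x (y - f y *\<^sub>C x) = 0"
      by (rule orth) (simp add: f.diff hom fx)
    then show ?thesis by (simp add: cinner.diff_right cinner_scaleC_right cinner_self)
  qed
  show ?thesis
  proof (intro exI[of _ "complex_of_real (inverse ((norm x)\<^sup>2)) *\<^sub>C x"] allI)
    show "f y = cinner (complex_of_real (inverse ((norm x)\<^sup>2)) *\<^sub>C x) y" for y
      using x0 by (simp add: cinner_scaleC_left eq)
  qed
qed

text \<open>Riesz representation of \<xi> \<mapsto> \<langle>\<eta>, a \<xi>\<rangle> yields b
  \<eta>, and uniqueness of the representing vector makes it linear in \<eta>.\<close>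

lemma adjoint_exists:
  fixes a :: "'h::complex_hilbert_space \<Rightarrow>\<^sub>L 'g::complex_hilbert_space"
  assumes a: "complex_linear a"
  shows "\<exists>b :: 'g \<Rightarrow>\<^sub>L 'h. \<forall>\<xi> \<eta>. cinner (blinfun_apply a \<xi>) \<eta> = cinner \<xi> (blinfun_apply b \<eta>)"
proof -
  have "\<exists>z. \<forall>\<xi>. cinner \<eta> (blinfun_apply a \<xi>) = cinner z \<xi>" for \<eta>
    by (rule riesz_representation)
      (use a in \<open>auto simp: complex_linear_def cinner_scaleC_right
        intro!: cinner.bounded_linear_right[THEN bounded_linear_compose] blinfun.bounded_linear_right\<close>)
  then obtain B where B: "\<And>\<eta> \<xi>. cinner \<eta> (blinfun_apply a \<xi>) = cinner (B \<eta>) \<xi>" by metis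
  have B': "cinner (blinfun_apply a \<xi>) \<eta> = cinner \<xi> (B \<eta>)" for \<xi> \<eta>
    using B[of \<eta> \<xi>] cinner_commute by metis
  have "bounded_linear B"
  proof (rule bounded_linear_intro[where K = "norm a"])
    show "B (x + y) = B x + B y" for x y
      by (rule cinner_ext) (simp add: B'[symmetric] cinner_add_right)
    show "B (r *\<^sub>R x) = r *\<^sub>R B x" for r x
      by (rule cinner_ext) (simp add: B'[symmetric] cinner_scaleR_right)
    \<comment> \<open>Cancel one factor in \<parallel>B x\<parallel>^2 = \<langle>a (B x),
      x\<rangle> \<le> \<parallel>a\<parallel> \<parallel>B x\<parallel>
      \<parallel>x\<parallel>.\<close>
    show "norm (B x) \<le> norm x * norm a" for x
    proof -
      have "(norm (B x))\<^sup>2 = cmod (cinner (B x) (B x))" by (simp add: cinner_self norm_power)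
      also have "\<dots> = cmod (cinner (blinfun_apply a (B x)) x)" by (simp add: B')
      also have "\<dots> \<le> norm a * norm (B x) * norm x"
        by (rule order_trans[OF cmod_cinner_le]) (simp add: mult_right_mono norm_blinfun)
      finally show ?thesis
        by (cases "B x = 0") (auto simp: power2_eq_square mult_ac)
    qed
  qed
  then show ?thesis
    using B' by (intro exI[of _ "Blinfun B"]) (simp add: bounded_linear_Blinfun_apply)
qed

lemma hilbert_adj_eqI:
  assumes "\<And>\<xi> \<eta>. cinner (blinfun_apply a \<xi>) \<eta> = cinner \<xi> (blinfun_apply b \<eta>)"
  shows "hilbert_adj a = b"
  unfolding hilbert_adj_def
proof (rule the_equality)
  fix b' assume "\<forall>\<xi> \<eta>. cinner (blinfun_apply a \<xi>) \<eta> = cinner \<xi> (blinfun_apply b' \<eta>)"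
  then have "cinner \<xi> (blinfun_apply b' \<eta>) = cinner \<xi> (blinfun_apply b \<eta>)" for \<xi> \<eta>
    using assms by simp
  then have "blinfun_apply b' \<eta> = blinfun_apply b \<eta>" for \<eta> by (rule cinner_ext)
  then show "b' = b" by (rule blinfun_eqI)
qed (use assms in blast)

lemma cinner_hilbert_adj:
  assumes "complex_linear a"
  shows "cinner (blinfun_apply a \<xi>) \<eta> = cinner \<xi> (blinfun_apply (hilbert_adj a) \<eta>)"
proof -
  obtain b where b: "\<And>\<xi> \<eta>. cinner (blinfun_apply a \<xi>) \<eta> = cinner \<xi> (blinfun_apply b \<eta>)"
    using adjoint_exists[OF assms] by blast
  show ?thesis using b hilbert_adj_eqI[OF b] by simp
qed

lemma complex_linear_adj:
  assumes "\<And>\<xi> \<eta>. cinner (blinfun_apply a \<xi>) \<eta> = cinner \<xi> (blinfun_apply b \<eta>)"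
  shows "complex_linear b"
  unfolding complex_linear_def
proof (intro allI)
  show "blinfun_apply b (c *\<^sub>C \<xi>) = c *\<^sub>C blinfun_apply b \<xi>" for c \<xi>
    by (rule cinner_ext) (simp add: assms[symmetric] cinner_scaleC_right)
qed

lemma hilbert_adj_adj:
  assumes "complex_linear a"
  shows "hilbert_adj (hilbert_adj a) = a"
proof (rule hilbert_adj_eqI)
  show "cinner (blinfun_apply (hilbert_adj a) \<xi>) \<eta> = cinner \<xi> (blinfun_apply a \<eta>)" for \<xi> \<eta>
    using cinner_hilbert_adj[OF assms, of \<eta> \<xi>]
      cinner_commute[of "blinfun_apply (hilbert_adj a) \<xi>" \<eta>] cinner_commute[of \<xi> "blinfun_apply a \<eta>"]
    by simp
qed

lemma complex_linear_sum:
  assumes "complex_linear a"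
  shows "blinfun_apply a (\<Sum>j\<in>J. v j *\<^sub>C \<xi> j) = (\<Sum>j\<in>J. v j *\<^sub>C blinfun_apply a (\<xi> j))"
  using assms by (simp add: blinfun.sum_right complex_linear_def)

section \<open>Gram-Schmidt and compactness for arbitrary inner products\<close>

section \<open>Inner products on finite-dimensional spaces\<close>

text \<open>Gram-Schmidt for an inner product G unrelated to the norm of the type; it serves both
  the standard inner product and the metric at a point.\<close>

lemma orthonormal_basis_exists:
  fixes G :: "'e::real_vector \<Rightarrow> 'e \<Rightarrow> real"
  assumes bil: "bilinear G" and sym: "\<And>v w. G v w = G w v" and pos: "\<And>v. v \<noteq> 0 \<Longrightarrow> 0 < G v v"
    and "finite B"
  shows "\<exists>E. finite E \<and> span E = span B \<and> (\<forall>u\<in>E. \<forall>v\<in>E. G u v = (if u = v then 1 else 0))"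
  using \<open>finite B\<close>
proof induction
  case empty
  then show ?case by (intro exI[of _ "{}"]) auto
next
  case (insert b B)
  then obtain E where E: "finite E" "span E = span B"
    and on: "\<And>u v. u \<in> E \<Longrightarrow> v \<in> E \<Longrightarrow> G u v = (if u = v then 1 else 0)" by blast
  define p where "p = (\<Sum>e\<in>E. G b e *\<^sub>R e)"
  define w where "w = b - p"
  have p: "p \<in> span E" unfolding p_def by (intro span_sum span_scale span_base)
  have Gp: "G p e = G b e" if "e \<in> E" for e
  proof -
    have "G p e = (\<Sum>u\<in>E. G b u * G u e)"
      unfolding p_def using bilinear_sum[OF bil, of "\<lambda>e. G b e *\<^sub>R e" E]
      by (simp add: bilinear_lmul[OF bil] linear_sum[of "\<lambda>x. G x e"] bil[unfolded bilinear_def])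
    also have "\<dots> = (\<Sum>u\<in>E. if u = e then G b u else 0)"
      using on that by (intro sum.cong) auto
    also have "\<dots> = G b e" using E(1) that by simp
    finally show ?thesis .
  qed
  have Gw: "G w e = 0" if "e \<in> E" for e
    using Gp[OF that] by (simp add: w_def bilinear_lsub[OF bil])
  show ?case
  proof (cases "w = 0")
    case True
    then have "b \<in> span B" using p E(2) by (simp add: w_def)
    then have "span (insert b B) = span B" by (rule span_redundant)
    then show ?thesis using E on by auto
  next
    case False
    define r where "r = 1 / sqrt (G w w)"
    have r: "r \<noteq> 0" "r * (r * G w w) = 1"
      using pos[OF False] by (auto simp: r_def real_div_sqrt)
    have sp: "span (insert (r *\<^sub>R w) E) = span (insert b B)"
    proof -
      have "span (insert (r *\<^sub>R w) E) = span (insert w E)"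
      proof (rule span_eq[THEN iffD2], intro conjI subsetI)
        fix x assume "x \<in> insert (r *\<^sub>R w) E"
        then show "x \<in> span (insert w E)" by (auto intro: span_scale span_base)
      next
        fix x assume "x \<in> insert w E"
        moreover have "w = (1 / r) *\<^sub>R (r *\<^sub>R w)" using r by simp
        then have "w \<in> span (insert (r *\<^sub>R w) E)" by (metis insertI1 span_base span_scale)
        ultimately show "x \<in> span (insert (r *\<^sub>R w) E)" by (auto intro: span_base)
      qed
      also have "\<dots> = span (insert b E)"
        by (rule eq_span_insert_eq) (use p in \<open>simp add: w_def span_neg\<close>)
      also have "\<dots> = span (insert b B)" using E(2) by (simp add: span_insert)
      finally show ?thesis .
    qed
    have "G u v = (if u = v then 1 else 0)" if u: "u \<in> insert (r *\<^sub>R w) E" and v: "v \<in> insert (r *\<^sub>R w) E" for u v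
    proof -
      have 1: "G (r *\<^sub>R w) (r *\<^sub>R w) = 1"
        using r by (simp add: bilinear_lmul[OF bil] bilinear_rmul[OF bil])
      have 2: "G (r *\<^sub>R w) e = 0" "G e (r *\<^sub>R w) = 0" if "e \<in> E" for e
        using Gw[OF that] sym[of e] by (simp_all add: bilinear_lmul[OF bil])
      have 3: "r *\<^sub>R w \<noteq> e" if "e \<in> E" for e
        using 1 2[OF that] by auto
      show ?thesis using u v on 1 2 3 by auto
    qed
    then show ?thesis using sp E(1) by (intro exI[of _ "insert (r *\<^sub>R w) E"]) blast
  qed
qed

text \<open>The source of compactness in coordinate space: a cube over \<open>insert b E\<close> is
  the continuous image of an interval times a cube over E.\<close>

lemma compact_cube_span:
  fixes E :: "'e::real_normed_vector set"
  assumes "finite E"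
  shows "compact {v. \<exists>a. (\<forall>e\<in>E. \<bar>a e\<bar> \<le> r) \<and> v = (\<Sum>e\<in>E. a e *\<^sub>R e)}"
  using assms
proof induction
  case empty
  then show ?case by simp
next
  case (insert b E)
  let ?C = "{v. \<exists>a. (\<forall>e\<in>E. \<bar>a e\<bar> \<le> r) \<and> v = (\<Sum>e\<in>E. a e *\<^sub>R e)}"
  have "compact ((\<lambda>(t, v). t *\<^sub>R b + v) ` ({-r..r} \<times> ?C))"
    using insert.IH by (intro compact_continuous_image compact_Times)
      (auto intro!: continuous_intros simp: split_beta)
  also have "(\<lambda>(t, v). t *\<^sub>R b + v) ` ({-r..r} \<times> ?C)
      = {v. \<exists>a. (\<forall>e\<in>insert b E. \<bar>a e\<bar> \<le> r) \<and> v = (\<Sum>e\<in>insert b E. a e *\<^sub>R e)}" (is "?L = ?R")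
  proof (intro equalityI subsetI)
    fix v assume "v \<in> ?L"
    then obtain t a where "t \<in> {-r..r}" "\<forall>e\<in>E. \<bar>a e\<bar> \<le> r" "v = t *\<^sub>R b + (\<Sum>e\<in>E. a e *\<^sub>R e)"
      by fastforce
    moreover have "(\<Sum>e\<in>E. (a(b := t)) e *\<^sub>R e) = (\<Sum>e\<in>E. a e *\<^sub>R e)"
      using insert.hyps by (intro sum.cong) auto
    ultimately show "v \<in> ?R"
      using insert.hyps by (intro CollectI exI[of _ "a(b := t)"]) (auto simp: abs_le_iff)
  next
    fix v assume "v \<in> ?R"
    then obtain a where a: "\<forall>e\<in>insert b E. \<bar>a e\<bar> \<le> r" "v = (\<Sum>e\<in>insert b E. a e *\<^sub>R e)" by blast
    then show "v \<in> ?L"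
      using insert.hyps
      by (intro image_eqI[of _ _ "(a b, \<Sum>e\<in>E. a e *\<^sub>R e)"]) (auto simp: abs_le_iff)
  qed
  finally show ?case .
qed

text \<open>One interface for the standard inner product and for the metric at each point, with a
  frame that makes coordinates explicit.\<close>

locale inner_form =
  fixes G :: "'e::real_normed_vector \<Rightarrow> 'e \<Rightarrow> real" and E :: "'e set"
  assumes bil: "bilinear G" and sym: "G v w = G w v"
    and fin: "finite E" and spanE: "span E = UNIV"
    and orthonormal: "u \<in> E \<Longrightarrow> v \<in> E \<Longrightarrow> G u v = (if u = v then 1 else 0)"
begin

definition N :: "'e \<Rightarrow> real" where "N v = sqrt (G v v)"

lemmas G_simps = bilinear_ladd[OF bil] bilinear_radd[OF bil] bilinear_lmul[OF bil]
  bilinear_rmul[OF bil] bilinear_lsub[OF bil] bilinear_rsub[OF bil] bilinear_lneg[OF bil]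
  bilinear_rneg[OF bil] bilinear_lzero[OF bil] bilinear_rzero[OF bil]

lemma linear_G_left: "linear (\<lambda>v. G v w)" and linear_G_right: "linear (G v)"
  using bil by (simp_all add: bilinear_def)

lemma expand: "v = (\<Sum>e\<in>E. G v e *\<^sub>R e)"
proof -
  have "v \<in> span E" by (simp add: spanE)
  then show ?thesis
  proof (induction rule: span_induct_alt)
    case base
    then show ?case by (simp add: G_simps)
  next
    case (step c x y)
    have "(\<Sum>e\<in>E. G x e *\<^sub>R e) = (\<Sum>e\<in>E. if x = e then e else 0)"
      using step(1) orthonormal by (intro sum.cong) auto
    also have "\<dots> = x" using fin step(1) by simp
    finally have "(\<Sum>e\<in>E. G (c *\<^sub>R x + y) e *\<^sub>R e) = c *\<^sub>R x + (\<Sum>e\<in>E. G y e *\<^sub>R e)"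
      by (simp add: G_simps scaleR_add_left sum.distrib flip: scaleR_scaleR scaleR_sum_right)
    then show ?case using step(2) by simp
  qed
qed

lemma linear_expand:
  assumes "linear f"
  shows "f v = (\<Sum>e\<in>E. G v e *\<^sub>R f e)"
  by (subst expand) (simp add: linear_sum[OF assms] linear_cmul[OF assms])

lemma G_expand: "G v w = (\<Sum>e\<in>E. G v e * G w e)"
  using linear_expand[OF linear_G_left, of v w] by (simp add: sym[of _ w])

text \<open>Through this, Cauchy-Schwarz and the triangle inequality are inherited from
  \<open>L2_set\<close>.\<close>

lemma N_L2: "N v = L2_set (G v) E"
  unfolding N_def L2_set_def by (subst G_expand) (simp add: power2_eq_square)

lemma G_self_nonneg: "0 \<le> G v v"
  by (subst G_expand) (simp add: sum_nonneg)

lemma N_sq: "(N v)\<^sup>2 = G v v"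
  by (simp add: N_def G_self_nonneg)

lemma N_nonneg: "0 \<le> N v"
  by (simp add: N_def G_self_nonneg)

lemma G_le: "\<bar>G v w\<bar> \<le> N v * N w"
proof -
  have "\<bar>G v w\<bar> \<le> (\<Sum>e\<in>E. \<bar>G v e\<bar> * \<bar>G w e\<bar>)"
    by (subst G_expand) (simp add: sum_abs[THEN order_trans] abs_mult)
  then show ?thesis unfolding N_L2 using L2_set_mult_ineq order_trans by blast
qed

lemma N_triangle: "N (v + w) \<le> N v + N w"
proof -
  have "G (v + w) = (\<lambda>e. G v e + G w e)" by (simp add: fun_eq_iff G_simps)
  then show ?thesis by (simp add: N_L2 L2_set_triangle_ineq)
qed

lemma N_scaleR: "N (c *\<^sub>R v) = \<bar>c\<bar> * N v"
  by (simp add: N_def G_simps real_sqrt_mult flip: mult.assoc)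

lemma N_minus: "N (- v) = N v"
  by (simp add: N_def G_simps)

lemma N_minus_commute: "N (v - w) = N (w - v)"
  by (metis N_minus minus_diff_eq)

lemma N_0: "N 0 = 0"
  by (simp add: N_def G_simps)

lemma N_frame: "e \<in> E \<Longrightarrow> N e = 1"
  by (simp add: N_def orthonormal)

lemma coord_le: "e \<in> E \<Longrightarrow> \<bar>G v e\<bar> \<le> N v"
  using G_le[of v e] by (simp add: N_frame)

lemma norm_linear_le:
  fixes f :: "'e \<Rightarrow> 'b::real_normed_vector"
  assumes "linear f"
  shows "norm (f v) \<le> N v * (\<Sum>e\<in>E. norm (f e))"
proof -
  have "norm (f v) \<le> (\<Sum>e\<in>E. \<bar>G v e\<bar> * norm (f e))"
    by (subst linear_expand[OF assms]) (simp add: norm_sum[THEN order_trans])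
  also have "\<dots> \<le> (\<Sum>e\<in>E. N v * norm (f e))"
    by (intro sum_mono mult_right_mono coord_le) auto
  finally show ?thesis by (simp add: sum_distrib_left)
qed

lemma norm_le_N: "norm v \<le> N v * (\<Sum>e\<in>E. norm e)"
  using norm_linear_le[of "\<lambda>x. x"] by (simp add: linear_iff)

text \<open>Coordinates are bounded by N, so the ball is a translate of a closed subset of a
  cube.\<close>

lemma compact_N_cball: "continuous_on UNIV N \<Longrightarrow> compact {v. N (v - a) \<le> r}"
proof -
  assume cont: "continuous_on UNIV N"
  let ?C = "{v. \<exists>a. (\<forall>e\<in>E. \<bar>a e\<bar> \<le> r) \<and> v = (\<Sum>e\<in>E. a e *\<^sub>R e)}"
  have "{v. N v \<le> r} \<subseteq> ?C"
  proof safe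
    fix v assume v: "N v \<le> r"
    then show "\<exists>a. (\<forall>e\<in>E. \<bar>a e\<bar> \<le> r) \<and> v = (\<Sum>e\<in>E. a e *\<^sub>R e)"
      using expand[of v] coord_le[of _ v] by (intro exI[of _ "G v"]) (auto intro: order_trans)
  qed
  moreover have "closed {v. N v \<le> r}"
    using cont by (intro closed_Collect_le) (auto intro: continuous_on_const)
  ultimately have "compact {v. N v \<le> r}"
    using compact_Int_closed[OF compact_cube_span[OF fin, of r], of "{v. N v \<le> r}"]
    by (simp add: Int_absorb1)
  then have "compact ((+) a ` {v. N v \<le> r})" by (rule compact_translation)
  also have "(+) a ` {v. N v \<le> r} = {v. N (v - a) \<le> r}"
  proof (intro equalityI subsetI)
    fix v assume "v \<in> {v. N (v - a) \<le> r}"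
    then show "v \<in> (+) a ` {v. N v \<le> r}" by (intro image_eqI[of _ _ "v - a"]) simp_all
  qed auto
  finally show ?thesis .
qed

end

section \<open>C1 maps and their differentials in charts\<close>

section \<open>Calculus on a manifold\<close>

lemma Ck_on_1I:
  assumes "\<And>p. p \<in> S \<Longrightarrow> (f has_derivative f' p) (at p)"
    and "\<And>v. continuous_on S (\<lambda>p. f' p v)"
  shows "Ck_on 1 S f"
proof -
  have "frechet_derivative f (at p) = f' p" if "p \<in> S" for p
    using assms(1)[OF that] by (metis frechet_derivative_at)
  then have "continuous_on S (\<lambda>p. frechet_derivative f (at p) v)" for v
    using assms(2)[of v] by (auto cong: continuous_on_cong)
  then show ?thesis using assms(1) by (auto simp: differentiable_def)
qed

lemma Ck_on_1D:
  assumes "Ck_on 1 S f"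
  shows "p \<in> S \<Longrightarrow> (f has_derivative frechet_derivative f (at p)) (at p)"
    and "continuous_on S (\<lambda>p. frechet_derivative f (at p) v)"
  using assms by (auto simp: frechet_derivative_works)

lemma Ck_on_1_continuous: "Ck_on 1 S f \<Longrightarrow> continuous_on S f"
  by (meson Ck_on_1D(1) continuous_at_imp_continuous_on has_derivative_continuous)

lemma Ck_on_1_local:
  assumes "\<And>p. p \<in> S \<Longrightarrow> \<exists>V. open V \<and> p \<in> V \<and> Ck_on 1 V f"
  shows "Ck_on 1 S f"
proof (rule Ck_on_1I)
  fix p assume "p \<in> S"
  then show "(f has_derivative frechet_derivative f (at p)) (at p)"
    using assms Ck_on_1D(1) by blast
next
  fix v
  show "continuous_on S (\<lambda>p. frechet_derivative f (at p) v)"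
  proof (rule continuous_at_imp_continuous_on, rule ballI)
    fix p assume "p \<in> S"
    then obtain V where V: "open V" "p \<in> V" "Ck_on 1 V f" using assms by blast
    show "isCont (\<lambda>p. frechet_derivative f (at p) v) p"
      using Ck_on_1D(2)[OF V(3), of v] V(1,2) by (simp add: continuous_on_eq_continuous_at)
  qed
qed

lemma Ck_on_1_mono: "Ck_on 1 S f \<Longrightarrow> T \<subseteq> S \<Longrightarrow> Ck_on 1 T f"
  by (auto intro: continuous_on_subset)

declare Ck_on.simps(2) [simp del]

lemma Ck_on_1_cong:
  assumes "open S" "\<And>p. p \<in> S \<Longrightarrow> f p = h p" "Ck_on 1 S f"
  shows "Ck_on 1 S h"
proof (rule Ck_on_1I[where f' = "\<lambda>p. frechet_derivative f (at p)"])
  show "(h has_derivative frechet_derivative f (at p)) (at p)" if "p \<in> S" for p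
    using has_derivative_transform_within_open[OF Ck_on_1D(1)[OF assms(3) that] assms(1) that] assms(2)
    by blast
qed (use Ck_on_1D(2)[OF assms(3)] in blast)

text \<open>\<open>diff_at\<close> is the case of the chart chosen at the point. Since that choice
  varies arbitrarily with the point, continuity of a derivative is expressed in a fixed
  chart.\<close>

definition der :: "('m, 'e::real_normed_vector) chart \<Rightarrow> ('m \<Rightarrow> 'b::real_normed_vector) \<Rightarrow> 'm \<Rightarrow> 'e \<Rightarrow> 'b"
  where "der c f x = frechet_derivative (local_rep c f) (at (snd c x))"

lemma der_eqI: "(local_rep c f has_derivative L) (at (snd c x)) \<Longrightarrow> der c f x = L"
  unfolding der_def by (metis frechet_derivative_at)

locale smooth_manifold =
  fixes A :: "('m::{t2_space,second_countable_topology}, 'e::real_inner) chart set"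
  assumes atlas: "smooth_atlas A"
begin

definition ob :: "'e set" where
  "ob = (SOME B. finite B \<and> span B = UNIV \<and> (\<forall>u\<in>B. \<forall>v\<in>B. u \<bullet> v = (if u = v then 1 else 0)))"

lemma finite_span: "\<exists>B::'e set. finite B \<and> span B = UNIV"
  using atlas by (simp add: smooth_atlas_def)

lemma bilinear_inner: "bilinear ((\<bullet>) :: 'e \<Rightarrow> 'e \<Rightarrow> real)"
  by (simp add: bilinear_def linear_iff inner_add_left inner_add_right)

lemma ob: "finite ob \<and> span ob = UNIV \<and> (\<forall>u\<in>ob. \<forall>v\<in>ob. u \<bullet> v = (if u = v then 1 else 0))"
  unfolding ob_def
proof (rule someI_ex)
  obtain B :: "'e set" where "finite B" "span B = UNIV" using finite_span by blast
  then show "\<exists>B::'e set. finite B \<and> span B = UNIV \<and> (\<forall>u\<in>B. \<forall>v\<in>B. u \<bullet> v = (if u = v then 1 else 0))"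
    using orthonormal_basis_exists[OF bilinear_inner inner_commute, of B] by auto
qed

sublocale std: inner_form "(\<bullet>)" ob
  by unfold_locales (use ob in \<open>auto simp: bilinear_inner inner_commute\<close>)

lemma std_N: "std.N v = norm v"
  by (simp add: std.N_def norm_eq_sqrt_inner)

lemma linear_bounded: "linear (f :: 'e \<Rightarrow> 'b::real_normed_vector) \<Longrightarrow> bounded_linear f"
  using std.norm_linear_le[of f] unfolding std_N linear_iff
  by (intro bounded_linear_intro[where K = "\<Sum>e\<in>ob. norm (f e)"]) auto

lemma Ck_on_1_compose:
  fixes f :: "'e \<Rightarrow> 'e" and h :: "'e \<Rightarrow> 'b::real_normed_vector"
  assumes f: "Ck_on 1 S f" and h: "Ck_on 1 T h" and sub: "f ` S \<subseteq> T"
  shows "Ck_on 1 S (\<lambda>p. h (f p))"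
proof (rule Ck_on_1I)
  let ?f' = "\<lambda>p. frechet_derivative f (at p)" and ?h' = "\<lambda>p. frechet_derivative h (at p)"
  show "((\<lambda>p. h (f p)) has_derivative (\<lambda>v. ?h' (f p) (?f' p v))) (at p)" if "p \<in> S" for p
    using diff_chain_at[OF Ck_on_1D(1)[OF f that] Ck_on_1D(1)[OF h, of "f p"]] sub that
    by (auto simp: o_def)
  have lin: "linear (?h' (f p))" if "p \<in> S" for p
    using Ck_on_1D(1)[OF h, of "f p"] sub that by (auto dest: has_derivative_linear)
  show "continuous_on S (\<lambda>p. ?h' (f p) (?f' p v))" for v
  proof -
    \<comment> \<open>The derivative of h is continuous for each fixed direction, so the varying
      direction is expanded in the basis.\<close>
    have "continuous_on S (\<lambda>p. \<Sum>b\<in>ob. (?f' p v \<bullet> b) *\<^sub>R ?h' (f p) b)"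
      by (intro continuous_intros Ck_on_1D(2)[OF f]
          continuous_on_compose2[OF Ck_on_1D(2)[OF h] Ck_on_1_continuous[OF f] sub])
    then show ?thesis
      by (rule continuous_on_eq) (simp add: std.linear_expand[OF lin])
  qed
qed

lemma chart_exists: "\<exists>c\<in>A. x \<in> fst c"
  using atlas UNIV_I[of x] unfolding smooth_atlas_def by blast

lemma chart_at: "chart_at A x \<in> A" "x \<in> fst (chart_at A x)"
  using someI_ex[of "\<lambda>c. c \<in> A \<and> x \<in> fst c"] chart_exists[of x]
  unfolding chart_at_def Bex_def by blast+

definition inv_chart :: "('m, 'e) chart \<Rightarrow> 'e \<Rightarrow> 'm" where
  "inv_chart c = inv_into (fst c) (snd c)"

context
  fixes c assumes c: "c \<in> A"
begin

lemma open_dom: "open (fst c)" and open_chart_image: "open (chart_image c)"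
  and homeo: "homeomorphism (fst c) (chart_image c) (snd c) (inv_chart c)"
  using atlas c unfolding smooth_atlas_def inv_chart_def by blast+

lemma inv_chart_coord: "x \<in> fst c \<Longrightarrow> inv_chart c (snd c x) = x"
  and coord_inv_chart: "p \<in> chart_image c \<Longrightarrow> snd c (inv_chart c p) = p"
  and coord_in: "x \<in> fst c \<Longrightarrow> snd c x \<in> chart_image c"
  and inv_chart_in: "p \<in> chart_image c \<Longrightarrow> inv_chart c p \<in> fst c"
  using homeo unfolding homeomorphism_def by blast+

lemma continuous_coord: "continuous_on (fst c) (snd c)"
  and continuous_inv_chart: "continuous_on (chart_image c) (inv_chart c)"
  using homeo unfolding homeomorphism_def by blast+

lemma open_coord:
  assumes "open U" "U \<subseteq> fst c"
  shows "open (snd c ` U)"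
proof -
  have "openin (top_of_set (chart_image c)) (snd c ` U)"
    using homeomorphism_imp_open_map[OF homeo, of U] assms open_dom
    by (simp add: openin_open_eq)
  then show ?thesis using open_chart_image openin_open_trans by blast
qed

lemma open_coord_preimage: "open V \<Longrightarrow> open {x \<in> fst c. snd c x \<in> V}"
  using continuous_open_preimage[OF continuous_coord open_dom, of V] by (simp add: vimage_def Int_def)

lemma local_rep_coord: "x \<in> fst c \<Longrightarrow> local_rep c f (snd c x) = f x"
  using inv_chart_coord by (simp add: local_rep_def inv_chart_def)

lemma compact_inv_chart: "compact K \<Longrightarrow> K \<subseteq> chart_image c \<Longrightarrow> compact (inv_chart c ` K)"
  using continuous_on_subset[OF continuous_inv_chart] by (blast intro: compact_continuous_image)

lemma has_der_local:
  assumes U: "open U" "x \<in> U" "x \<in> fst c" and eq: "\<And>y. y \<in> U \<Longrightarrow> f y = h y"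
    and f: "(local_rep c f has_derivative L) (at (snd c x))"
  shows "(local_rep c h has_derivative L) (at (snd c x))"
proof (rule has_derivative_transform_within_open[OF f])
  show "open (snd c ` (U \<inter> fst c))" using U open_dom by (intro open_coord) auto
  show "snd c x \<in> snd c ` (U \<inter> fst c)" using U by blast
  show "local_rep c f p = local_rep c h p" if "p \<in> snd c ` (U \<inter> fst c)" for p
    using that eq by (auto simp: local_rep_coord)
qed

end

lemma transition_Ck: "c \<in> A \<Longrightarrow> d \<in> A \<Longrightarrow> Ck_on k (snd c ` (fst c \<inter> fst d)) (local_rep c (snd d))"
  using atlas unfolding smooth_atlas_def by blast

lemma transition_has_der:
  assumes "c \<in> A" "d \<in> A" "x \<in> fst c" "x \<in> fst d"
  shows "(local_rep c (snd d) has_derivative der c (snd d) x) (at (snd c x))"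
  unfolding der_def using assms by (intro Ck_on_1D(1)[OF transition_Ck]) auto

lemma has_der_transfer:
  assumes c: "c \<in> A" and d: "d \<in> A" and x: "x \<in> fst c" "x \<in> fst d"
    and f: "(local_rep d f has_derivative L) (at (snd d x))"
  shows "(local_rep c f has_derivative (\<lambda>v. L (der c (snd d) x v))) (at (snd c x))"
proof -
  have "((\<lambda>p. local_rep d f (local_rep c (snd d) p)) has_derivative
      (\<lambda>v. L (der c (snd d) x v))) (at (snd c x))"
    using diff_chain_at[OF transition_has_der[OF c d x], of "local_rep d f" L] f
    by (simp add: o_def local_rep_coord[OF c x(1)])
  then show ?thesis
  proof (rule has_derivative_transform_within_open)
    show "open (snd c ` (fst c \<inter> fst d))" using c d by (intro open_coord) (auto intro: open_dom)
    show "snd c x \<in> snd c ` (fst c \<inter> fst d)" using x by blast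
    show "local_rep d f (local_rep c (snd d) p) = local_rep c f p" if "p \<in> snd c ` (fst c \<inter> fst d)" for p
      using that by (auto simp: local_rep_coord[OF c] local_rep_coord[OF d])
  qed
qed

text \<open>\<open>C1_map\<close> quantifies over all charts, but composition with the smooth
  transition maps carries the property over from one chart around each point.\<close>

lemma C1_map_localI:
  assumes "\<And>x. \<exists>c\<in>A. \<exists>U. open U \<and> x \<in> U \<and> U \<subseteq> fst c \<and> Ck_on 1 (snd c ` U) (local_rep c f)"
  shows "C1_map A f"
  unfolding C1_map_def
proof (intro ballI Ck_on_1_local)
  fix d p assume d: "d \<in> A" and p: "p \<in> chart_image d"
  define x where "x = inv_chart d p"
  have x: "x \<in> fst d" "snd d x = p" using d p by (simp_all add: x_def inv_chart_in coord_inv_chart)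
  obtain c U where c: "c \<in> A" and U: "open U" "x \<in> U" "U \<subseteq> fst c" "Ck_on 1 (snd c ` U) (local_rep c f)"
    using assms by blast
  define V where "V = snd d ` (U \<inter> fst d)"
  have V: "open V" unfolding V_def using U(1) d by (intro open_coord) (auto intro: open_dom)
  have "Ck_on 1 V (\<lambda>p. local_rep c f (local_rep d (snd c) p))"
    using d c U unfolding V_def
    by (intro Ck_on_1_compose[OF Ck_on_1_mono[OF transition_Ck[OF d c]] U(4)])
      (auto simp: local_rep_coord)
  then have "Ck_on 1 V (local_rep d f)"
    by (rule Ck_on_1_cong[OF V, rotated])
      (use U c d in \<open>auto simp: V_def local_rep_coord\<close>)
  then show "\<exists>V. open V \<and> p \<in> V \<and> Ck_on 1 V (local_rep d f)"
    using V x U(2) unfolding V_def by blast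
qed

lemma C1_map_has_der:
  "C1_map A f \<Longrightarrow> c \<in> A \<Longrightarrow> x \<in> fst c \<Longrightarrow> (local_rep c f has_derivative der c f x) (at (snd c x))"
  unfolding der_def C1_map_def by (rule Ck_on_1D(1)[of "chart_image c"]) (auto simp: coord_in)

lemma der_transfer:
  assumes "C1_map A f" "c \<in> A" "d \<in> A" "x \<in> fst c" "x \<in> fst d"
  shows "der c f x v = der d f x (der c (snd d) x v)"
  using der_eqI[OF has_der_transfer[OF assms(2-5) C1_map_has_der[OF assms(1,3,5)]]] by simp

lemma C1_map_continuous:
  assumes f: "C1_map A f"
  shows "continuous_on UNIV f"
proof (rule continuous_at_imp_continuous_on, rule ballI)
  fix x
  obtain c where c: "c \<in> A" "x \<in> fst c" using chart_exists by blast
  have "continuous_on (fst c) (\<lambda>y. local_rep c f (snd c y))"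
    using f c(1) unfolding C1_map_def
    by (intro continuous_on_compose2[OF Ck_on_1_continuous continuous_coord[OF c(1)]])
      (auto simp: coord_in)
  then have "continuous_on (fst c) f"
    by (rule continuous_on_eq) (simp add: local_rep_coord[OF c(1)])
  then show "isCont f x"
    using c by (simp add: continuous_on_eq_continuous_at open_dom)
qed

lemma C1_mapI:
  assumes "\<And>c x. c \<in> A \<Longrightarrow> x \<in> fst c \<Longrightarrow> (local_rep c f has_derivative D c x) (at (snd c x))"
    and "\<And>c v. c \<in> A \<Longrightarrow> continuous_on (fst c) (\<lambda>x. D c x v)"
  shows "C1_map A f"
  unfolding C1_map_def
proof (intro ballI Ck_on_1I)
  fix c p assume c: "c \<in> A" "p \<in> chart_image c"
  then show "(local_rep c f has_derivative D c (inv_chart c p)) (at p)"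
    using assms(1)[OF c(1), of "inv_chart c p"] by (simp add: coord_inv_chart inv_chart_in)
next
  fix c v assume c: "c \<in> A"
  show "continuous_on (chart_image c) (\<lambda>p. D c (inv_chart c p) v)"
    by (rule continuous_on_compose2[OF assms(2)[OF c] continuous_inv_chart[OF c]])
      (use c inv_chart_in in blast)
qed

lemma C1_map_continuous_der:
  assumes "C1_map A f" "c \<in> A"
  shows "continuous_on (fst c) (\<lambda>x. der c f x v)"
  unfolding der_def
  by (rule continuous_on_compose2[OF Ck_on_1D(2)[of "chart_image c"] continuous_coord[OF assms(2)]])
    (use assms in \<open>auto simp: C1_map_def coord_in\<close>)

lemma C1_map_bilinear:
  assumes b: "bounded_bilinear b" and f: "C1_map A f" and h: "C1_map A h"
  shows "C1_map A (\<lambda>x. b (f x) (h x))"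
    and "c \<in> A \<Longrightarrow> x \<in> fst c \<Longrightarrow> der c (\<lambda>x. b (f x) (h x)) x v = b (f x) (der c h x v) + b (der c f x v) (h x)"
proof -
  interpret b: bounded_bilinear b by (rule b)
  have *: "(local_rep c (\<lambda>x. b (f x) (h x)) has_derivative
      (\<lambda>v. b (f x) (der c h x v) + b (der c f x v) (h x))) (at (snd c x))"
    if "c \<in> A" "x \<in> fst c" for c x
    using b.FDERIV[OF C1_map_has_der[OF f that] C1_map_has_der[OF h that]] that
    by (simp add: local_rep_coord) (simp add: local_rep_def o_def)
  show "C1_map A (\<lambda>x. b (f x) (h x))"
    by (rule C1_mapI[OF *])
      (auto intro!: continuous_intros b.continuous_on C1_map_continuous_der f h
        continuous_on_subset[OF C1_map_continuous[OF f]] continuous_on_subset[OF C1_map_continuous[OF h]])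
  show "c \<in> A \<Longrightarrow> x \<in> fst c \<Longrightarrow> der c (\<lambda>x. b (f x) (h x)) x v = b (f x) (der c h x v) + b (der c f x v) (h x)"
    using der_eqI[OF *] by simp
qed

lemma C1_map_add:
  assumes f: "C1_map A f" and h: "C1_map A h"
  shows "C1_map A (\<lambda>x. f x + h x)"
    and "c \<in> A \<Longrightarrow> x \<in> fst c \<Longrightarrow> der c (\<lambda>x. f x + h x) x v = der c f x v + der c h x v"
proof -
  have *: "(local_rep c (\<lambda>x. f x + h x) has_derivative (\<lambda>v. der c f x v + der c h x v)) (at (snd c x))"
    if "c \<in> A" "x \<in> fst c" for c x
    using has_derivative_add[OF C1_map_has_der[OF f that] C1_map_has_der[OF h that]]
    by (simp add: local_rep_def o_def)
  show "C1_map A (\<lambda>x. f x + h x)"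
    by (rule C1_mapI[OF *]) (auto intro!: continuous_intros C1_map_continuous_der f h)
  show "c \<in> A \<Longrightarrow> x \<in> fst c \<Longrightarrow> der c (\<lambda>x. f x + h x) x v = der c f x v + der c h x v"
    using der_eqI[OF *] by simp
qed

lemma C1_map_linear:
  assumes b: "bounded_linear b" and f: "C1_map A f"
  shows "C1_map A (\<lambda>x. b (f x))"
    and "c \<in> A \<Longrightarrow> x \<in> fst c \<Longrightarrow> der c (\<lambda>x. b (f x)) x v = b (der c f x v)"
proof -
  have *: "(local_rep c (\<lambda>x. b (f x)) has_derivative (\<lambda>v. b (der c f x v))) (at (snd c x))"
    if "c \<in> A" "x \<in> fst c" for c x
    using bounded_linear.has_derivative[OF b C1_map_has_der[OF f that]]
    by (simp add: local_rep_def o_def)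
  show "C1_map A (\<lambda>x. b (f x))"
    by (rule C1_mapI[OF *]) (auto intro!: bounded_linear.continuous_on[OF b] C1_map_continuous_der f)
  show "c \<in> A \<Longrightarrow> x \<in> fst c \<Longrightarrow> der c (\<lambda>x. b (f x)) x v = b (der c f x v)"
    using der_eqI[OF *] by simp
qed

lemma C1_map_real:
  fixes f :: "'m \<Rightarrow> real"
  assumes q: "\<And>t. (q has_real_derivative q' t) (at t)" "continuous_on UNIV q'" and f: "C1_map A f"
  shows "C1_map A (\<lambda>x. q (f x))"
    and "c \<in> A \<Longrightarrow> x \<in> fst c \<Longrightarrow> der c (\<lambda>x. q (f x)) x v = q' (f x) * der c f x v"
proof -
  have *: "(local_rep c (\<lambda>x. q (f x)) has_derivative (\<lambda>v. q' (f x) * der c f x v)) (at (snd c x))"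
    if "c \<in> A" "x \<in> fst c" for c x
    using diff_chain_at[OF C1_map_has_der[OF f that], of q "(*) (q' (f x))"] q(1)[of "f x"] that
    by (simp add: local_rep_coord has_field_derivative_def) (simp add: local_rep_def o_def)
  have "continuous_on S (\<lambda>x. q' (f x))" for S
    by (rule continuous_on_compose2[OF q(2)])
      (use C1_map_continuous[OF f] continuous_on_subset in auto)
  then show "C1_map A (\<lambda>x. q (f x))"
    by (intro C1_mapI[OF *]) (auto intro!: continuous_intros C1_map_continuous_der f)
  show "c \<in> A \<Longrightarrow> x \<in> fst c \<Longrightarrow> der c (\<lambda>x. q (f x)) x v = q' (f x) * der c f x v"
    using der_eqI[OF *] by simp
qed

lemma C1_map_const:
  fixes c :: "('m, 'e) chart"
  shows "C1_map A (\<lambda>x. k)"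
  and der_const: "der c (\<lambda>x. k) x v = 0"
proof -
  have *: "(local_rep c (\<lambda>x. k) has_derivative (\<lambda>v. 0)) (at (snd c x))" for c :: "('m, 'e) chart" and x
    by (simp add: local_rep_def o_def)
  show "C1_map A (\<lambda>x. k)" by (rule C1_mapI[OF *]) auto
  show "der c (\<lambda>x. k) x v = 0" using der_eqI[OF *] by metis
qed

lemma der_eq_local:
  assumes "C1_map A f" "c \<in> A" "x \<in> fst c" "open U" "x \<in> U" "\<And>y. y \<in> U \<Longrightarrow> f y = h y"
  shows "der c h x v = der c f x v"
  using has_der_local[OF assms(2,4,5,3,6) C1_map_has_der[OF assms(1-3)]] der_eqI by metis

lemma linear_der: "C1_map A f \<Longrightarrow> c \<in> A \<Longrightarrow> x \<in> fst c \<Longrightarrow> linear (der c f x)"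
  using C1_map_has_der has_derivative_linear by blast

text \<open>K has to be closed in the whole manifold: then its complement is a neighborhood, on
  which the extension vanishes, of every point outside of the chart.\<close>

lemma C1_map_extend:
  fixes F :: "'e \<Rightarrow> 'b::real_normed_vector"
  assumes c: "c \<in> A" and F: "Ck_on 1 (chart_image c) F"
    and K: "closed K" "K \<subseteq> fst c" "\<And>x. x \<in> fst c - K \<Longrightarrow> F (snd c x) = 0"
  shows "C1_map A (\<lambda>x. if x \<in> fst c then F (snd c x) else 0)" (is "C1_map A ?f")
proof (rule C1_map_localI)
  fix x
  show "\<exists>d\<in>A. \<exists>U. open U \<and> x \<in> U \<and> U \<subseteq> fst d \<and> Ck_on 1 (snd d ` U) (local_rep d ?f)"
  proof (cases "x \<in> fst c")
    case True
    have "Ck_on 1 (chart_image c) (local_rep c ?f)"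
      by (rule Ck_on_1_cong[OF open_chart_image[OF c] _ F])
        (auto simp: chart_image_def local_rep_coord[OF c])
    then show ?thesis
      using True c open_dom[OF c] unfolding chart_image_def by blast
  next
    case False
    obtain d where d: "d \<in> A" "x \<in> fst d" using chart_exists by blast
    define U where "U = fst d - K"
    have U: "open U" "x \<in> U" "U \<subseteq> fst d"
      using K False d open_dom[OF d(1)] by (auto simp: U_def)
    have "Ck_on 1 (snd d ` U) (\<lambda>p. 0 :: 'b)" by (rule Ck_on_1I[where f' = "\<lambda>_ _. 0"]) auto
    then have "Ck_on 1 (snd d ` U) (local_rep d ?f)"
    proof (rule Ck_on_1_cong[OF open_coord[OF d(1) U(1,3)], rotated])
      show "0 = local_rep d ?f p" if "p \<in> snd d ` U" for p
        using that K(3) U(3) by (auto simp: local_rep_coord[OF d(1)] U_def)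
    qed
    then show ?thesis using d U by blast
  qed
qed

end

section \<open>The metric in charts and the norm of covectors\<close>

locale riemannian = smooth_manifold A
  for A :: "('m::{t2_space,second_countable_topology}, 'e::real_inner) chart set" +
  fixes g :: "('m, 'e) local_metric"
  assumes metric: "riemannian_metric A g"
begin

lemma metric_bilinear: "c \<in> A \<Longrightarrow> x \<in> fst c \<Longrightarrow> bilinear (g c x)"
  and metric_sym: "c \<in> A \<Longrightarrow> x \<in> fst c \<Longrightarrow> g c x v w = g c x w v"
  and metric_pos: "c \<in> A \<Longrightarrow> x \<in> fst c \<Longrightarrow> v \<noteq> 0 \<Longrightarrow> 0 < g c x v v"
  using metric unfolding riemannian_metric_def by blast+

lemma metric_transfer:
  "c \<in> A \<Longrightarrow> d \<in> A \<Longrightarrow> x \<in> fst c \<Longrightarrow> x \<in> fst d \<Longrightarrow>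
    g c x v w = g d x (der c (snd d) x v) (der c (snd d) x w)"
  using metric unfolding riemannian_metric_def der_def by blast

lemma metric_inner_form:
  assumes "c \<in> A" "x \<in> fst c"
  shows "\<exists>E. inner_form (g c x) E"
proof -
  obtain E where "finite E" "span E = span ob" "\<forall>u\<in>E. \<forall>v\<in>E. g c x u v = (if u = v then 1 else 0)"
    using orthonormal_basis_exists[OF metric_bilinear[OF assms] metric_sym[OF assms] metric_pos[OF assms] std.fin]
    by blast
  then have "inner_form (g c x) E"
    by unfold_locales (use assms in \<open>auto simp: metric_bilinear metric_sym std.spanE\<close>)
  then show ?thesis ..
qed

lemma continuous_metric:
  assumes c: "c \<in> A" "S \<subseteq> fst c"
  shows "continuous_on S (\<lambda>x. g c x v w)"
proof (rule continuous_on_subset[OF _ c(2)])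
  have "Ck_on 0 (chart_image c) (local_rep c (\<lambda>x. g c x v w))"
    using metric c unfolding riemannian_metric_def by blast
  then have "continuous_on (fst c) (\<lambda>x. local_rep c (\<lambda>x. g c x v w) (snd c x))"
    by (intro continuous_on_compose2[OF _ continuous_coord[OF c(1)]]) (auto simp: coord_in c)
  then show "continuous_on (fst c) (\<lambda>x. g c x v w)"
    by (rule continuous_on_eq) (simp add: local_rep_coord[OF c(1)])
qed

lemma metric_expand:
  assumes "c \<in> A" "x \<in> fst c"
  shows "g c x v w = (\<Sum>a\<in>ob. \<Sum>b\<in>ob. (v \<bullet> a) * (w \<bullet> b) * g c x a b)"
proof -
  have l: "linear (\<lambda>v. g c x v w)" "linear (g c x a)" for w a
    using metric_bilinear[OF assms] by (auto simp: bilinear_def)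
  show ?thesis
    by (subst std.linear_expand[OF l(1)], subst std.linear_expand[OF l(2)])
      (simp add: sum_distrib_left mult_ac)
qed

definition gn :: "('m, 'e) chart \<Rightarrow> 'm \<Rightarrow> 'e \<Rightarrow> real" where
  "gn c x v = sqrt (g c x v v)"

lemma gn_transfer:
  "c \<in> A \<Longrightarrow> d \<in> A \<Longrightarrow> x \<in> fst c \<Longrightarrow> x \<in> fst d \<Longrightarrow> gn c x v = gn d x (der c (snd d) x v)"
  using metric_transfer[of c d x v v] by (simp add: gn_def)

lemma gn_nonneg: "c \<in> A \<Longrightarrow> x \<in> fst c \<Longrightarrow> 0 \<le> gn c x v"
  using metric_inner_form[of c x] inner_form.G_self_nonneg unfolding gn_def by fastforce

text \<open>The differential and the metric norm are pulled back by the same linear map, so gradient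
  bounds do not depend on the chart.\<close>

lemma der_bound_transfer:
  assumes "C1_map A f" "c \<in> A" "d \<in> A" "x \<in> fst c" "x \<in> fst d"
    and "\<And>v. norm (der d f x v) \<le> M * gn d x v"
  shows "norm (der c f x v) \<le> M * gn c x v"
  using assms(6)[of "der c (snd d) x v"] der_transfer[OF assms(1-5)] gn_transfer[OF assms(2-5)]
  by simp

lemma orthonormal_frame: "inner_form (g (chart_at A x) x) (orthonormal_frame A g x)"
proof -
  let ?P = "\<lambda>E. finite E \<and> span E = UNIV \<and>
     (\<forall>u\<in>E. \<forall>v\<in>E. g (chart_at A x) x u v = (if u = v then 1 else 0))"
  obtain E where "inner_form (g (chart_at A x) x) E" using metric_inner_form chart_at by blast
  then have "?P E" by (simp add: inner_form_def)
  then have "?P (orthonormal_frame A g x)" unfolding orthonormal_frame_def by (rule someI)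
  then show ?thesis
    by unfold_locales (use chart_at in \<open>auto simp: metric_bilinear metric_sym\<close>)
qed

sublocale frame: inner_form "g (chart_at A x) x" "orthonormal_frame A g x" for x
  by (rule orthonormal_frame)

lemma frame_N: "frame.N x v = gn (chart_at A x) x v"
  by (simp add: frame.N_def gn_def)

text \<open>Orthonormal vectors are independent. The bound is uniform in x, as the constant in
  \<open>cot_norm_le_card\<close> must be.\<close>

lemma card_frame: "card (orthonormal_frame A g x) \<le> card ob"
proof -
  have "independent (orthonormal_frame A g x)"
    unfolding independent_explicit_finite_subsets
  proof (intro allI impI ballI)
    fix S u v
    assume S: "S \<subseteq> orthonormal_frame A g x" "finite S" "(\<Sum>v\<in>S. u v *\<^sub>R v) = 0" "v \<in> S"
    have "0 = g (chart_at A x) x (\<Sum>v\<in>S. u v *\<^sub>R v) v" by (simp add: S frame.G_simps)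
    also have "\<dots> = (\<Sum>w\<in>S. u w * g (chart_at A x) x w v)"
      by (simp add: linear_sum[OF frame.linear_G_left] frame.G_simps)
    also have "\<dots> = (\<Sum>w\<in>S. if w = v then u w else 0)"
      using S(1,4) frame.orthonormal[of _ x v] by (intro sum.cong) (auto simp: subset_iff)
    also have "\<dots> = u v" using S by simp
    finally show "u v = 0" by simp
  qed
  then show ?thesis using independent_span_bound[OF std.fin] std.spanE by auto
qed

lemma cot_norm_L2: "cot_norm A g x S = L2_set (\<lambda>e. norm (S e)) (orthonormal_frame A g x)"
  unfolding cot_norm_def cot_inner_def L2_set_def by (simp add: cinner_self)

lemma cot_norm_nonneg: "0 \<le> cot_norm A g x S"
  by (simp add: cot_norm_L2)

text \<open>\<open>cot_norm\<close> is the Hilbert-Schmidt norm with respect to an orthonormal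
  frame, and thus dominates the operator norm.\<close>

lemma norm_le_cot_norm:
  assumes "linear S"
  shows "norm (S v) \<le> cot_norm A g x S * gn (chart_at A x) x v"
proof -
  have "norm (S v) \<le> (\<Sum>e\<in>orthonormal_frame A g x. \<bar>g (chart_at A x) x v e\<bar> * \<bar>norm (S e)\<bar>)"
    by (subst frame.linear_expand[OF assms]) (auto intro: norm_sum[THEN order_trans])
  also have "\<dots> \<le> frame.N x v * cot_norm A g x S"
    unfolding frame.N_L2 cot_norm_L2 by (rule L2_set_mult_ineq)
  finally show ?thesis by (simp add: frame_N mult.commute)
qed

text \<open>A crude converse with a dimensional factor, for places where only finiteness
  matters.\<close>

lemma cot_norm_le_card:
  fixes M :: real
  assumes "\<And>v. norm (S v) \<le> M * gn (chart_at A x) x v" "0 \<le> M"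
  shows "cot_norm A g x S \<le> card ob * M"
proof -
  have "cot_norm A g x S \<le> (\<Sum>e\<in>orthonormal_frame A g x. norm (S e))"
    unfolding cot_norm_L2 by (rule L2_set_le_sum) simp
  also have "\<dots> \<le> (\<Sum>e\<in>orthonormal_frame A g x. M)"
    using assms(1) frame.N_frame[of _ x] by (intro sum_mono) (metis frame_N mult.right_neutral)
  also have "\<dots> \<le> card ob * M"
    using card_frame[of x] assms(2) by (simp add: mult_right_mono)
  finally show ?thesis .
qed

text \<open>For maps of rank one the Hilbert-Schmidt and operator norms agree, so the gradient of a
  cutoff function enters the norm of a section without a dimensional factor.\<close>

lemma cot_norm_rank_one:
  fixes \<omega> :: "'e \<Rightarrow> real"
  assumes lin: "linear \<omega>" and bd: "\<And>v. \<bar>\<omega> v\<bar> \<le> M * gn (chart_at A x) x v" and M: "0 \<le> M"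
  shows "cot_norm A g x (\<lambda>v. \<omega> v *\<^sub>R \<xi>) \<le> M * norm \<xi>"
proof -
  let ?E = "orthonormal_frame A g x"
  \<comment> \<open>The metric dual of \<omega>; at this vector \<omega> takes the square of its
    norm as value.\<close>
  define w where "w = (\<Sum>e\<in>?E. \<omega> e *\<^sub>R e)"
  have "\<omega> w = (\<Sum>e\<in>?E. (\<omega> e)\<^sup>2)"
    by (simp add: w_def linear_sum[OF lin] linear_cmul[OF lin] power2_eq_square)
  then have \<omega>w: "\<omega> w = (L2_set \<omega> ?E)\<^sup>2" by (simp add: L2_set_def sum_nonneg)
  have "g (chart_at A x) x w e = \<omega> e" if "e \<in> ?E" for e
  proof -
    have "g (chart_at A x) x w e = (\<Sum>u\<in>?E. \<omega> u * g (chart_at A x) x u e)"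
      by (simp add: w_def linear_sum[OF frame.linear_G_left] frame.G_simps)
    also have "\<dots> = (\<Sum>u\<in>?E. if u = e then \<omega> u else 0)"
      using that frame.orthonormal by (intro sum.cong) auto
    also have "\<dots> = \<omega> e" using that frame.fin by simp
    finally show ?thesis .
  qed
  then have "gn (chart_at A x) x w = L2_set \<omega> ?E"
    by (simp add: frame.N_L2 cong: L2_set_cong flip: frame_N)
  then have "(L2_set \<omega> ?E)\<^sup>2 \<le> M * L2_set \<omega> ?E" using bd[of w] \<omega>w by simp
  then have "L2_set \<omega> ?E \<le> M"
    using M by (cases "L2_set \<omega> ?E = 0") (auto simp: power2_eq_square mult_le_cancel_right)
  moreover have "cot_norm A g x (\<lambda>v. \<omega> v *\<^sub>R \<xi>) = L2_set \<omega> ?E * norm \<xi>"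
    unfolding cot_norm_L2 by (simp add: L2_set_left_distrib) (simp add: L2_set_def power_mult_distrib)
  ultimately show ?thesis by (simp add: mult_right_mono)
qed

lemma diff_at_eq: "diff_at A s x = der (chart_at A x) s x"
  by (simp add: diff_at_def der_def)

lemma linear_diff_at: "C1_map A s \<Longrightarrow> linear (diff_at A s x)"
  unfolding diff_at_eq using linear_der chart_at by blast

end

section \<open>Small balls on which the metric is nearly constant\<close>

section \<open>Coordinate balls\<close>

context riemannian
begin

lemma gn_N: "inner_form (g c p) E \<Longrightarrow> gn c p v = inner_form.N (g c p) v"
  by (simp add: gn_def inner_form.N_def[of "g c p" E])

context
  fixes c p assumes cp: "c \<in> A" "p \<in> fst c"
begin

lemma gn_triangle: "gn c p (v + w) \<le> gn c p v + gn c p w"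
    and gn_scaleR: "gn c p (s *\<^sub>R v) = \<bar>s\<bar> * gn c p v"
    and gn_minus_commute: "gn c p (v - w) = gn c p (w - v)"
    and gn_0: "gn c p 0 = 0"
    and gn_sq: "(gn c p v)\<^sup>2 = g c p v v"
    and metric_le: "\<bar>g c p v w\<bar> \<le> gn c p v * gn c p w"
    and norm_le_gn: "\<exists>C>0. \<forall>v. norm v \<le> C * gn c p v"
    and gn_bounded_bilinear: "bounded_bilinear (g c p)"
proof -
  obtain E where E: "inner_form (g c p) E" using metric_inner_form[OF cp] by blast
  interpret inner_form "g c p" E by (rule E)
  note [simp] = gn_N[OF E]
  show "gn c p (v + w) \<le> gn c p v + gn c p w" by (simp add: N_triangle)
  show "gn c p (s *\<^sub>R v) = \<bar>s\<bar> * gn c p v" by (simp add: N_scaleR)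
  show "gn c p (v - w) = gn c p (w - v)" using N_minus_commute by simp
  show "gn c p 0 = 0" by (simp add: N_0)
  show "(gn c p v)\<^sup>2 = g c p v v" by (simp add: N_sq)
  show "\<bar>g c p v w\<bar> \<le> gn c p v * gn c p w" by (simp add: G_le)
  show "\<exists>C>0. \<forall>v. norm v \<le> C * gn c p v"
  proof (intro exI[of _ "(\<Sum>e\<in>E. norm e) + 1"] conjI allI)
    show "0 < (\<Sum>e\<in>E. norm e) + 1" by (simp add: add_nonneg_pos sum_nonneg)
    show "norm v \<le> ((\<Sum>e\<in>E. norm e) + 1) * gn c p v" for v
      using norm_le_N[of v] N_nonneg[of v] by (simp add: algebra_simps)
  qed
  have bl: "bounded_linear (g c p v)" for v by (rule linear_bounded[OF linear_G_right])
  show "bounded_bilinear (g c p)"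
  proof
    have "\<exists>K. \<forall>v w. norm (g c p v w) \<le> norm v * norm w * K"
    proof (intro exI allI)
      fix v w
      let ?K = "\<Sum>a\<in>ob. \<Sum>b\<in>ob. \<bar>g c p a b\<bar>"
      have "\<bar>g c p v w\<bar> \<le> (\<Sum>a\<in>ob. \<Sum>b\<in>ob. \<bar>(v \<bullet> a) * (w \<bullet> b) * g c p a b\<bar>)"
        by (subst metric_expand[OF cp]) (intro order_trans[OF sum_abs] sum_mono sum_abs)
      also have "\<dots> \<le> (\<Sum>a\<in>ob. \<Sum>b\<in>ob. (norm v * norm w) * \<bar>g c p a b\<bar>)"
        using std.coord_le unfolding std_N abs_mult
        by (intro sum_mono mult_right_mono mult_mono) auto
      also have "\<dots> = norm v * norm w * ?K" by (simp add: sum_distrib_left)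
      finally show "norm (g c p v w) \<le> norm v * norm w * ?K" by simp
    qed
    then show "\<exists>K. \<forall>v w. norm (g c p v w) \<le> norm v * norm w * K" .
  qed (simp_all add: G_simps)
qed

lemma continuous_gn: "continuous_on S f \<Longrightarrow> continuous_on S (\<lambda>q. gn c p (f q))"
  unfolding gn_def
  by (intro continuous_on_real_sqrt bounded_bilinear.continuous_on[OF gn_bounded_bilinear])

lemma compact_gn_cball: "compact {q. gn c p (q - a) \<le> r}"
proof -
  obtain E where E: "inner_form (g c p) E" using metric_inner_form[OF cp] by blast
  have eq: "gn c p = inner_form.N (g c p)" by (rule ext) (rule gn_N[OF E])
  have "continuous_on UNIV (gn c p)" by (rule continuous_gn[OF continuous_on_id])
  then show ?thesis
    unfolding eq by (rule inner_form.compact_N_cball[OF E])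
qed

end

text \<open>On such a ball the metric frozen at p can replace g, which reduces Riemannian estimates
  to those of a normed space. The factor 2 is a convenience: continuity of g allows any constant
  above 1.\<close>

definition good :: "('m, 'e) chart \<Rightarrow> 'm \<Rightarrow> real \<Rightarrow> bool" where
  "good c p r \<longleftrightarrow> c \<in> A \<and> p \<in> fst c \<and> 0 < r \<and>
     (\<forall>q. gn c p (q - snd c p) \<le> r \<longrightarrow> q \<in> chart_image c \<and>
        (\<forall>v. gn c p v \<le> 2 * gn c (inv_chart c q) v \<and> gn c (inv_chart c q) v \<le> 2 * gn c p v))"

definition gball :: "('m, 'e) chart \<Rightarrow> 'm \<Rightarrow> real \<Rightarrow> 'm set" where
  "gball c p r = {x \<in> fst c. gn c p (snd c x - snd c p) < r}"

definition gcball :: "('m, 'e) chart \<Rightarrow> 'm \<Rightarrow> real \<Rightarrow> 'm set" where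
  "gcball c p r = {x \<in> fst c. gn c p (snd c x - snd c p) \<le> r}"

lemma good_mono: "good c p r \<Longrightarrow> 0 < s \<Longrightarrow> s \<le> r \<Longrightarrow> good c p s"
  unfolding good_def by (meson order_trans)

lemma goodD:
  assumes "good c p r"
  shows "c \<in> A" "p \<in> fst c" "0 < r"
    and "gn c p (q - snd c p) \<le> r \<Longrightarrow> q \<in> chart_image c"
    and "x \<in> gcball c p r \<Longrightarrow> gn c p v \<le> 2 * gn c x v"
    and "x \<in> gcball c p r \<Longrightarrow> gn c x v \<le> 2 * gn c p v"
proof -
  show cp: "c \<in> A" "p \<in> fst c" "0 < r" and "gn c p (q - snd c p) \<le> r \<Longrightarrow> q \<in> chart_image c"
    using assms by (auto simp: good_def)
  assume "x \<in> gcball c p r"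
  then have x: "x \<in> fst c" "gn c p (snd c x - snd c p) \<le> r" by (auto simp: gcball_def)
  show "gn c p v \<le> 2 * gn c x v" "gn c x v \<le> 2 * gn c p v"
    using assms x inv_chart_coord[OF cp(1) x(1)] unfolding good_def by metis+
qed

lemma gball_subset: "gball c p r \<subseteq> gcball c p r" "gcball c p r \<subseteq> fst c"
  by (auto simp: gball_def gcball_def)

lemma gball_mono: "r \<le> s \<Longrightarrow> gball c p r \<subseteq> gball c p s"
  by (auto simp: gball_def)

lemma gball_half: "good c p r \<Longrightarrow> gball c p (r / 2) \<subseteq> gball c p r"
  by (rule gball_mono) (simp add: good_def)

lemma open_gball:
  assumes "c \<in> A" "p \<in> fst c"
  shows "open (gball c p r)"
proof -
  have "open {q. gn c p (q - snd c p) < r}"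
    by (intro open_Collect_less continuous_gn[OF assms] continuous_intros)
  from open_coord_preimage[OF assms(1) this] show ?thesis by (simp add: gball_def)
qed

lemma gball_center: "c \<in> A \<Longrightarrow> p \<in> fst c \<Longrightarrow> 0 < r \<Longrightarrow> p \<in> gball c p r"
  by (simp add: gball_def gn_0)

lemma inv_chart_gcball:
  assumes "good c p r" "gn c p (q - snd c p) \<le> r"
  shows "inv_chart c q \<in> gcball c p r" "snd c (inv_chart c q) = q"
  using goodD[OF assms(1)] assms(2) by (auto simp: gcball_def inv_chart_in coord_inv_chart)

lemma compact_gcball:
  assumes "good c p r"
  shows "compact (gcball c p r)"
proof -
  note cp = goodD[OF assms]
  have "gcball c p r = inv_chart c ` {q. gn c p (q - snd c p) \<le> r}"
  proof (intro equalityI subsetI)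
    fix x assume "x \<in> gcball c p r"
    then show "x \<in> inv_chart c ` {q. gn c p (q - snd c p) \<le> r}"
      using cp(1) by (intro image_eqI[of _ _ "snd c x"]) (auto simp: gcball_def inv_chart_coord)
  qed (use inv_chart_gcball[OF assms] in blast)
  then show ?thesis
    using compact_inv_chart[OF cp(1) compact_gn_cball[OF cp(1,2), of "snd c p" r]] cp(4) by auto
qed

text \<open>Continuity of the finitely many coefficients of g in a frame orthonormal at p controls
  the whole quadratic form near p.\<close>

lemma good_exists:
  assumes cp: "c \<in> A" "p \<in> fst c"
  shows "\<exists>r. good c p r"
proof -
  obtain E where E: "inner_form (g c p) E" using metric_inner_form[OF cp] by blast
  interpret E: inner_form "g c p" E by (rule E)
  obtain C where C: "0 < C" "\<And>v. norm v \<le> C * gn c p v" using norm_le_gn[OF cp] by blast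
  \<comment> \<open>Coefficients off by less than \<eta> change the form at v by at most (card E)^2
    \<eta> \<le> 3/4 of its value at p, and 1 - 3/4 = (1/2)^2 is the loss that \<open>good\<close>
    allows. The + 1 covers an empty E.\<close>
  define \<eta> where "\<eta> = 3 / (4 * (real (card E) + 1)\<^sup>2)"
  have \<eta>: "0 < \<eta>" "(real (card E))\<^sup>2 * \<eta> \<le> 3 / 4"
  proof -
    show "0 < \<eta>" by (simp add: \<eta>_def add_nonneg_pos)
    have "(real (card E))\<^sup>2 \<le> (real (card E) + 1)\<^sup>2" by (intro power_mono) auto
    then show "(real (card E))\<^sup>2 * \<eta> \<le> 3 / 4"
      by (simp add: \<eta>_def divide_le_eq add_nonneg_pos)
  qed
  let ?m = "\<lambda>u v q. g c (inv_chart c q) u v"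
  have cont: "isCont (?m u v) (snd c p)" for u v
  proof -
    have "continuous_on (chart_image c) (?m u v)"
      by (rule continuous_on_compose2[OF continuous_metric[OF cp(1) order_refl] continuous_inv_chart[OF cp(1)]])
        (use cp inv_chart_in in blast)
    then show ?thesis
      using open_chart_image[OF cp(1)] coord_in[OF cp] by (simp add: continuous_on_eq_continuous_at)
  qed
  have near: "\<forall>\<^sub>F q in nhds (snd c p). \<bar>?m u v q - g c p u v\<bar> < \<eta>" for u v
  proof -
    have "(?m u v \<longlongrightarrow> ?m u v (snd c p)) (nhds (snd c p))"
      using cont[of u v] tendsto_at_iff_tendsto_nhds[of "?m u v" "snd c p"]
      by (simp only: isCont_def)
    from tendstoD[OF this \<eta>(1)] show ?thesis
      by (simp add: dist_real_def inv_chart_coord[OF cp])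
  qed
  have "\<forall>\<^sub>F q in nhds (snd c p). q \<in> chart_image c \<and> (\<forall>u\<in>E. \<forall>v\<in>E. \<bar>?m u v q - g c p u v\<bar> < \<eta>)"
    using near E.fin eventually_nhds_in_open[OF open_chart_image[OF cp(1)] coord_in[OF cp]]
    by (intro eventually_conj eventually_ball_finite ballI)
  then obtain \<delta> where \<delta>: "0 < \<delta>" and
    D: "\<And>q. dist q (snd c p) < \<delta> \<Longrightarrow> q \<in> chart_image c \<and> (\<forall>u\<in>E. \<forall>v\<in>E. \<bar>?m u v q - g c p u v\<bar> < \<eta>)"
    unfolding eventually_nhds_metric by blast
  define r where "r = \<delta> / (2 * C)"
  have r: "0 < r" using \<delta> C by (simp add: r_def)
  have "good c p r"
    unfolding good_def
  proof (intro conjI allI impI)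
    fix q assume q: "gn c p (q - snd c p) \<le> r"
    have "norm (q - snd c p) \<le> C * r"
      using C(2)[of "q - snd c p"] mult_left_mono[OF q, of C] C(1) by linarith
    also have "\<dots> < \<delta>" using C(1) \<delta> by (simp add: r_def)
    finally have Dq: "q \<in> chart_image c" "\<And>u v. u \<in> E \<Longrightarrow> v \<in> E \<Longrightarrow> \<bar>?m u v q - g c p u v\<bar> < \<eta>"
      using D[of q] by (auto simp: dist_norm)
    show "q \<in> chart_image c" by (rule Dq)
    fix v
    have x: "inv_chart c q \<in> fst c" using Dq(1) cp(1) by (rule inv_chart_in[rotated])
    let ?a = "\<lambda>e. g c p v e"
    have exp: "b v v = (\<Sum>e\<in>E. \<Sum>f\<in>E. ?a e * ?a f * b e f)" if "bilinear b" for b :: "'e \<Rightarrow> 'e \<Rightarrow> real"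
    proof -
      have l: "linear (\<lambda>v. b v w)" "linear (b u)" for u w using that by (auto simp: bilinear_def)
      show ?thesis
        by (subst E.linear_expand[OF l(1)], subst E.linear_expand[OF l(2)])
          (simp add: sum_distrib_left mult_ac)
    qed
    have "\<bar>?m v v q - g c p v v\<bar> = \<bar>\<Sum>e\<in>E. \<Sum>f\<in>E. ?a e * ?a f * (?m e f q - g c p e f)\<bar>"
      by (simp only: exp[OF metric_bilinear[OF cp(1) x]] exp[OF E.bil] right_diff_distrib sum_subtractf)
    also have "\<dots> \<le> (\<Sum>e\<in>E. \<Sum>f\<in>E. \<bar>?a e * ?a f * (?m e f q - g c p e f)\<bar>)"
      by (intro order_trans[OF sum_abs] sum_mono sum_abs)
    also have "\<dots> \<le> (\<Sum>e\<in>E. \<Sum>f\<in>E. E.N v * E.N v * \<eta>)"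
      unfolding abs_mult using E.coord_le[of _ v] E.N_nonneg[of v] Dq(2)
      by (intro sum_mono mult_mono mult_nonneg_nonneg) (auto intro: less_imp_le)
    also have "\<dots> = (real (card E))\<^sup>2 * \<eta> * g c p v v"
      by (simp add: power2_eq_square flip: E.N_sq)
    also have "\<dots> \<le> 3 / 4 * g c p v v"
      using \<eta>(2) E.G_self_nonneg by (intro mult_right_mono) auto
    finally have d: "\<bar>?m v v q - g c p v v\<bar> \<le> 3 / 4 * g c p v v" .
    have 4: "2 * sqrt y = sqrt (4 * y)" for y by (simp add: real_sqrt_mult)
    show "gn c p v \<le> 2 * gn c (inv_chart c q) v" "gn c (inv_chart c q) v \<le> 2 * gn c p v"
      unfolding gn_def 4 using d E.G_self_nonneg[of v] by (intro real_sqrt_le_mono; linarith)+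
  qed (use cp r in auto)
  then show ?thesis ..
qed

section \<open>Lengths of curves against coordinate displacements\<close>

section \<open>Lengths of curves\<close>

definition speed :: "(real \<Rightarrow> 'm) \<Rightarrow> real \<Rightarrow> real" where
  "speed \<gamma> t = gn (chart_at A (\<gamma> t)) (\<gamma> t)
     (vector_derivative (\<lambda>u. snd (chart_at A (\<gamma> t)) (\<gamma> u)) (at t within {0..1}))"

lemma curve_length_speed: "curve_length A g \<gamma> = integral {0..1} (speed \<gamma>)"
  by (simp add: curve_length_def speed_def[abs_def] gn_def Let_def)

lemma speed_nonneg: "0 \<le> speed \<gamma> t"
  unfolding speed_def by (intro gn_nonneg chart_at)

text \<open>The integrand of the length uses a chart chosen anew at every t; its continuity and size
  become accessible in a fixed chart.\<close>

lemma speed_eq: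
  assumes c: "c \<in> A" "\<gamma> t \<in> fst c" and t: "t \<in> {0..1}" and cont: "continuous (at t within {0..1}) \<gamma>"
    and D: "((\<lambda>u. snd c (\<gamma> u)) has_vector_derivative D) (at t within {0..1})"
  shows "speed \<gamma> t = gn c (\<gamma> t) D"
proof -
  let ?d = "chart_at A (\<gamma> t)"
  let ?T = "der c (snd ?d) (\<gamma> t)"
  note d = chart_at[of "\<gamma> t"]
  have T: "(local_rep c (snd ?d) has_derivative ?T) (at (snd c (\<gamma> t)))"
    by (rule transition_has_der[OF c(1) d(1) c(2) d(2)])
  have "((\<lambda>u. local_rep c (snd ?d) (snd c (\<gamma> u))) has_derivative (\<lambda>h. ?T (h *\<^sub>R D))) (at t within {0..1})"
    using has_derivative_compose[OF D[unfolded has_vector_derivative_def], of "local_rep c (snd ?d)" ?T] T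
    by blast
  moreover have "\<forall>\<^sub>F u in at t within {0..1}. local_rep c (snd ?d) (snd c (\<gamma> u)) = snd ?d (\<gamma> u)"
  proof -
    have "\<forall>\<^sub>F u in at t within {0..1}. \<gamma> u \<in> fst c"
      using cont open_dom[OF c(1)] c(2) by (auto simp: continuous_within intro: topological_tendstoD)
    then show ?thesis by eventually_elim (simp add: local_rep_coord[OF c(1)])
  qed
  ultimately have "((\<lambda>u. snd ?d (\<gamma> u)) has_derivative (\<lambda>h. ?T (h *\<^sub>R D))) (at t within {0..1})"
    by (rule has_derivative_transform_eventually) (use t c in \<open>auto simp: local_rep_coord\<close>)
  then have "((\<lambda>u. snd ?d (\<gamma> u)) has_vector_derivative ?T D) (at t within {0..1})"
    unfolding has_vector_derivative_def by (simp add: linear_cmul[OF has_derivative_linear[OF T]])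
  then have "vector_derivative (\<lambda>u. snd ?d (\<gamma> u)) (at t within {0..1}) = ?T D"
    using t vector_derivative_within_cbox[of 0 1 t] by (simp add: cbox_interval)
  then show ?thesis
    unfolding speed_def using gn_transfer[OF c(1) d(1) c(2) d(2)] by simp
qed

lemma continuous_speed:
  assumes "C1_curve A \<gamma>"
  shows "continuous_on {0..1} (speed \<gamma>)"
proof (unfold continuous_on_eq_continuous_within, intro ballI)
  fix t :: real assume t: "t \<in> {0..1}"
  have \<gamma>: "continuous_on {0..1} \<gamma>" using assms by (simp add: C1_curve_def)
  obtain c where c: "c \<in> A" "\<gamma> t \<in> fst c" using chart_exists by blast
  let ?S = "{t\<in>{0..1}. \<gamma> t \<in> fst c}"
  obtain D where D: "continuous_on ?S D"
    "\<And>t. t \<in> ?S \<Longrightarrow> ((\<lambda>u. snd c (\<gamma> u)) has_vector_derivative D t) (at t within {0..1})"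
    using assms c(1) unfolding C1_curve_def by blast
  have eq: "speed \<gamma> u = gn c (\<gamma> u) (D u)" if "u \<in> ?S" for u
    using that D(2)[OF that] \<gamma> c(1) by (intro speed_eq) (auto simp: continuous_on_eq_continuous_within)
  \<comment> \<open>Continuity of the metric is available for fixed vectors, hence the expansion in
    the basis.\<close>
  have "continuous_on ?S (\<lambda>u. sqrt (\<Sum>a\<in>ob. \<Sum>b\<in>ob. (D u \<bullet> a) * (D u \<bullet> b) * g c (\<gamma> u) a b))"
    by (intro continuous_intros D(1) continuous_on_compose2[OF continuous_metric[OF c(1) order_refl]]
        continuous_on_subset[OF \<gamma>]) auto
  then have "continuous_on ?S (speed \<gamma>)"
    by (rule continuous_on_eq) (use metric_expand[OF c(1)] eq in \<open>auto simp: gn_def\<close>)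
  then have "continuous (at t within ?S) (speed \<gamma>)"
    using t c(2) by (simp add: continuous_on_eq_continuous_within)
  moreover have "openin (top_of_set {0..1}) ?S"
    using continuous_openin_preimage_gen[OF \<gamma> open_dom[OF c(1)]] by (simp add: vimage_def Int_def)
  then obtain T where "open T" "?S = {0..1} \<inter> T" unfolding openin_open by blast
  then have "at t within ?S = at t within {0..1}"
    using t c(2) by (intro at_within_nhd[of t T]) auto
  ultimately show "continuous (at t within {0..1}) (speed \<gamma>)" by simp
qed

text \<open>Differentiate the pairing of w with the coordinates of \<gamma>, where w is the total
  displacement: integration and Cauchy-Schwarz give \<parallel>w\<parallel>^2 \<le>
  \<parallel>w\<parallel> times twice the length. The pairing replaces a vector-valued integral by a
  real one.\<close>

lemma displacement_le_length:
  assumes \<gamma>: "C1_curve A \<gamma>" and good: "good c p r" and ab: "a \<in> {0..1}" "b \<in> {0..1}" "a \<le> b"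
    and sub: "\<And>t. a \<le> t \<Longrightarrow> t \<le> b \<Longrightarrow> \<gamma> t \<in> gcball c p r"
  shows "gn c p (snd c (\<gamma> b) - snd c (\<gamma> a)) \<le> 2 * curve_length A g \<gamma>"
proof -
  note cp = goodD[OF good]
  interpret bb: bounded_bilinear "g c p" by (rule gn_bounded_bilinear[OF cp(1,2)])
  define w where "w = snd c (\<gamma> b) - snd c (\<gamma> a)"
  let ?S = "{t\<in>{0..1}. \<gamma> t \<in> fst c}"
  obtain D where D: "\<And>t. t \<in> ?S \<Longrightarrow> ((\<lambda>u. snd c (\<gamma> u)) has_vector_derivative D t) (at t within {0..1})"
    using \<gamma> cp(1) unfolding C1_curve_def by blast
  have S: "t \<in> ?S" if "t \<in> {a..b}" for t
    using that ab sub[of t] subsetD[OF gball_subset(2), of "\<gamma> t" c p r] by auto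
  have der: "((\<lambda>u. g c p w (snd c (\<gamma> u))) has_vector_derivative g c p w (D t)) (at t within {a..b})"
    if "t \<in> {a..b}" for t
    using bounded_linear.has_vector_derivative[OF bb.bounded_linear_right, OF
        has_vector_derivative_within_subset[OF D[OF S[OF that]]], of "{a..b}"] ab by auto
  have "((\<lambda>t. g c p w (D t)) has_integral g c p w (snd c (\<gamma> b)) - g c p w (snd c (\<gamma> a))) {a..b}"
    by (rule fundamental_theorem_of_calculus[OF ab(3) der])
  then have "((\<lambda>t. g c p w (D t)) has_integral (gn c p w)\<^sup>2) {a..b}"
    by (simp add: gn_sq[OF cp(1,2)] bb.diff_right[symmetric] flip: w_def)
  moreover have int: "speed \<gamma> integrable_on {0..1}"
    by (rule integrable_continuous_interval[OF continuous_speed[OF \<gamma>]])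
  then have int': "speed \<gamma> integrable_on {a..b}"
    by (rule integrable_on_subinterval) (use ab in auto)
  then have "((\<lambda>t. gn c p w * (2 * speed \<gamma> t)) has_integral gn c p w * (2 * integral {a..b} (speed \<gamma>))) {a..b}"
    by (intro has_integral_mult_right integrable_integral)
  ultimately have "(gn c p w)\<^sup>2 \<le> gn c p w * (2 * integral {a..b} (speed \<gamma>))"
  proof (rule has_integral_le)
    fix t assume t: "t \<in> {a..b}"
    have "continuous (at t within {0..1}) \<gamma>"
      using \<gamma> S[OF t] by (auto simp: C1_curve_def continuous_on_eq_continuous_within)
    then have "speed \<gamma> t = gn c (\<gamma> t) (D t)"
      using S[OF t] D[OF S[OF t]] cp(1) by (intro speed_eq) auto
    then have "gn c p (D t) \<le> 2 * speed \<gamma> t" using cp(5)[of "\<gamma> t"] sub t by simp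
    then show "g c p w (D t) \<le> gn c p w * (2 * speed \<gamma> t)"
      using metric_le[OF cp(1,2), of w "D t"] gn_nonneg[OF cp(1,2), of w]
      by (meson abs_le_D1 mult_left_mono order_trans)
  qed
  moreover have "integral {a..b} (speed \<gamma>) \<le> integral {0..1} (speed \<gamma>)"
    using ab int int' speed_nonneg by (intro integral_subset_le) auto
  ultimately have "gn c p w * gn c p w \<le> gn c p w * (2 * curve_length A g \<gamma>)"
    using mult_left_mono[of _ _ "gn c p w"] gn_nonneg[OF cp(1,2), of w]
    unfolding curve_length_speed power2_eq_square by fastforce
  moreover have "0 \<le> curve_length A g \<gamma>"
    unfolding curve_length_speed by (rule integral_nonneg[OF int]) (simp add: speed_nonneg)
  ultimately show ?thesis
    using gn_nonneg[OF cp(1,2), of w] unfolding w_def[symmetric]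
    by (cases "gn c p w = 0") (auto simp: mult_le_cancel_left)
qed

text \<open>The infimum of the closed set of times spent outside of U.\<close>

lemma first_exit:
  fixes f :: "real \<Rightarrow> 'm"
  assumes f: "continuous_on {0..1} f" and U: "open U" "f 0 \<in> U" "f 1 \<notin> U"
  shows "\<exists>t\<in>{0..1}. f t \<notin> U \<and> (\<forall>s. 0 \<le> s \<longrightarrow> s < t \<longrightarrow> f s \<in> U)"
proof -
  define Z where "Z = {0..1} \<inter> f -` (- U)"
  have "closed Z" unfolding Z_def using f U(1) by (intro continuous_closed_preimage) auto
  moreover have "1 \<in> Z" "bdd_below Z" using U by (auto simp: Z_def)
  ultimately have "Inf Z \<in> Z" by (intro closed_contains_Inf) auto
  moreover have "f s \<in> U" if "0 \<le> s" "s < Inf Z" for s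
    using cInf_lower[OF _ \<open>bdd_below Z\<close>, of s] that \<open>Inf Z \<in> Z\<close> by (fastforce simp: Z_def)
  ultimately show ?thesis by (auto simp: Z_def)
qed

lemma closure_gball: "good c p r \<Longrightarrow> closure (gball c p r) \<subseteq> gcball c p r"
  by (intro closure_minimal gball_subset compact_imp_closed compact_gcball)

text \<open>Leaving the ball from its inner half takes a displacement of more than r / 2, whereas a
  length below r / 4 permits less.\<close>

lemma curve_stays:
  assumes \<gamma>: "C1_curve A \<gamma>" and good: "good c p r" and len: "curve_length A g \<gamma> < r / 4"
  shows "\<gamma> 0 \<in> gball c p (r / 2) \<Longrightarrow> \<gamma> 1 \<in> gball c p r"
    and "\<gamma> 1 \<in> gball c p (r / 2) \<Longrightarrow> \<gamma> 0 \<in> gball c p r"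
proof -
  note cp = goodD[OF good]
  have cont: "continuous_on {0..1} \<gamma>" using \<gamma> by (simp add: C1_curve_def)
  \<comment> \<open>Stated for a continuous f together with a displacement estimate, so as to cover
    the curve and its reversal.\<close>
  have *: False if t: "t \<in> {0..1}" "f t \<notin> gball c p r" "\<forall>s. 0 \<le> s \<longrightarrow> s < t \<longrightarrow> f s \<in> gball c p r"
    and f: "continuous_on {0..1} f" "f 0 \<in> gball c p (r / 2)"
    and disp: "\<And>t. t \<in> {0..1} \<Longrightarrow> (\<And>s. 0 \<le> s \<Longrightarrow> s \<le> t \<Longrightarrow> f s \<in> gcball c p r) \<Longrightarrow>
      gn c p (snd c (f t) - snd c (f 0)) \<le> 2 * curve_length A g \<gamma>"
    for f :: "real \<Rightarrow> 'm" and t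
  proof -
    have "f 0 \<in> gball c p r" using f(2) gball_half[OF good] by blast
    then have "t \<noteq> 0" using t by metis
    then have t0: "0 < t" using t(1) by simp
    have "f t \<in> gcball c p r"
    proof -
      have "f ` closure {0..<t} \<subseteq> closure (gball c p r)"
        using t t0 f(1) closure_subset
        by (intro image_closure_subset) (auto intro!: continuous_on_subset[OF f(1)] subsetD[OF closure_subset])
      then show ?thesis using t0 closure_gball[OF good] by (auto simp: image_subset_iff)
    qed
    moreover then have "f s \<in> gcball c p r" if "0 \<le> s" "s \<le> t" for s
      using that t(3) by (cases "s = t") (simp_all add: subsetD[OF gball_subset(1)])
    ultimately have "gn c p (snd c (f t) - snd c (f 0)) \<le> 2 * curve_length A g \<gamma>"
      using disp t(1) by blast
    moreover have "r \<le> gn c p (snd c (f t) - snd c p)"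
      using t(2) \<open>f t \<in> gcball c p r\<close> by (auto simp: gball_def gcball_def)
    moreover have "gn c p (snd c (f t) - snd c p)
        \<le> gn c p (snd c (f t) - snd c (f 0)) + gn c p (snd c (f 0) - snd c p)"
      using gn_triangle[OF cp(1,2), of "snd c (f t) - snd c (f 0)" "snd c (f 0) - snd c p"] by simp
    moreover have "gn c p (snd c (f 0) - snd c p) < r / 2" using f(2) by (simp add: gball_def)
    ultimately show False using len by linarith
  qed
  show "\<gamma> 1 \<in> gball c p r" if "\<gamma> 0 \<in> gball c p (r / 2)"
  proof (rule ccontr)
    assume "\<gamma> 1 \<notin> gball c p r"
    moreover have "\<gamma> 0 \<in> gball c p r" using that gball_half[OF good] by blast
    ultimately obtain t where "t \<in> {0..1}" "\<gamma> t \<notin> gball c p r" "\<forall>s. 0 \<le> s \<longrightarrow> s < t \<longrightarrow> \<gamma> s \<in> gball c p r"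
      using first_exit[OF cont open_gball[OF cp(1,2), of r]] by blast
    then show False
      using that cont by (intro *[of t \<gamma>]) (auto intro!: displacement_le_length[OF \<gamma> good])
  qed
  show "\<gamma> 0 \<in> gball c p r" if "\<gamma> 1 \<in> gball c p (r / 2)"
  proof (rule ccontr)
    assume "\<gamma> 0 \<notin> gball c p r"
    moreover have "\<gamma> 1 \<in> gball c p r" using that gball_half[OF good] by blast
    moreover have cont': "continuous_on {0..1} (\<lambda>t. \<gamma> (1 - t))"
      by (rule continuous_on_compose2[OF cont]) (auto intro!: continuous_intros)
    ultimately obtain t where t: "t \<in> {0..1}" "\<gamma> (1 - t) \<notin> gball c p r"
        "\<forall>s. 0 \<le> s \<longrightarrow> s < t \<longrightarrow> \<gamma> (1 - s) \<in> gball c p r"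
      using first_exit[OF _ open_gball[OF cp(1,2), of r], of "\<lambda>t. \<gamma> (1 - t)"] by auto
    show False
    proof (rule *[OF t cont'])
      fix u :: real assume u: "u \<in> {0..1}" "\<And>s. 0 \<le> s \<Longrightarrow> s \<le> u \<Longrightarrow> \<gamma> (1 - s) \<in> gcball c p r"
      \<comment> \<open>The estimate comes from \<gamma> itself on [1 - u, 1]; for the reversed
        curve only continuity is established.\<close>
      have "gn c p (snd c (\<gamma> 1) - snd c (\<gamma> (1 - u))) \<le> 2 * curve_length A g \<gamma>"
        by (rule displacement_le_length[OF \<gamma> good]) (use u(1) u(2)[of "1 - _"] in auto)
      then show "gn c p (snd c (\<gamma> (1 - u)) - snd c (\<gamma> (1 - 0))) \<le> 2 * curve_length A g \<gamma>"
        using gn_minus_commute[OF cp(1,2)] by simp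
    qed (use that in simp)
  qed
qed

text \<open>Relates the Riemannian distance, an infimum over curves, to the topology of the
  manifold.\<close>

lemma dist_stays:
  assumes good: "good c p r" and "riemannian_dist A g y z < ennreal (r / 4)"
  shows "y \<in> gball c p (r / 2) \<Longrightarrow> z \<in> gball c p r" and "z \<in> gball c p (r / 2) \<Longrightarrow> y \<in> gball c p r"
proof -
  obtain \<gamma> where \<gamma>: "C1_curve A \<gamma>" "\<gamma> 0 = y" "\<gamma> 1 = z" "ennreal (curve_length A g \<gamma>) < ennreal (r / 4)"
    using assms(2) unfolding riemannian_dist_def INF_less_iff by blast
  then have "curve_length A g \<gamma> < r / 4"
    using goodD(3)[OF good] by (metis ennreal_leI not_le)
  then show "y \<in> gball c p (r / 2) \<Longrightarrow> z \<in> gball c p r" "z \<in> gball c p (r / 2) \<Longrightarrow> y \<in> gball c p r"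
    using curve_stays[OF \<gamma>(1) good] \<gamma>(2,3) by auto
qed

end

section \<open>A C1 step function of one real variable\<close>

section \<open>A smooth step function\<close>

lemma has_real_derivative_max_square:
  "((\<lambda>t::real. (max 0 t)\<^sup>2) has_real_derivative 2 * max 0 t) (at t)"
proof -
  consider "t < 0" | "0 < t" | "t = 0" by linarith
  then show ?thesis
  proof cases
    case 1
    have "((\<lambda>t::real. 0) has_real_derivative 2 * max 0 t) (at t)" using 1 by simp
    then show ?thesis
      by (rule has_field_derivative_transform_within_open[of _ _ _ "{..<0}"]) (use 1 in auto)
  next
    case 2
    have "((\<lambda>t::real. t\<^sup>2) has_real_derivative 2 * max 0 t) (at t)"
      using 2 by (auto intro!: derivative_eq_intros)
    then show ?thesis
      by (rule has_field_derivative_transform_within_open[of _ _ _ "{0<..}"]) (use 2 in auto)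
  next
    case 3
    have "((\<lambda>h. ((max 0 h)\<^sup>2 - 0) / h) \<longlongrightarrow> 0) (at (0::real))"
    proof (rule Lim_null_comparison)
      show "\<forall>\<^sub>F h in at (0::real). norm (((max 0 h)\<^sup>2 - 0) / h) \<le> \<bar>h\<bar>"
        by (rule always_eventually) (auto simp: max_def power2_eq_square)
      show "((\<lambda>h. \<bar>h\<bar>) \<longlongrightarrow> 0) (at (0::real))"
        using tendsto_rabs[OF tendsto_ident_at[of "0::real" UNIV]] by simp
    qed
    then show ?thesis using 3 by (simp add: has_field_derivative_iff)
  qed
qed

text \<open>The integral of the tent function on [0,1] with peak 2 at 1/2; a piecewise quadratic is
  enough for C1.\<close>

definition smoothstep :: "real \<Rightarrow> real" where
  "smoothstep t = 2 * (max 0 t)\<^sup>2 - 4 * (max 0 (t - 1 / 2))\<^sup>2 + 2 * (max 0 (t - 1))\<^sup>2"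

definition smoothstep' :: "real \<Rightarrow> real" where
  "smoothstep' t = 4 * max 0 t - 8 * max 0 (t - 1 / 2) + 4 * max 0 (t - 1)"

lemma smoothstep_deriv: "(smoothstep has_real_derivative smoothstep' t) (at t)"
proof -
  have *: "((\<lambda>t. (max 0 (t - k))\<^sup>2) has_real_derivative 2 * max 0 (t - k)) (at t)" for k
    using DERIV_shift[of "\<lambda>t. (max 0 t)\<^sup>2" "2 * max 0 (t - k)" t "- k"]
      has_real_derivative_max_square[of "t - k"] by simp
  have "((\<lambda>t. 2 * (max 0 t)\<^sup>2 - 4 * (max 0 (t - 1 / 2))\<^sup>2 + 2 * (max 0 (t - 1))\<^sup>2)
      has_real_derivative 2 * (2 * max 0 t) - 4 * (2 * max 0 (t - 1 / 2)) + 2 * (2 * max 0 (t - 1))) (at t)"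
    by (intro DERIV_add DERIV_diff DERIV_cmult * has_real_derivative_max_square)
  then show ?thesis by (simp add: smoothstep_def[abs_def] smoothstep'_def)
qed

lemma continuous_smoothstep': "continuous_on S smoothstep'"
  unfolding smoothstep'_def by (intro continuous_intros)

lemma smoothstep_0: "t \<le> 0 \<Longrightarrow> smoothstep t = 0" and smoothstep'_0: "t \<le> 0 \<Longrightarrow> smoothstep' t = 0"
  and smoothstep_1: "1 \<le> t \<Longrightarrow> smoothstep t = 1"
  and smoothstep'_nonneg: "0 \<le> smoothstep' t" and smoothstep'_le: "smoothstep' t \<le> 2"
  by (auto simp: smoothstep_def smoothstep'_def max_def power2_eq_square algebra_simps)

lemma smoothstep_nonneg: "0 \<le> smoothstep t" and smoothstep_le: "smoothstep t \<le> 1"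
proof -
  have mono: "smoothstep s \<le> smoothstep u" if "s \<le> u" for s u
    by (rule DERIV_nonneg_imp_nondecreasing[OF that]) (use smoothstep_deriv smoothstep'_nonneg in blast)
  show "0 \<le> smoothstep t" using mono[of "min t 0" t] smoothstep_0[of "min t 0"] by simp
  show "smoothstep t \<le> 1" using mono[of t "max t 1"] smoothstep_1[of "max t 1"] by simp
qed

section \<open>The length metric given by piecewise coordinate segments\<close>

section \<open>Chains of coordinate segments\<close>

context riemannian
begin

text \<open>Two-sided neighborhoods and all charts around the point at once: then gluing of curves
  and affine changes of parameter reduce to statements at single times. Curves are therefore defined
  on the whole real line.\<close>

definition curve_at :: "(real \<Rightarrow> 'm) \<Rightarrow> real \<Rightarrow> real \<Rightarrow> bool" where
  "curve_at \<gamma> t M \<longleftrightarrow> isCont \<gamma> t \<and> (\<forall>c\<in>A. \<gamma> t \<in> fst c \<longrightarrow>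
     (\<exists>S D. open S \<and> t \<in> S \<and> continuous_on S D \<and> gn c (\<gamma> t) (D t) \<le> M \<and>
        (\<forall>u\<in>S. \<gamma> u \<in> fst c \<and> ((\<lambda>u. snd c (\<gamma> u)) has_vector_derivative D u) (at u))))"

lemma curve_atE:
  assumes "curve_at \<gamma> t M" "c \<in> A" "\<gamma> t \<in> fst c"
  obtains S D where "open S" "t \<in> S" "continuous_on S D" "gn c (\<gamma> t) (D t) \<le> M"
    "\<And>u. u \<in> S \<Longrightarrow> \<gamma> u \<in> fst c"
    "\<And>u. u \<in> S \<Longrightarrow> ((\<lambda>u. snd c (\<gamma> u)) has_vector_derivative D u) (at u)"
proof -
  from assms obtain S where "\<exists>D. open S \<and> t \<in> S \<and> continuous_on S D \<and> gn c (\<gamma> t) (D t) \<le> M \<and>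
        (\<forall>u\<in>S. \<gamma> u \<in> fst c \<and> ((\<lambda>u. snd c (\<gamma> u)) has_vector_derivative D u) (at u))"
    unfolding curve_at_def by meson
  then obtain D where "open S \<and> t \<in> S \<and> continuous_on S D \<and> gn c (\<gamma> t) (D t) \<le> M \<and>
        (\<forall>u\<in>S. \<gamma> u \<in> fst c \<and> ((\<lambda>u. snd c (\<gamma> u)) has_vector_derivative D u) (at u))" ..
  then show thesis by (intro that[of S D]) simp_all
qed

lemma curve_at_cong:
  assumes \<gamma>: "curve_at \<gamma> t M" and T: "open T" "t \<in> T" "\<And>u. u \<in> T \<Longrightarrow> \<gamma> u = \<gamma>' u"
  shows "curve_at \<gamma>' t M"
  unfolding curve_at_def
proof (intro conjI ballI impI)
  have "\<forall>\<^sub>F u in nhds t. \<gamma> u = \<gamma>' u"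
    using eventually_nhds_in_open[OF T(1,2)] by eventually_elim (rule T(3))
  then show "isCont \<gamma>' t" using \<gamma> by (simp add: curve_at_def cong: isCont_cong)
  fix c assume c: "c \<in> A" "\<gamma>' t \<in> fst c"
  then obtain S D where S: "open S" "t \<in> S" "continuous_on S D" "gn c (\<gamma> t) (D t) \<le> M"
    "\<And>u. u \<in> S \<Longrightarrow> \<gamma> u \<in> fst c \<and> ((\<lambda>u. snd c (\<gamma> u)) has_vector_derivative D u) (at u)"
    using \<gamma> T unfolding curve_at_def by metis
  show "\<exists>S D. open S \<and> t \<in> S \<and> continuous_on S D \<and> gn c (\<gamma>' t) (D t) \<le> M \<and>
      (\<forall>u\<in>S. \<gamma>' u \<in> fst c \<and> ((\<lambda>u. snd c (\<gamma>' u)) has_vector_derivative D u) (at u))"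
  proof (intro exI[of _ "S \<inter> T"] exI[of _ D] conjI ballI)
    fix u assume u: "u \<in> S \<inter> T"
    then show "\<gamma>' u \<in> fst c" using S(5)[of u] T(3)[of u] by simp
    show "((\<lambda>u. snd c (\<gamma>' u)) has_vector_derivative D u) (at u)"
      by (rule has_vector_derivative_transform_within_open[of "\<lambda>u. snd c (\<gamma> u)" "D u" u "S \<inter> T"])
        (use S(1) S(5)[of u] u T(1,3) in auto)
  qed (use S T in \<open>auto intro: continuous_on_subset\<close>)
qed

lemma curve_at_affine:
  assumes \<gamma>: "curve_at \<gamma> (2 * t + k) M"
  shows "curve_at (\<lambda>u. \<gamma> (2 * u + k)) t (2 * M)"
  unfolding curve_at_def
proof (intro conjI ballI impI)
  show "isCont (\<lambda>u. \<gamma> (2 * u + k)) t"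
  proof (rule isCont_o2[where f = "\<lambda>u. 2 * u + k" and g = \<gamma>])
    show "isCont (\<lambda>u. 2 * u + k) t" by (intro continuous_intros)
    show "isCont \<gamma> (2 * t + k)" using \<gamma> by (simp add: curve_at_def)
  qed
  fix c assume c: "c \<in> A" "\<gamma> (2 * t + k) \<in> fst c"
  then obtain S D where S: "open S" "2 * t + k \<in> S" "continuous_on S D" "gn c (\<gamma> (2 * t + k)) (D (2 * t + k)) \<le> M"
    "\<And>u. u \<in> S \<Longrightarrow> \<gamma> u \<in> fst c \<and> ((\<lambda>u. snd c (\<gamma> u)) has_vector_derivative D u) (at u)"
    using \<gamma> unfolding curve_at_def by metis
  let ?S = "(\<lambda>u. 2 * u + k) -` S"
  show "\<exists>S D. open S \<and> t \<in> S \<and> continuous_on S D \<and> gn c (\<gamma> (2 * t + k)) (D t) \<le> 2 * M \<and>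
      (\<forall>u\<in>S. \<gamma> (2 * u + k) \<in> fst c \<and> ((\<lambda>u. snd c (\<gamma> (2 * u + k))) has_vector_derivative D u) (at u))"
  proof (intro exI[of _ ?S] exI[of _ "\<lambda>u. 2 *\<^sub>R D (2 * u + k)"] conjI ballI)
    show "open ?S" using S(1) by (intro open_vimage) (auto intro!: continuous_intros)
    show "continuous_on ?S (\<lambda>u. 2 *\<^sub>R D (2 * u + k))"
      by (intro continuous_intros continuous_on_compose2[OF S(3)]) auto
    show "gn c (\<gamma> (2 * t + k)) (2 *\<^sub>R D (2 * t + k)) \<le> 2 * M"
      using S(4) by (simp add: gn_scaleR[OF c])
    fix u assume u: "u \<in> ?S"
    then show "\<gamma> (2 * u + k) \<in> fst c" using S(5) by simp
    have "((\<lambda>u. 2 * u + k) has_vector_derivative 2) (at u)"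
      unfolding has_real_derivative_iff_has_vector_derivative[symmetric] by (auto intro!: derivative_eq_intros)
    moreover have "((\<lambda>u. snd c (\<gamma> u)) has_vector_derivative D (2 * u + k)) (at (2 * u + k))"
      using S(5) u by simp
    ultimately show "((\<lambda>u. snd c (\<gamma> (2 * u + k))) has_vector_derivative 2 *\<^sub>R D (2 * u + k)) (at u)"
      by (rule vector_diff_chain_at[unfolded o_def])
  qed (use S(2) in simp)
qed

text \<open>Constancy near the end points makes concatenations \<open>C\<^sup>1\<close>.\<close>

definition path_bound :: "'m \<Rightarrow> 'm \<Rightarrow> real \<Rightarrow> bool" where
  "path_bound x y L \<longleftrightarrow> (\<exists>\<gamma> \<delta> m. 0 < \<delta> \<and> (\<forall>t<\<delta>. \<gamma> t = x) \<and> (\<forall>t>1-\<delta>. \<gamma> t = y) \<and>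
     (m has_integral L) {0..1} \<and> (\<forall>t\<in>{0..1}. curve_at \<gamma> t (m t)))"

lemma path_bound_join:
  assumes "path_bound x y L" "path_bound y z L'"
  shows "path_bound x z (L + L')"
proof -
  obtain \<gamma>1 \<delta>1 m1 where 1: "0 < \<delta>1" "\<And>t. t < \<delta>1 \<Longrightarrow> \<gamma>1 t = x" "\<And>t. t > 1 - \<delta>1 \<Longrightarrow> \<gamma>1 t = y"
      "(m1 has_integral L) {0..1}" "\<And>t. t \<in> {0..1} \<Longrightarrow> curve_at \<gamma>1 t (m1 t)"
    using assms(1) unfolding path_bound_def by blast
  obtain \<gamma>2 \<delta>2 m2 where 2: "0 < \<delta>2" "\<And>t. t < \<delta>2 \<Longrightarrow> \<gamma>2 t = y" "\<And>t. t > 1 - \<delta>2 \<Longrightarrow> \<gamma>2 t = z"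
      "(m2 has_integral L') {0..1}" "\<And>t. t \<in> {0..1} \<Longrightarrow> curve_at \<gamma>2 t (m2 t)"
    using assms(2) unfolding path_bound_def by blast
  \<comment> \<open>The summands 0 and - 1 are written out to match the parameter k of
    \<open>curve_at_affine\<close> and the form of \<open>has_integral_affinity\<close>.\<close>
  define \<gamma> where "\<gamma> u = (if u \<le> 1 / 2 then \<gamma>1 (2 * u + 0) else \<gamma>2 (2 * u + - 1))" for u :: real
  define m where "m u = (if u \<le> 1 / 2 then 2 * m1 (2 * u + 0) else 2 * m2 (2 * u + - 1))" for u :: real
  define \<delta> where "\<delta> = min (1 / 2) (min (\<delta>1 / 2) (\<delta>2 / 2))"
  have "0 < \<delta>" using 1(1) 2(1) by (simp add: \<delta>_def)
  moreover have "\<gamma> t = x" if "t < \<delta>" for t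
    using that 1(2)[of "2 * t"] by (simp add: \<gamma>_def \<delta>_def)
  moreover have "\<gamma> t = z" if "t > 1 - \<delta>" for t
    using that 2(3)[of "2 * t - 1"] by (simp add: \<gamma>_def \<delta>_def min_def split: if_splits)
  moreover have "(m has_integral (L + L')) {0..1}"
  proof (rule has_integral_combine[where c = "1/2"])
    have "((\<lambda>u. m1 (2 * u + 0)) has_integral L / 2) {0..1/2}"
      using has_integral_affinity[of m1 L 0 1 2 0] 1(4) by (simp add: cbox_interval)
    from has_integral_mult_right[OF this, of 2]
    have "((\<lambda>u. 2 * m1 (2 * u + 0)) has_integral L) {0..1/2}" by simp
    then show "(m has_integral L) {0..1/2}"
      by (rule has_integral_eq[rotated]) (simp add: m_def)
    have "((\<lambda>u. m2 (2 * u + - 1)) has_integral L' / 2) {1/2..1}"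
      using has_integral_affinity[of m2 L' 0 1 2 "-1"] 2(4) image_affinity_atLeastAtMost[of "1/2::real" "1/2" 0 1]
      by (simp add: cbox_interval)
    from has_integral_mult_right[OF this, of 2]
    have "((\<lambda>u. 2 * m2 (2 * u + - 1)) has_integral L') {1/2..1}" by simp
    then show "(m has_integral L') {1/2..1}"
      by (rule has_integral_spike_finite[of "{1/2}", rotated 2]) (auto simp: m_def)
  qed auto
  moreover have "curve_at \<gamma> t (m t)" if t: "t \<in> {0..1}" for t
  proof (cases "t \<le> 1 / 2")
    case True
    have "curve_at (\<lambda>u. \<gamma>1 (2 * u + 0)) t (2 * m1 (2 * t + 0))"
      using t True by (intro curve_at_affine 1(5)) auto
    then have "curve_at \<gamma> t (2 * m1 (2 * t + 0))"
    \<comment> \<open>The first formula remains valid a little beyond 1/2, as both curves rest at y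
      there.\<close>
    proof (rule curve_at_cong[where T = "{..<1/2 + \<delta>2 / 2}"])
      show "\<gamma>1 (2 * u + 0) = \<gamma> u" if "u \<in> {..<1/2 + \<delta>2 / 2}" for u
        using that 1(1) 1(3)[of "2 * u"] 2(2)[of "2 * u - 1"] by (auto simp: \<gamma>_def)
    qed (use True 2(1) in auto)
    then show ?thesis using True by (simp add: m_def)
  next
    case False
    have "curve_at (\<lambda>u. \<gamma>2 (2 * u + - 1)) t (2 * m2 (2 * t + - 1))"
      using t False by (intro curve_at_affine 2(5)) auto
    then have "curve_at \<gamma> t (2 * m2 (2 * t + - 1))"
      by (rule curve_at_cong[where T = "{1/2<..}"]) (use False in \<open>auto simp: \<gamma>_def\<close>)
    then show ?thesis using False by (simp add: m_def)
  qed
  ultimately show ?thesis unfolding path_bound_def by blast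
qed

lemma path_bound_dist:
  assumes "path_bound x y L"
  shows "riemannian_dist A g x y \<le> ennreal L"
proof -
  obtain \<gamma> \<delta> m where \<delta>: "0 < \<delta>" "\<And>t. t < \<delta> \<Longrightarrow> \<gamma> t = x" "\<And>t. t > 1 - \<delta> \<Longrightarrow> \<gamma> t = y"
      and m: "(m has_integral L) {0..1}" and \<gamma>: "\<And>t. t \<in> {0..1} \<Longrightarrow> curve_at \<gamma> t (m t)"
    using assms unfolding path_bound_def by blast
  have cont: "isCont \<gamma> t" if "t \<in> {0..1}" for t using \<gamma>[OF that] by (simp add: curve_at_def)
  have C1: "C1_curve A \<gamma>"
    unfolding C1_curve_def
  proof (intro conjI ballI)
    show "continuous_on {0..1} \<gamma>" by (intro continuous_at_imp_continuous_on ballI cont)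
    fix c assume c: "c \<in> A"
    let ?X = "{t\<in>{0..1}. \<gamma> t \<in> fst c}"
    \<comment> \<open>The local derivatives D all agree with \<open>vector_derivative\<close>, which
      thus serves as one globally defined derivative.\<close>
    let ?V = "\<lambda>t. vector_derivative (\<lambda>u. snd c (\<gamma> u)) (at t)"
    have *: "isCont ?V t \<and> ((\<lambda>u. snd c (\<gamma> u)) has_vector_derivative ?V t) (at t)" if "t \<in> ?X" for t
    proof -
      have t: "t \<in> {0..1}" "\<gamma> t \<in> fst c" using that by auto
      obtain S D where S: "open S" "t \<in> S" "continuous_on S D" "gn c (\<gamma> t) (D t) \<le> m t"
        "\<And>u. u \<in> S \<Longrightarrow> \<gamma> u \<in> fst c"
        "\<And>u. u \<in> S \<Longrightarrow> ((\<lambda>u. snd c (\<gamma> u)) has_vector_derivative D u) (at u)"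
        using curve_atE[OF \<gamma>[OF t(1)] c t(2)] by metis
      have V: "?V u = D u" if "u \<in> S" for u by (rule vector_derivative_at[OF S(6)[OF that]])
      have "continuous_on S ?V" by (rule continuous_on_eq[OF S(3)]) (rule V[symmetric])
      then have "isCont ?V t" using continuous_on_eq_continuous_at[OF S(1)] S(2) by blast
      moreover have "((\<lambda>u. snd c (\<gamma> u)) has_vector_derivative ?V t) (at t)"
        using S(6)[OF S(2)] unfolding V[OF S(2)] .
      ultimately show ?thesis ..
    qed
    show "\<exists>D. continuous_on ?X D \<and>
        (\<forall>t\<in>?X. ((\<lambda>u. snd c (\<gamma> u)) has_vector_derivative D t) (at t within {0..1}))"
      using * by (intro exI[of _ ?V] conjI continuous_at_imp_continuous_on ballI)
        (auto intro: has_vector_derivative_at_within)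
  qed
  have "curve_length A g \<gamma> \<le> L"
    unfolding curve_length_speed
  proof (rule has_integral_le[OF integrable_integral m])
    show "speed \<gamma> integrable_on {0..1}" by (rule integrable_continuous_interval[OF continuous_speed[OF C1]])
    fix t :: real assume t: "t \<in> {0..1}"
    obtain c where c: "c \<in> A" "\<gamma> t \<in> fst c" using chart_exists by blast
    obtain D where D: "gn c (\<gamma> t) (D t) \<le> m t" "((\<lambda>u. snd c (\<gamma> u)) has_vector_derivative D t) (at t)"
      by (rule curve_atE[OF \<gamma>[OF t] c]) blast
    have "speed \<gamma> t = gn c (\<gamma> t) (D t)"
      using c t D cont[OF t] by (intro speed_eq) (auto intro: has_vector_derivative_at_within continuous_at_imp_continuous_within)
    then show "speed \<gamma> t \<le> m t" using D by simp
  qed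
  moreover have "riemannian_dist A g x y \<le> ennreal (curve_length A g \<gamma>)"
    unfolding riemannian_dist_def using C1 \<delta> by (intro INF_lower) auto
  ultimately show ?thesis using ennreal_leI order_trans by blast
qed

lemma gball_convex:
  assumes cp: "c \<in> A" "p \<in> fst c" and ab: "gn c p (a - q) < r" "gn c p (b - q) < r" and t: "0 \<le> t" "t \<le> 1"
  shows "gn c p (a + t *\<^sub>R (b - a) - q) < r"
proof -
  have "a + t *\<^sub>R (b - a) - q = (1 - t) *\<^sub>R (a - q) + t *\<^sub>R (b - q)" by (simp add: algebra_simps)
  then have "gn c p (a + t *\<^sub>R (b - a) - q) \<le> (1 - t) * gn c p (a - q) + t * gn c p (b - q)"
    using gn_triangle[OF cp, of "(1 - t) *\<^sub>R (a - q)" "t *\<^sub>R (b - q)"] t by (simp add: gn_scaleR[OF cp])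
  also have "\<dots> < r"
    using ab t by (cases "t = 0") (auto intro!: convex_bound_lt[of _ r _ "1 - t" t] )
  finally show ?thesis .
qed

lemma segment_path:
  assumes good: "good c p r" and y: "y \<in> gball c p r" and z: "z \<in> gball c p r"
  shows "path_bound y z (2 * gn c p (snd c z - snd c y))"
proof -
  note cp = goodD[OF good]
  define a b where "a = snd c y" and "b = snd c z"
  \<comment> \<open>Constant for t \<le> 1/4 and for t \<ge> 3/4, which provides the rest at both
    ends that \<open>path_bound\<close> requires.\<close>
  define \<phi> \<phi>' where "\<phi> t = smoothstep (2 * t - 1 / 2)" and "\<phi>' t = 2 * smoothstep' (2 * t - 1 / 2)" for t
  have \<phi>: "(\<phi> has_real_derivative \<phi>' t) (at t)" for t
  proof -
    have "((\<lambda>t. 2 * t - 1 / 2 :: real) has_real_derivative 2) (at t)"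
      by (auto intro!: derivative_eq_intros)
    from DERIV_chain2[OF smoothstep_deriv this] show ?thesis
      by (simp add: \<phi>_def[abs_def] \<phi>'_def mult.commute)
  qed
  have cont_\<phi>: "continuous_on S \<phi>" "continuous_on S \<phi>'" for S
  proof -
    show "continuous_on S \<phi>" using \<phi> DERIV_isCont continuous_at_imp_continuous_on by blast
    show "continuous_on S \<phi>'"
      unfolding \<phi>'_def
      by (intro continuous_intros continuous_on_compose2[OF continuous_smoothstep'[of UNIV]]) auto
  qed
  define l where "l t = a + \<phi> t *\<^sub>R (b - a)" for t
  define \<gamma> where "\<gamma> t = inv_chart c (l t)" for t
  have ab: "gn c p (a - snd c p) < r" "gn c p (b - snd c p) < r"
    using y z by (auto simp: gball_def a_def b_def)
  have l: "gn c p (l t - snd c p) \<le> r" for t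
    unfolding l_def by (rule less_imp_le, rule gball_convex[OF cp(1,2) ab])
      (simp_all add: \<phi>_def smoothstep_nonneg smoothstep_le)
  have \<gamma>: "\<gamma> t \<in> gcball c p r" "snd c (\<gamma> t) = l t" for t
    unfolding \<gamma>_def using inv_chart_gcball[OF good l] by auto
  have \<gamma>c: "\<gamma> t \<in> fst c" for t using \<gamma>(1) gball_subset(2) by blast
  have cont_l: "continuous_on S l" for S unfolding l_def by (intro continuous_intros cont_\<phi>)
  have cont_\<gamma>: "continuous_on UNIV \<gamma>"
    unfolding \<gamma>_def using l cp(4) by (intro continuous_on_compose2[OF continuous_inv_chart[OF cp(1)] cont_l]) blast
  have l': "(l has_vector_derivative \<phi>' t *\<^sub>R (b - a)) (at t)" for t
    unfolding l_def has_vector_derivative_def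
    using \<phi>[of t, unfolded has_field_derivative_def]
    by (auto intro!: derivative_eq_intros simp: mult.commute)
  have "curve_at \<gamma> t (2 * gn c p (b - a) * \<phi>' t)" for t
    unfolding curve_at_def
  proof (intro conjI ballI impI)
    show "isCont \<gamma> t" using cont_\<gamma> by (simp add: continuous_on_eq_continuous_at)
    fix d assume d: "d \<in> A" "\<gamma> t \<in> fst d"
    let ?S = "\<gamma> -` fst d"
    let ?D = "\<lambda>u. \<phi>' u *\<^sub>R der c (snd d) (\<gamma> u) (b - a)"
    have "open ?S" using open_vimage[OF open_dom[OF d(1)] cont_\<gamma>] .
    moreover have "continuous_on ?S ?D"
      unfolding der_def \<gamma>(2)
    proof (intro continuous_intros cont_\<phi> continuous_on_compose2[OF Ck_on_1D(2)[OF transition_Ck[OF cp(1) d(1)]] cont_l])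
      show "l ` ?S \<subseteq> snd c ` (fst c \<inter> fst d)"
      proof safe
        fix u assume "\<gamma> u \<in> fst d"
        then show "l u \<in> snd c ` (fst c \<inter> fst d)" using \<gamma>c[of u] \<gamma>(2)[of u] by (metis IntI imageI)
      qed
    qed
    moreover have "gn d (\<gamma> t) (?D t) \<le> 2 * gn c p (b - a) * \<phi>' t"
    proof -
      have "gn d (\<gamma> t) (?D t) = \<phi>' t * gn c (\<gamma> t) (b - a)"
        using gn_transfer[OF cp(1) d(1) \<gamma>c d(2), of "b - a"] gn_scaleR[OF d]
        by (simp add: \<phi>'_def smoothstep'_nonneg)
      also have "\<dots> \<le> \<phi>' t * (2 * gn c p (b - a))"
        using cp(6)[OF \<gamma>(1)] by (intro mult_left_mono) (auto simp: \<phi>'_def smoothstep'_nonneg)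
      finally show ?thesis by (simp add: mult.commute)
    qed
    moreover have "((\<lambda>u. snd d (\<gamma> u)) has_vector_derivative ?D u) (at u)" if "u \<in> ?S" for u
    proof -
      have T: "(local_rep c (snd d) has_derivative der c (snd d) (\<gamma> u)) (at (l u))"
        using transition_has_der[OF cp(1) d(1) \<gamma>c, of u] that by (simp add: \<gamma>(2))
      have "((\<lambda>u. local_rep c (snd d) (l u)) has_derivative (\<lambda>h. der c (snd d) (\<gamma> u) (h *\<^sub>R \<phi>' u *\<^sub>R (b - a)))) (at u)"
        using has_derivative_compose[OF l'[of u, unfolded has_vector_derivative_def] T] .
      then show ?thesis
        unfolding has_vector_derivative_def linear_cmul[OF has_derivative_linear[OF T]]
        by (simp add: local_rep_def \<gamma>_def inv_chart_def)
    qed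
    ultimately show "\<exists>S D. open S \<and> t \<in> S \<and> continuous_on S D \<and> gn d (\<gamma> t) (D t) \<le> 2 * gn c p (b - a) * \<phi>' t \<and>
        (\<forall>u\<in>S. \<gamma> u \<in> fst d \<and> ((\<lambda>u. snd d (\<gamma> u)) has_vector_derivative D u) (at u))"
      using d(2) by (intro exI[of _ ?S] exI[of _ ?D]) auto
  qed
  moreover have "((\<lambda>t. 2 * gn c p (b - a) * \<phi>' t) has_integral 2 * gn c p (b - a) * (\<phi> 1 - \<phi> 0)) {0..1}"
    by (intro has_integral_mult_right fundamental_theorem_of_calculus)
      (use \<phi> in \<open>auto simp: has_real_derivative_iff_has_vector_derivative[symmetric] intro: has_field_derivative_at_within\<close>)
  moreover have "\<gamma> t = y" if "t < 1/4" for t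
    using that y inv_chart_coord[OF cp(1), of y] by (simp add: \<gamma>_def l_def \<phi>_def smoothstep_0 a_def gball_def)
  moreover have "\<gamma> t = z" if "t > 1 - 1/4" for t
    using that z inv_chart_coord[OF cp(1), of z] by (simp add: \<gamma>_def l_def \<phi>_def smoothstep_1 b_def gball_def)
  moreover have "\<phi> 1 - \<phi> 0 = 1" by (simp add: \<phi>_def smoothstep_0 smoothstep_1)
  ultimately show ?thesis
    unfolding path_bound_def a_def[symmetric] b_def[symmetric]
    by (intro exI[of _ \<gamma>] exI[of _ "1/4"] exI[of _ "\<lambda>t. 2 * gn c p (b - a) * \<phi>' t"]) auto
qed

text \<open>Strictness makes balls of chains open and leaves room to shorten every step. The center
  p may differ from both points, which makes the relation symmetric.\<close>

definition step :: "'m \<Rightarrow> 'm \<Rightarrow> real \<Rightarrow> bool" where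
  "step y z s \<longleftrightarrow> (\<exists>c p r. good c p r \<and> y \<in> gball c p r \<and> z \<in> gball c p r \<and> gn c p (snd c z - snd c y) < s)"

text \<open>\<open>reach x L y\<close> plays the role of d(x,y) < L for the metric d of
  chains.\<close>

inductive reach :: "'m \<Rightarrow> real \<Rightarrow> 'm \<Rightarrow> bool" for x where
  start: "0 < L \<Longrightarrow> reach x L x"
| extend: "reach x L y \<Longrightarrow> step y z s \<Longrightarrow> reach x (L + s) z"

lemma step_pos: "step y z s \<Longrightarrow> 0 < s"
  unfolding step_def using gn_nonneg goodD(1,2) by (meson order.strict_trans1)

lemma step_refl:
  assumes "0 < s"
  shows "step y y s"
proof -
  obtain c where c: "c \<in> A" "y \<in> fst c" using chart_exists by blast
  obtain r where "good c y r" using good_exists[OF c] by blast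
  then show ?thesis
    unfolding step_def using c assms goodD(3)
    by (intro exI[of _ c] exI[of _ y] exI[of _ r]) (auto simp: gball_center gn_0)
qed

lemma step_sym: "step y z s \<Longrightarrow> step z y s"
  unfolding step_def using gn_minus_commute goodD(1,2) by metis

lemma step_dense: "step y z s \<Longrightarrow> \<exists>s'<s. step y z s'"
  unfolding step_def using dense by meson

text \<open>Cut the coordinate segment in the ratio a : b.\<close>

lemma step_split:
  assumes "step y z t" "0 < a" "0 < b" "t \<le> a + b"
  shows "\<exists>w. step y w a \<and> step w z b"
proof -
  obtain c p r where good: "good c p r" and yz: "y \<in> gball c p r" "z \<in> gball c p r"
    and less: "gn c p (snd c z - snd c y) < t"
    using assms(1) unfolding step_def by blast
  note cp = goodD[OF good]
  define k where "k = a / (a + b)"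
  have k: "0 \<le> k" "k \<le> 1" using assms by (auto simp: k_def)
  have k': "0 < k" "k < 1" using assms by (auto simp: k_def)
  define q where "q = snd c y + k *\<^sub>R (snd c z - snd c y)"
  have q: "gn c p (q - snd c p) < r"
    unfolding q_def using yz k by (intro gball_convex[OF cp(1,2)]) (auto simp: gball_def)
  define w where "w = inv_chart c q"
  have w: "w \<in> gball c p r" "snd c w = q"
    using inv_chart_gcball[OF good less_imp_le[OF q]] q by (auto simp: w_def gball_def gcball_def)
  have N: "gn c p (snd c z - snd c y) < a + b" using less assms by linarith
  have "q - snd c y = k *\<^sub>R (snd c z - snd c y)" "snd c z - q = (1 - k) *\<^sub>R (snd c z - snd c y)"
    by (simp_all add: q_def algebra_simps)
  then have "gn c p (q - snd c y) = k * gn c p (snd c z - snd c y)"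
    "gn c p (snd c z - q) = (1 - k) * gn c p (snd c z - snd c y)"
    using k by (simp_all add: gn_scaleR[OF cp(1,2)])
  moreover have "k * gn c p (snd c z - snd c y) < k * (a + b)" "(1 - k) * gn c p (snd c z - snd c y) < (1 - k) * (a + b)"
    using N k' by (simp_all add: mult_strict_left_mono)
  moreover have "k * (a + b) = a" "(1 - k) * (a + b) = b" using assms by (auto simp: k_def field_simps)
  ultimately have "gn c p (q - snd c y) < a" "gn c p (snd c z - q) < b" by linarith+
  then show ?thesis unfolding step_def using good yz w by metis
qed

lemma reach_pos: "reach x L y \<Longrightarrow> 0 < L"
  by (induction rule: reach.induct) (auto dest: step_pos)

lemma reach_mono: "reach x L y \<Longrightarrow> L \<le> L' \<Longrightarrow> reach x L' y"
  using extend[OF _ step_refl, of x L y "L' - L"] by (cases "L = L'") auto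

lemma reach_trans: "reach y M z \<Longrightarrow> reach x L y \<Longrightarrow> reach x (L + M) z"
proof (induction rule: reach.induct)
  case (start M)
  then show ?case by (auto intro: reach_mono)
next
  case (extend M y' z s)
  then show ?case using reach.extend[of x "L + M" y' z s] by (simp add: add.assoc)
qed

lemma reach_dense: "reach x L y \<Longrightarrow> \<exists>L'<L. reach x L' y"
proof (induction rule: reach.induct)
  case (start L)
  then show ?case by (intro exI[of _ "L / 2"]) (auto intro: reach.start)
next
  case (extend L y z s)
  then obtain s' where "s' < s" "step y z s'" using step_dense by blast
  then show ?case using extend.hyps(1) by (intro exI[of _ "L + s'"]) (auto intro: reach.extend)
qed

lemma reach_step: "step y z s \<Longrightarrow> reach y s z"
proof -
  assume "step y z s"
  then obtain s' where "s' < s" "step y z s'" using step_dense by blast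
  then show ?thesis using extend[OF start, of "s - s'" y z s'] by simp
qed

lemma reach_sym: "reach x L y \<Longrightarrow> reach y L x"
proof (induction rule: reach.induct)
  case (start L)
  then show ?case by (rule reach.start)
next
  case (extend L y z s)
  then show ?case using reach_trans[OF extend.IH reach_step[OF step_sym[OF extend.hyps(2)]]]
    by (simp add: add.commute)
qed

text \<open>The chain metric is a length metric: a chain can be cut at any prescribed length, inside
  of its last segment, at the start of that segment, or, by induction, before it.\<close>

lemma reach_split:
  "reach x T y \<Longrightarrow> 0 < r \<Longrightarrow> 0 < s \<Longrightarrow> T \<le> r + s \<Longrightarrow> \<exists>z. reach x r z \<and> reach z s y"
proof (induction arbitrary: r s rule: reach.induct)
  case (start L)
  then show ?case by (auto intro: reach.start)
next
  case (extend L y z t)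
  note t = step_pos[OF extend.hyps(2)]
  consider "L < r" | "L = r" | "r < L" by linarith
  then show ?case
  proof cases
    case 1
    then obtain w where w: "step y w (r - L)" "step w z s"
      using step_split[OF extend.hyps(2), of "r - L" s] extend.prems by auto
    then show ?thesis using reach.extend[OF extend.hyps(1) w(1)] reach_step[OF w(2)] by auto
  next
    case 2
    then show ?thesis
      using extend.hyps(1) reach_mono[OF reach_step[OF extend.hyps(2)], of s] extend.prems by auto
  next
    case 3
    then obtain u where u: "reach x r u" "reach u (s - t) y"
      using extend.IH[of r "s - t"] extend.prems by auto
    then show ?thesis using reach.extend[OF u(2) extend.hyps(2)] by auto
  qed
qed

text \<open>The factor 2 is that of \<open>segment_path\<close>, applied to each segment of the
  chain.\<close>

lemma reach_dist: "reach x L y \<Longrightarrow> riemannian_dist A g x y \<le> ennreal (2 * L)"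
proof -
  have "\<exists>L'\<le>2 * L. path_bound x y L'" if "reach x L y" using that
  proof (induction rule: reach.induct)
    case (start L)
    obtain c where c: "c \<in> A" "x \<in> fst c" using chart_exists by blast
    obtain r where "good c x r" using good_exists[OF c] by blast
    then have "path_bound x x (2 * gn c x (snd c x - snd c x))"
      using c goodD(3) by (intro segment_path gball_center)
    then show ?case using start by (intro exI[of _ 0]) (simp add: gn_0[OF c])
  next
    case (extend L y z s)
    then obtain c p r L' where "path_bound x y L'" "L' \<le> 2 * L" "good c p r"
      "y \<in> gball c p r" "z \<in> gball c p r" "gn c p (snd c z - snd c y) < s"
      unfolding step_def by blast
    then show ?case
      using path_bound_join[OF _ segment_path] by (intro exI[of _ "L' + 2 * gn c p (snd c z - snd c y)"]) auto
  qed
  moreover assume "reach x L y"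
  ultimately obtain L' where "L' \<le> 2 * L" "path_bound x y L'" by blast
  then show ?thesis using path_bound_dist ennreal_leI order_trans by blast
qed

text \<open>The chain can be shortened to L', and the spare length L - L' pays for a coordinate ball
  around its end point.\<close>

lemma open_reach: "open {y. reach x L y}"
proof (subst open_subopen, intro ballI)
  fix y assume "y \<in> {y. reach x L y}"
  then obtain L' where L': "L' < L" "reach x L' y" using reach_dense by blast
  obtain c where c: "c \<in> A" "y \<in> fst c" using chart_exists by blast
  obtain r where r: "good c y r" using good_exists[OF c] by blast
  let ?T = "gball c y (min r (L - L'))"
  have "reach x L z" if "z \<in> ?T" for z
  proof -
    have "step y z (L - L')"
      unfolding step_def
      by (intro exI[of _ c] exI[of _ y] exI[of _ r])
        (use that r c goodD(3)[OF r] in \<open>auto simp: gball_center, auto simp: gball_def\<close>)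
    from reach.extend[OF L'(2) this] show ?thesis by simp
  qed
  then show "\<exists>T. open T \<and> y \<in> T \<and> T \<subseteq> {y. reach x L y}"
    using open_gball[OF c] gball_center[OF c] goodD(3)[OF r] L'(1) by (intro exI[of _ ?T]) auto
qed

section \<open>Relative compactness of balls of chains\<close>

definition relc :: "'m set \<Rightarrow> bool" where
  "relc S \<longleftrightarrow> (\<exists>K. compact K \<and> S \<subseteq> K)"

lemma relc_subset: "relc T \<Longrightarrow> S \<subseteq> T \<Longrightarrow> relc S"
  unfolding relc_def by blast

lemma relc_UN: "finite F \<Longrightarrow> (\<And>z. z \<in> F \<Longrightarrow> relc (B z)) \<Longrightarrow> relc (\<Union>z\<in>F. B z)"
proof (induction rule: finite_induct)
  case empty
  then show ?case by (auto simp: relc_def)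
next
  case (insert z F)
  then obtain K K' where "compact K" "B z \<subseteq> K" "compact K'" "(\<Union>z\<in>F. B z) \<subseteq> K'"
    unfolding relc_def by (metis insertCI)
  then show ?case unfolding relc_def by (intro exI[of _ "K \<union> K'"]) (auto intro: compact_Un)
qed

lemma relc_closure:
  assumes "relc S"
  shows "compact (closure S)"
proof -
  obtain K where K: "compact K" "S \<subseteq> K" using assms by (auto simp: relc_def)
  then have "closure S \<subseteq> K" by (intro closure_minimal compact_imp_closed)
  then show ?thesis using K(1) compact_Int_closed[of K "closure S"] by (simp add: Int_absorb1)
qed

text \<open>Finitely many balls of radius w / 8 cover the compact closure of the r-ball. A point
  reached within r + w / 4 is within w / 4 of the r-ball, hence within w / 8 + w / 4 \<le> w / 2 of
  a center. The condition r + w / 4 \<le> w keeps the centers, known only to lie in the closure,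
  inside of the w-ball where q applies.\<close>

lemma relc_grow:
  assumes w: "0 < w" and q: "\<And>q. reach x w q \<Longrightarrow> relc {y. reach q (w / 2) y}"
    and r: "0 < r" "r + w / 4 \<le> w" and rel: "relc {y. reach x r y}"
  shows "relc {y. reach x (r + w / 4) y}"
proof -
  let ?K = "closure {y. reach x r y}"
  have near: "reach x w z" if "z \<in> ?K" for z
  proof -
    have "{y. reach z (w / 8) y} \<inter> {y. reach x r y} \<noteq> {}"
    proof
      assume "{y. reach z (w / 8) y} \<inter> {y. reach x r y} = {}"
      then have "{y. reach z (w / 8) y} \<inter> ?K = {}"
        using open_Int_closure_eq_empty[OF open_reach] by blast
      moreover have "reach z (w / 8) z" using w by (intro start) simp
      ultimately show False using that by blast
    qed
    then obtain y where "reach z (w / 8) y" "reach x r y" by blast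
    then have "reach x (r + w / 8) z" using reach_trans[OF reach_sym] by blast
    then show ?thesis by (rule reach_mono) (use r w in linarith)
  qed
  have "?K \<subseteq> (\<Union>z\<in>?K. {y. reach z (w / 8) y})" using w start[of "w / 8"] by fastforce
  from compactE_image[OF relc_closure[OF rel] open_reach this]
  obtain F where F: "F \<subseteq> ?K" "finite F" "?K \<subseteq> (\<Union>z\<in>F. {y. reach z (w / 8) y})" by blast
  have "relc (\<Union>z\<in>F. {y. reach z (w / 2) y})" using F near by (intro relc_UN q) auto
  then show ?thesis
  proof (rule relc_subset, intro subsetI)
    fix y assume "y \<in> {y. reach x (r + w / 4) y}"
    then obtain u where u: "reach x r u" "reach u (w / 4) y"
      using reach_split[of x "r + w / 4" y r "w / 4"] r w by auto
    then obtain z where z: "z \<in> F" "reach z (w / 8) u" using F(3) closure_subset[of "{y. reach x r y}"] by blast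
    have "reach z (w / 8 + w / 4) y" by (rule reach_trans[OF u(2) z(2)])
    then have "reach z (w / 2) y" by (rule reach_mono) (use w in linarith)
    then show "y \<in> (\<Union>z\<in>F. {y. reach z (w / 2) y})" using z by blast
  qed
qed

text \<open>Supplies the next center in the bisection of \<open>relc_reach\<close>.\<close>

lemma not_relc_half:
  assumes w: "0 < w" and bad: "\<not> relc {y. reach x w y}"
  shows "\<exists>q. reach x w q \<and> \<not> relc {y. reach q (w / 2) y}"
proof (rule ccontr)
  assume "\<not> ?thesis"
  then have q: "\<And>q. reach x w q \<Longrightarrow> relc {y. reach q (w / 2) y}" by blast
  have "relc {y. reach x (w / 2) y}" using w by (intro q start)
  \<comment> \<open>Two growth steps lead from w / 2 over 3 w / 4 to w.\<close>
  from relc_grow[OF w q _ _ this] have "relc {y. reach x (w / 2 + w / 4) y}" using w by auto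
  from relc_grow[OF w q _ _ this] have "relc {y. reach x (w / 2 + w / 4 + w / 4) y}" using w by auto
  then show False using bad by (simp add: field_simps)
qed

end

locale complete_riemannian = riemannian A g
  for A :: "('m::{t2_space,second_countable_topology}, 'e::real_inner) chart set" and g +
  assumes complete: "complete_riemannian_manifold A g"
begin

text \<open>The Hopf--Rinow theorem: otherwise \<open>not_relc_half\<close> yields balls with radii \<open>w / 2 ^ n\<close> that are
  not relatively compact and whose centers form a Cauchy sequence.\<close>

lemma relc_reach:
  assumes w: "0 < w"
  shows "relc {y. reach x w y}"
proof (rule ccontr)
  assume bad: "\<not> relc {y. reach x w y}"
  have "\<exists>X. \<forall>n. (\<not> relc {y. reach (X n) (w / 2 ^ n) y}) \<and> reach (X n) (w / 2 ^ n) (X (Suc n))"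
  proof (rule dependent_nat_choice)
    show "\<exists>x. \<not> relc {y. reach x (w / 2 ^ 0) y}" using bad by auto
    show "\<exists>y. (\<not> relc {z. reach y (w / 2 ^ Suc n) z}) \<and> reach x (w / 2 ^ n) y"
      if "\<not> relc {y. reach x (w / 2 ^ n) y}" for x n
      using not_relc_half[OF _ that] w by (auto simp: mult.commute)
  qed
  then obtain X where X: "\<And>n. \<not> relc {y. reach (X n) (w / 2 ^ n) y}"
    "\<And>n. reach (X n) (w / 2 ^ n) (X (Suc n))" by blast
  have reach: "reach (X n) (3 * w / 2 ^ n) (X m)" if "n \<le> m" for n m
  proof -
    \<comment> \<open>The first k steps sum to 2 w / 2^n - 2 w / 2^(n + k); an extra w / 2^n makes
      the bound positive also for k = 0, as \<open>reach\<close> demands.\<close>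
    have "reach (X n) (3 * w / 2 ^ n - 2 * w / 2 ^ (n + k)) (X (n + k))" for k
    proof (induction k)
      case 0
      then show ?case using w by (auto intro!: start simp: field_simps)
    next
      case (Suc k)
      have "3 * w / 2 ^ n - 2 * w / 2 ^ (n + k) + w / 2 ^ (n + k) = 3 * w / 2 ^ n - 2 * w / 2 ^ (n + Suc k)"
        by (simp add: field_simps)
      then show ?case using reach_trans[OF X(2) Suc.IH] by simp
    qed
    from this[of "m - n"] have "reach (X n) (3 * w / 2 ^ n - 2 * w / 2 ^ m) (X m)" using that by simp
    then show ?thesis by (rule reach_mono) (use w in simp)
  qed
  have dist: "riemannian_dist A g (X n) (X m) \<le> ennreal (6 * w / 2 ^ K)" if "K \<le> n" "K \<le> m" for n m K
  proof -
    have mono: "3 * w / 2 ^ i \<le> 3 * w / 2 ^ K" if "K \<le> i" for i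
      using w that by (intro divide_left_mono) auto
    have "reach (X n) (3 * w / 2 ^ K) (X m)"
    proof (cases "n \<le> m")
      case True
      then show ?thesis using reach_mono[OF reach mono[OF that(1)]] by blast
    next
      case False
      then show ?thesis using reach_mono[OF reach_sym[OF reach] mono[OF that(2)], of n] by simp
    qed
    from reach_dist[OF this] show ?thesis by simp
  qed
  have lim: "(\<lambda>K. k * w / 2 ^ K) \<longlonglongrightarrow> 0" for k
    using tendsto_mult_right_zero[OF LIMSEQ_inverse_realpow_zero[of 2], of "k * w"]
    by (simp add: divide_inverse)
  have "\<exists>K. \<forall>m\<ge>K. \<forall>n\<ge>K. riemannian_dist A g (X m) (X n) < \<epsilon>" if "0 < \<epsilon>" for \<epsilon>
  proof -
    have "(\<lambda>K. ennreal (6 * w / 2 ^ K)) \<longlonglongrightarrow> ennreal 0" by (intro tendsto_ennrealI lim)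
    then have "\<forall>\<^sub>F K in sequentially. ennreal (6 * w / 2 ^ K) < \<epsilon>"
      using that by (intro order_tendstoD(2)) auto
    then obtain K where "ennreal (6 * w / 2 ^ K) < \<epsilon>" by (auto simp: eventually_sequentially)
    then show ?thesis using dist by (meson order.strict_trans1)
  qed
  then obtain z where z: "(\<lambda>n. riemannian_dist A g (X n) z) \<longlonglongrightarrow> 0"
    using complete unfolding complete_riemannian_manifold_def by blast
  obtain c where c: "c \<in> A" "z \<in> fst c" using chart_exists by blast
  obtain r where r: "good c z r" using good_exists[OF c] by blast
  have r0: "0 < r" using goodD(3)[OF r] .
  have "\<forall>\<^sub>F n in sequentially. riemannian_dist A g (X n) z < ennreal (r / 2 / 4) \<and> 2 * w / 2 ^ n < r / 4"
    using r0 by (intro eventually_conj order_tendstoD(2)[OF z] order_tendstoD(2)[OF lim]) auto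
  then obtain n where n: "riemannian_dist A g (X n) z < ennreal (r / 2 / 4)" "2 * w / 2 ^ n < r / 4"
    by (auto simp: eventually_sequentially)
  \<comment> \<open>\<open>dist_stays\<close> is used with radius r / 2 here and with r below: first
    the center, then its whole ball is caught in a compact coordinate ball around the limit
    z.\<close>
  have Xn: "X n \<in> gball c z (r / 2)"
    using dist_stays(2)[OF good_mono[OF r] n(1)] r0 gball_center[OF c, of "r / 2 / 2"] by simp
  have "{y. reach (X n) (w / 2 ^ n) y} \<subseteq> gball c z r"
  proof safe
    fix y assume "reach (X n) (w / 2 ^ n) y"
    from reach_dist[OF this] have "riemannian_dist A g (X n) y \<le> ennreal (2 * w / 2 ^ n)" by simp
    also have "\<dots> < ennreal (r / 4)" using n(2) r0 by (intro ennreal_lessI) auto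
    finally show "y \<in> gball c z r" using dist_stays(1)[OF r] Xn by blast
  qed
  then have "{y. reach (X n) (w / 2 ^ n) y} \<subseteq> gcball c z r" using gball_subset(1) by blast
  then show False using X(1)[of n] compact_gcball[OF r] unfolding relc_def by blast
qed

end

section \<open>Approximation of Lipschitz functions by C1 functions\<close>

section \<open>Smoothing Lipschitz functions\<close>

text \<open>The log-sum-exp minimum: below the true minimum by at most ln (card F) / \<beta>, with
  derivative a convex combination of the derivatives of the u j.\<close>

definition softmin :: "real \<Rightarrow> 'j set \<Rightarrow> ('j \<Rightarrow> 'e \<Rightarrow> real) \<Rightarrow> 'e \<Rightarrow> real" where
  "softmin \<beta> F u q = - (1 / \<beta>) * ln (\<Sum>j\<in>F. exp (- \<beta> * u j q))"

lemma softmin_pos: "finite F \<Longrightarrow> F \<noteq> {} \<Longrightarrow> 0 < (\<Sum>j\<in>F. exp (- \<beta> * u j q :: real))"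
  by (intro sum_pos) auto

lemma softmin_has_derivative:
  assumes F: "finite F" "F \<noteq> {}" and \<beta>: "\<beta> \<noteq> 0"
    and u: "\<And>j. j \<in> F \<Longrightarrow> (u j has_derivative u' j) (at q)"
  shows "(softmin \<beta> F u has_derivative
    (\<lambda>v. (\<Sum>j\<in>F. exp (- \<beta> * u j q) * u' j v) / (\<Sum>j\<in>F. exp (- \<beta> * u j q)))) (at q)"
proof -
  let ?S = "\<lambda>q. \<Sum>j\<in>F. exp (- \<beta> * u j q)"
  have S: "0 < ?S q" by (rule softmin_pos[OF F])
  have "((\<lambda>q. exp (- \<beta> * u j q)) has_derivative (\<lambda>v. exp (- \<beta> * u j q) * (- \<beta> * u' j v))) (at q)"
    if "j \<in> F" for j
    by (rule derivative_eq_intros u[OF that] refl)+ (simp add: mult_ac)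
  then have "(?S has_derivative (\<lambda>v. \<Sum>j\<in>F. exp (- \<beta> * u j q) * (- \<beta> * u' j v))) (at q)"
    by (rule has_derivative_sum)
  from has_derivative_mult_right[OF has_derivative_ln[OF S this], of "- (1 / \<beta>)"]
  have "(softmin \<beta> F u has_derivative (\<lambda>v. - (1 / \<beta>) *
      ((\<Sum>j\<in>F. exp (- \<beta> * u j q) * (- \<beta> * u' j v)) * inverse (?S q)))) (at q)"
    by (simp add: softmin_def[abs_def])
  moreover have "- (1 / \<beta>) * ((\<Sum>j\<in>F. exp (- \<beta> * u j q) * (- \<beta> * u' j v)) * inverse (?S q))
      = (\<Sum>j\<in>F. exp (- \<beta> * u j q) * u' j v) / ?S q" for v
  proof -
    have "(\<Sum>j\<in>F. exp (- \<beta> * u j q) * (- \<beta> * u' j v)) = - \<beta> * (\<Sum>j\<in>F. exp (- \<beta> * u j q) * u' j v)"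
      by (simp add: sum_distrib_left sum_negf mult_ac)
    then show ?thesis using \<beta> by (simp add: divide_inverse)
  qed
  ultimately show ?thesis by simp
qed

lemma softmin_derivative_bound:
  assumes F: "finite F" "F \<noteq> {}" and u': "\<And>j. j \<in> F \<Longrightarrow> \<bar>u' j v\<bar> \<le> C"
  shows "\<bar>(\<Sum>j\<in>F. exp (- \<beta> * u j q) * u' j v) / (\<Sum>j\<in>F. exp (- \<beta> * u j q))\<bar> \<le> (C::real)"
proof -
  have "\<bar>\<Sum>j\<in>F. exp (- \<beta> * u j q) * u' j v\<bar> \<le> (\<Sum>j\<in>F. exp (- \<beta> * u j q) * C)"
    by (intro order_trans[OF sum_abs] sum_mono) (simp add: abs_mult u')
  then show ?thesis
    using softmin_pos[OF F, of \<beta> u q] by (simp add: abs_divide divide_le_eq mult.commute flip: sum_distrib_left)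
qed

lemma softmin_le:
  assumes F: "finite F" "j \<in> F" and \<beta>: "0 < \<beta>"
  shows "softmin \<beta> F u q \<le> u j q"
proof -
  have "exp (- \<beta> * u j q) \<le> (\<Sum>j\<in>F. exp (- \<beta> * u j q))"
    using F by (intro member_le_sum) auto
  then have "- \<beta> * u j q \<le> ln (\<Sum>j\<in>F. exp (- \<beta> * u j q))"
    using F softmin_pos[of F \<beta> u q] by (subst ln_ge_iff) auto
  then show ?thesis using \<beta> by (simp add: softmin_def field_simps)
qed

lemma softmin_ge:
  assumes F: "finite F" "F \<noteq> {}" and \<beta>: "0 < \<beta>" and m: "\<And>j. j \<in> F \<Longrightarrow> m \<le> u j q"
  shows "m - ln (card F) / \<beta> \<le> softmin \<beta> F u q"
proof -
  have "(\<Sum>j\<in>F. exp (- \<beta> * u j q)) \<le> (\<Sum>j\<in>F. exp (- \<beta> * m))"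
    using m \<beta> by (intro sum_mono) simp
  then have "ln (\<Sum>j\<in>F. exp (- \<beta> * u j q)) \<le> ln (card F * exp (- \<beta> * m))"
    using softmin_pos[OF F, of \<beta> u q] by (intro ln_mono) auto
  also have "\<dots> = ln (card F) - \<beta> * m" using F by (simp add: ln_mult card_gt_0_iff)
  finally have "(\<beta> * m - ln (card F)) / \<beta> \<le> (- ln (\<Sum>j\<in>F. exp (- \<beta> * u j q))) / \<beta>"
    using \<beta> by (intro divide_right_mono) auto
  then show ?thesis using \<beta> by (simp add: softmin_def diff_divide_distrib)
qed

lemma Ck_on_1_mult:
  fixes f h :: "'e::real_normed_vector \<Rightarrow> real"
  assumes f: "Ck_on 1 S f" and h: "Ck_on 1 S h"
  shows "Ck_on 1 S (\<lambda>p. f p * h p)"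
proof (rule Ck_on_1I)
  show "((\<lambda>p. f p * h p) has_derivative
      (\<lambda>v. f p * frechet_derivative h (at p) v + frechet_derivative f (at p) v * h p)) (at p)" if "p \<in> S" for p
    by (intro has_derivative_mult Ck_on_1D(1)[OF f that] Ck_on_1D(1)[OF h that])
  show "continuous_on S (\<lambda>p. f p * frechet_derivative h (at p) v + frechet_derivative f (at p) v * h p)" for v
    by (intro continuous_intros Ck_on_1_continuous f h Ck_on_1D(2)[OF f] Ck_on_1D(2)[OF h])
qed

context riemannian
begin

lemma has_der_chart:
  assumes c: "c \<in> A" and U: "open U" "x \<in> U" "U \<subseteq> fst c" "\<And>y. y \<in> U \<Longrightarrow> f y = F (snd c y)"
    and F: "(F has_derivative L) (at (snd c x))"
  shows "(local_rep c f has_derivative L) (at (snd c x))"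
  by (rule has_derivative_transform_within_open[OF F open_coord[OF c U(1,3)]])
    (use U c in \<open>auto simp: local_rep_coord subset_iff\<close>)

text \<open>A step function of the squared frozen distance, which unlike the distance is smooth at
  the center.\<close>

lemma bump:
  assumes good: "good c p b" and a: "0 < a" "a < b"
  shows "\<exists>\<phi>::'m \<Rightarrow> real. C1_map A \<phi> \<and> (\<forall>x. 0 \<le> \<phi> x \<and> \<phi> x \<le> 1) \<and> (\<forall>x\<in>gball c p a. \<phi> x = 1) \<and>
    (\<forall>x. x \<notin> gball c p b \<longrightarrow> \<phi> x = 0 \<and> (\<forall>d\<in>A. x \<in> fst d \<longrightarrow> (\<forall>v. der d \<phi> x v = 0))) \<and>
    (\<exists>M\<ge>0. \<forall>d\<in>A. \<forall>x\<in>fst d. \<forall>v. \<bar>der d \<phi> x v\<bar> \<le> M * gn d x v)"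
proof -
  note cp = goodD[OF good]
  interpret bb: bounded_bilinear "g c p" by (rule gn_bounded_bilinear[OF cp(1,2)])
  \<comment> \<open>Normalizes the argument of \<open>smoothstep\<close> to be at least 1 on the
    inner ball and at most 0 outside of the outer one.\<close>
  define k where "k = b\<^sup>2 - a\<^sup>2"
  have k: "0 < k" using a by (simp add: k_def power_strict_mono)
  define N2 where "N2 q = g c p (q - snd c p) (q - snd c p)" for q
  have N2: "N2 q = (gn c p (q - snd c p))\<^sup>2" for q using gn_sq[OF cp(1,2)] by (simp add: N2_def)
  define Q where "Q q = smoothstep ((b\<^sup>2 - N2 q) / k)" for q
  define Q' where "Q' q v = smoothstep' ((b\<^sup>2 - N2 q) / k) * (- 2 * g c p (q - snd c p) v / k)" for q v
  have N2': "(N2 has_derivative (\<lambda>v. 2 * g c p (q - snd c p) v)) (at q)" for q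
  proof -
    have "((\<lambda>q. q - snd c p) has_derivative (\<lambda>v. v)) (at q)" by (auto intro!: derivative_eq_intros)
    from bb.FDERIV[OF this this] show ?thesis
      using metric_sym[OF cp(1,2)] by (simp add: N2_def[abs_def])
  qed
  have Q': "(Q has_derivative Q' q) (at q)" for q
  proof -
    have "((\<lambda>q. (b\<^sup>2 - N2 q) / k) has_derivative (\<lambda>v. - 2 * g c p (q - snd c p) v / k)) (at q)"
      using k by (auto intro!: derivative_eq_intros N2')
    from has_derivative_compose[OF this smoothstep_deriv[unfolded has_field_derivative_def]]
    show ?thesis by (simp add: Q_def[abs_def] Q'_def[abs_def])
  qed
  have cont_N2: "continuous_on S N2" for S
    unfolding N2_def by (intro bb.continuous_on continuous_intros)
  have Ck: "Ck_on 1 (chart_image c) Q"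
    using Q'
  proof (rule Ck_on_1I)
    show "continuous_on (chart_image c) (\<lambda>q. Q' q v)" for v
      unfolding Q'_def using less_imp_neq[OF k, symmetric]
      by (intro continuous_intros continuous_on_compose2[OF continuous_smoothstep'[of UNIV]] cont_N2
          bb.continuous_on) simp_all
  qed
  define \<phi> where "\<phi> x = (if x \<in> fst c then Q (snd c x) else 0)" for x
  have out: "Q q = 0" "Q' q v = 0" if "b \<le> gn c p (q - snd c p)" for q v
  proof -
    have "b\<^sup>2 \<le> N2 q" unfolding N2 using that cp(3) by (intro power_mono) auto
    then have "(b\<^sup>2 - N2 q) / k \<le> 0" using k by (simp add: divide_nonpos_pos)
    then show "Q q = 0" "Q' q v = 0" by (simp_all add: Q_def Q'_def smoothstep_0 smoothstep'_0)
  qed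
  have C1: "C1_map A \<phi>"
    unfolding \<phi>_def
  proof (rule C1_map_extend[OF cp(1) Ck])
    show "closed (gcball c p b)" by (rule compact_imp_closed[OF compact_gcball[OF good]])
  qed (auto simp: gcball_def intro!: out)
  have der_c: "der c \<phi> x = Q' (snd c x)" if "x \<in> fst c" for x
    by (rule der_eqI, rule has_der_chart[OF cp(1) open_dom[OF cp(1)] that order_refl _ Q'])
      (simp add: \<phi>_def)
  have "\<phi> x = 1" if "x \<in> gball c p a" for x
  proof -
    have x: "x \<in> fst c" "gn c p (snd c x - snd c p) < a" using that by (auto simp: gball_def)
    then have "N2 (snd c x) \<le> a\<^sup>2" unfolding N2 using gn_nonneg[OF cp(1,2)] by (intro power_mono) auto
    then have "1 \<le> (b\<^sup>2 - N2 (snd c x)) / k" using k by (simp add: k_def)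
    then show ?thesis using x by (simp add: \<phi>_def Q_def smoothstep_1)
  qed
  moreover have "0 \<le> \<phi> x \<and> \<phi> x \<le> 1" for x
    by (simp add: \<phi>_def Q_def smoothstep_nonneg smoothstep_le)
  moreover have \<phi>0: "\<phi> x = 0" if "x \<notin> gball c p b" for x
    using that by (auto simp: \<phi>_def gball_def intro!: out)
  moreover have der0: "der d \<phi> x v = 0" if x: "x \<notin> gball c p b" and d: "d \<in> A" "x \<in> fst d" for x d v
  proof (cases "x \<in> fst c")
    case True
    then have "der c \<phi> x w = 0" for w using x by (auto simp: der_c gball_def intro!: out)
    then show ?thesis using der_transfer[OF C1 d(1) cp(1) d(2) True] by simp
  next
    case False
    have "der d \<phi> x v = der d (\<lambda>x. 0) x v"
    proof (rule der_eq_local[OF C1_map_const(1) d, of "- gcball c p b"])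
      show "open (- gcball c p b)" using compact_imp_closed[OF compact_gcball[OF good]] by blast
      show "x \<in> - gcball c p b" using False by (auto simp: gcball_def)
      show "0 = \<phi> y" if "y \<in> - gcball c p b" for y using that \<phi>0[of y] gball_subset(1) by fastforce
    qed
    then show ?thesis by (simp add: der_const)
  qed
  \<comment> \<open>The 8 is 2 (bound of \<open>smoothstep'\<close>) times 2 (derivative of a
    square) times 2 (frozen against true metric).\<close>
  moreover have "\<bar>der d \<phi> x v\<bar> \<le> 8 * b / k * gn d x v" if d: "d \<in> A" "x \<in> fst d" for d x v
  proof (cases "x \<in> gball c p b")
    case False
    then show ?thesis using der0[OF False d] gn_nonneg[OF d] k cp(3) by simp
  next
    case True
    then have x: "x \<in> fst c" "gn c p (snd c x - snd c p) < b" "x \<in> gcball c p b"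
      by (auto simp: gball_def gcball_def)
    have "norm (der c \<phi> x w) \<le> 8 * b / k * gn c x w" for w
    proof -
      have "\<bar>g c p (snd c x - snd c p) w\<bar> \<le> gn c p (snd c x - snd c p) * gn c p w"
        by (rule metric_le[OF cp(1,2)])
      also have "\<dots> \<le> b * (2 * gn c x w)"
        using x cp(5)[OF x(3)] cp(3) gn_nonneg[OF cp(1,2)] by (intro mult_mono) auto
      finally have "2 * (2 * \<bar>g c p (snd c x - snd c p) w\<bar> / k) \<le> 2 * (2 * (b * (2 * gn c x w)) / k)"
        using k by (simp add: divide_right_mono)
      moreover have "norm (der c \<phi> x w) \<le> 2 * (2 * \<bar>g c p (snd c x - snd c p) w\<bar> / k)"
        unfolding der_c[OF x(1)] Q'_def real_norm_def abs_mult
        using smoothstep'_le smoothstep'_nonneg k by (intro mult_mono) (auto simp: abs_mult)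
      ultimately show ?thesis by simp
    qed
    from der_bound_transfer[OF C1 d(1) cp(1) d(2) x(1) this] show ?thesis by simp
  qed
  moreover have "0 \<le> 8 * b / k" using k cp(3) by simp
  ultimately show ?thesis using C1 by blast
qed

text \<open>A Lipschitz function is an infimum of cones.  A soft minimum of finitely many cones with rounded
  tips is \<open>C\<^sup>1\<close> and does not have a larger Lipschitz constant.\<close>

lemma smooth_on_ball:
  assumes good: "good c p r" and L: "0 < L" and \<delta>: "0 < \<delta>"
    and lip: "\<And>y z. y \<in> gball c p r \<Longrightarrow> z \<in> gball c p r \<Longrightarrow> \<bar>h y - h z\<bar> \<le> L * gn c p (snd c y - snd c z)"
  shows "\<exists>w::'m \<Rightarrow> real. C1_map A w \<and> (\<forall>x\<in>gball c p (r / 2). \<bar>w x - h x\<bar> \<le> \<delta> \<and>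
    (\<forall>v. \<bar>der c w x v\<bar> \<le> 2 * L * gn c x v))"
proof -
  note cp = goodD[OF good]
  interpret bb: bounded_bilinear "g c p" by (rule gn_bounded_bilinear[OF cp(1,2)])
  let ?N = "gn c p"
  \<comment> \<open>In the upper estimate three errors of L \<eta> add up to \<delta>: the distance
    to the nearby center j, the rounding of the tip, and the change of h up to that center.\<close>
  define \<eta> where "\<eta> = \<delta> / (3 * L)"
  have \<eta>: "0 < \<eta>" "3 * L * \<eta> = \<delta>" using L \<delta> by (auto simp: \<eta>_def)
  let ?K = "{q. ?N (q - snd c p) \<le> r / 2}"
  have "open {q. ?N (q - j) < \<eta>}" for j
    by (intro open_Collect_less continuous_gn[OF cp(1,2)] continuous_intros)
  moreover have "?K \<subseteq> (\<Union>j\<in>?K. {q. ?N (q - j) < \<eta>})" using \<eta> gn_0[OF cp(1,2)] by fastforce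
  ultimately obtain F where F: "F \<subseteq> ?K" "finite F" "?K \<subseteq> (\<Union>j\<in>F. {q. ?N (q - j) < \<eta>})"
    using compactE_image[OF compact_gn_cball[OF cp(1,2), of "snd c p" "r / 2"], of ?K "\<lambda>j. {q. ?N (q - j) < \<eta>}"]
    by blast
  have "snd c p \<in> ?K" using gn_0[OF cp(1,2)] cp(3) by simp
  then have F0: "F \<noteq> {}" using F(3) by blast
  \<comment> \<open>Keeps the loss ln (card F) / \<beta> at most \<delta>; the + 1 makes \<beta>
    positive if F has one element.\<close>
  define \<beta> where "\<beta> = (ln (card F) + 1) / \<delta>"
  have lnF: "0 \<le> ln (real (card F))"
    using F0 F(2) by (intro ln_ge_zero) (simp add: Suc_leI card_gt_0_iff)
  then have \<beta>: "0 < \<beta>" "ln (card F) / \<beta> \<le> \<delta>" using \<delta> by (auto simp: \<beta>_def field_simps add_pos_nonneg)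
  define S where "S j q = sqrt (g c p (q - j) (q - j) + \<eta>\<^sup>2)" for j q
  have S0: "0 < g c p (q - j) (q - j) + \<eta>\<^sup>2" for j q
    using gn_sq[OF cp(1,2), of "q - j"] \<eta>(1) by (metis add_nonneg_pos zero_le_power2 zero_less_power)
  have S: "?N (q - j) \<le> S j q" "S j q \<le> ?N (q - j) + \<eta>" "0 < S j q" for j q
  proof -
    show "?N (q - j) \<le> S j q" unfolding S_def gn_def by (rule real_sqrt_le_mono) simp
    show "S j q \<le> ?N (q - j) + \<eta>"
      unfolding S_def gn_sq[OF cp(1,2), symmetric]
      using sqrt_sum_squares_le_sum[of "?N (q - j)" \<eta>] gn_nonneg[OF cp(1,2)] \<eta>(1) by simp
    show "0 < S j q" unfolding S_def using S0 by simp
  qed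
  have S': "(S j has_derivative (\<lambda>v. g c p (q - j) v / S j q)) (at q)" for j q
  proof -
    have "((\<lambda>q. q - j) has_derivative (\<lambda>v. v)) (at q)" by (auto intro!: derivative_eq_intros)
    from bb.FDERIV[OF this this] have "((\<lambda>q. g c p (q - j) (q - j)) has_derivative (\<lambda>v. 2 * g c p (q - j) v)) (at q)"
      using metric_sym[OF cp(1,2)] by simp
    then have "((\<lambda>q. g c p (q - j) (q - j) + \<eta>\<^sup>2) has_derivative (\<lambda>v. 2 * g c p (q - j) v)) (at q)"
      by (auto intro!: derivative_eq_intros)
    from has_derivative_real_sqrt[OF S0 this] show ?thesis
      by (simp add: S_def[abs_def] field_simps)
  qed
  define u where "u j q = h (inv_chart c j) + L * S j q" for j q
  define u' where "u' q j v = L * (g c p (q - j) v / S j q)" for q j v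
  have u': "(u j has_derivative u' q j) (at q)" for j q
    unfolding u_def u'_def by (auto intro!: derivative_eq_intros S')
  have u'_le: "\<bar>u' q j v\<bar> \<le> L * ?N v" for q j v
  proof -
    have "\<bar>g c p (q - j) v\<bar> \<le> ?N (q - j) * ?N v" by (rule metric_le[OF cp(1,2)])
    also have "\<dots> \<le> S j q * ?N v" using S(1) gn_nonneg[OF cp(1,2)] by (intro mult_right_mono) auto
    finally have "\<bar>g c p (q - j) v / S j q\<bar> \<le> ?N v" using S(3)[of j q] by (simp add: divide_le_eq mult.commute)
    from mult_left_mono[OF this less_imp_le[OF L]] show ?thesis
      using L by (simp only: u'_def abs_mult abs_of_pos)
  qed
  define W where "W = softmin \<beta> F u"
  define W' where "W' q v = (\<Sum>j\<in>F. exp (- \<beta> * u j q) * u' q j v) / (\<Sum>j\<in>F. exp (- \<beta> * u j q))" for q v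
  have W': "(W has_derivative W' q) (at q)" for q
    unfolding W_def W'_def using \<beta> by (intro softmin_has_derivative F(2) F0 u') auto
  have W'_le: "\<bar>W' q v\<bar> \<le> L * ?N v" for q v
    unfolding W'_def by (rule softmin_derivative_bound[OF F(2) F0]) (rule u'_le)
  have cont_S: "continuous_on X (S j)" for X j
    unfolding S_def by (intro continuous_intros bb.continuous_on)
  have Ck_W: "Ck_on 1 X W" for X
    using W'
  proof (rule Ck_on_1I)
    have cu: "continuous_on X (u j)" for j unfolding u_def by (intro continuous_intros cont_S)
    have cu': "continuous_on X (\<lambda>q. u' q j v)" for j v
      unfolding u'_def using S(3) by (intro continuous_intros bb.continuous_on cont_S ballI less_imp_neq[symmetric])
    show "continuous_on X (\<lambda>q. W' q v)" for v
      unfolding W'_def using softmin_pos[OF F(2) F0]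
      by (intro continuous_intros cu cu' ballI less_imp_neq[symmetric])
  qed
  have FK: "inv_chart c j \<in> gball c p r" "snd c (inv_chart c j) = j" if "j \<in> F" for j
    using that F(1) cp(3) inv_chart_gcball[OF good, of j] by (auto simp: gball_def gcball_def)
  have approx: "\<bar>W (snd c x) - h x\<bar> \<le> \<delta>" if x: "x \<in> gball c p (r / 2)" for x
  proof -
    have xr: "x \<in> gball c p r" using x gball_half[OF good] by blast
    have lower: "h x - ln (card F) / \<beta> \<le> W (snd c x)"
      unfolding W_def
    proof (rule softmin_ge[OF F(2) F0 \<beta>(1)])
      fix j assume "j \<in> F"
      then have "h x \<le> h (inv_chart c j) + L * ?N (snd c x - j)"
        using lip[OF xr FK(1)] FK(2) by fastforce
      also have "\<dots> \<le> u j (snd c x)" using S(1) L by (simp add: u_def)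
      finally show "h x \<le> u j (snd c x)" .
    qed
    have "snd c x \<in> ?K" using x by (auto simp: gball_def)
    then obtain j where j: "j \<in> F" "?N (snd c x - j) < \<eta>" using F(3) by blast
    have "W (snd c x) \<le> u j (snd c x)" unfolding W_def by (rule softmin_le[OF F(2) j(1) \<beta>(1)])
    also have "\<dots> \<le> h (inv_chart c j) + L * (2 * \<eta>)"
      using S(2)[of j "snd c x"] j(2) L by (simp add: u_def)
    also have "\<dots> \<le> h x + L * \<eta> + L * (2 * \<eta>)"
    proof -
      have "\<bar>h x - h (inv_chart c j)\<bar> \<le> L * ?N (snd c x - j)" using lip[OF xr FK(1)[OF j(1)]] FK(2)[OF j(1)] by simp
      also have "\<dots> \<le> L * \<eta>" using j(2) L by simp
      finally show ?thesis by simp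
    qed
    also have "\<dots> = h x + \<delta>" using \<eta>(2) by simp
    finally show ?thesis using lower \<beta>(2) by linarith
  qed
  \<comment> \<open>W lives in coordinates only; multiplied by \<phi> it extends by zero, and it is
    unchanged on the half ball.\<close>
  obtain \<phi> :: "'m \<Rightarrow> real" where \<phi>: "C1_map A \<phi>" "\<And>x. x \<in> gball c p (r / 2) \<Longrightarrow> \<phi> x = 1" "\<And>x. x \<notin> gball c p r \<Longrightarrow> \<phi> x = 0"
    using bump[OF good, of "r / 2"] cp(3) by auto
  define w where "w x = (if x \<in> fst c then local_rep c \<phi> (snd c x) * W (snd c x) else 0)" for x
  have C1: "C1_map A w"
    unfolding w_def
  proof (rule C1_map_extend[OF cp(1)])
    show "Ck_on 1 (chart_image c) (\<lambda>q. local_rep c \<phi> q * W q)"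
      using \<phi>(1) cp(1) Ck_W by (intro Ck_on_1_mult) (auto simp: C1_map_def)
    show "closed (gcball c p r)" by (rule compact_imp_closed[OF compact_gcball[OF good]])
    show "local_rep c \<phi> (snd c x) * W (snd c x) = 0" if "x \<in> fst c - gcball c p r" for x
      using that \<phi>(3)[of x] subsetD[OF gball_subset(1), of x c p r] cp(1) by (auto simp: local_rep_coord)
  qed (rule gball_subset)
  have w: "w y = W (snd c y)" if "y \<in> gball c p (r / 2)" for y
    using that \<phi>(2)[OF that] cp(1) by (simp add: w_def gball_def local_rep_coord)
  have "\<bar>der c w x v\<bar> \<le> 2 * L * gn c x v" if x: "x \<in> gball c p (r / 2)" for x v
  proof -
    have "der c w x = W' (snd c x)"
      by (rule der_eqI, rule has_der_chart[OF cp(1) open_gball[OF cp(1,2)] x _ w W'])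
        (auto simp: gball_def)
    then have "\<bar>der c w x v\<bar> \<le> L * ?N v" using W'_le by simp
    also have "?N v \<le> 2 * gn c x v"
      by (rule cp(5)) (use x gball_half[OF good] gball_subset(1) in blast)
    finally show ?thesis using L by (simp add: mult_left_mono)
  qed
  then show ?thesis by (intro exI[of _ w] conjI ballI allI C1) (simp_all add: w approx)
qed

text \<open>The error \<delta> is allowed in the gradient as well as in the value, because gluing
  spoils the gradient bound slightly. The bounds are demanded on S, while u is C1
  everywhere.\<close>

definition approximable :: "('m \<Rightarrow> real) \<Rightarrow> real \<Rightarrow> 'm set \<Rightarrow> bool" where
  "approximable h L S \<longleftrightarrow> (\<forall>\<delta>>0. \<exists>u. C1_map A u \<and> (\<forall>x\<in>S. \<bar>u x - h x\<bar> \<le> \<delta> \<and>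
     (\<forall>d\<in>A. x \<in> fst d \<longrightarrow> (\<forall>v. \<bar>der d u x v\<bar> \<le> (L + \<delta>) * gn d x v))))"

text \<open>In u + \<phi> (w - u) the derivative of \<phi> contributes at most M \<bar>w - u\<bar>.
  Since M depends on the ball only, sufficiently fine approximations absorb it, and the constant 2 L
  does not grow with the number of balls.\<close>

lemma approximable_glue:
  assumes S: "approximable h (2 * L) S" and good: "good c p r" and L: "0 < L"
    and lip: "\<And>y z. y \<in> gball c p r \<Longrightarrow> z \<in> gball c p r \<Longrightarrow> \<bar>h y - h z\<bar> \<le> L * gn c p (snd c y - snd c z)"
  shows "approximable h (2 * L) (S \<union> gball c p (r / 4))"
  unfolding approximable_def
proof (intro allI impI)
  fix \<delta> :: real assume \<delta>: "0 < \<delta>"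
  note cp = goodD[OF good]
  have goodh: "good c p (r / 2)" using good_mono[OF good] cp(3) by simp
  obtain \<phi> M where \<phi>: "C1_map A \<phi>" "\<And>x. 0 \<le> \<phi> x \<and> \<phi> x \<le> (1::real)" "\<And>x. x \<in> gball c p (r / 4) \<Longrightarrow> \<phi> x = 1"
    "\<And>x. x \<notin> gball c p (r / 2) \<Longrightarrow> \<phi> x = 0 \<and> (\<forall>d\<in>A. x \<in> fst d \<longrightarrow> (\<forall>v. der d \<phi> x v = 0))"
    and M: "0 \<le> M" "\<And>d x v. d \<in> A \<Longrightarrow> x \<in> fst d \<Longrightarrow> \<bar>der d \<phi> x v\<bar> \<le> M * gn d x v"
    using bump[OF goodh, of "r / 4"] cp(3) by auto
  \<comment> \<open>The gradient error is \<delta>' from u and w plus M times the gap 2 \<delta>'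
    between u and w.\<close>
  define \<delta>' where "\<delta>' = \<delta> / (1 + 2 * M)"
  have \<delta>': "0 < \<delta>'" "\<delta>' + 2 * M * \<delta>' = \<delta>" "\<delta>' \<le> \<delta>"
  proof -
    show "0 < \<delta>'" using \<delta> M(1) by (simp add: \<delta>'_def)
    show "\<delta>' + 2 * M * \<delta>' = \<delta>" proof -
      have "\<delta>' + 2 * M * \<delta>' = \<delta>' * (1 + 2 * M)" by (simp add: algebra_simps)
      then show ?thesis using M(1) by (simp add: \<delta>'_def)
    qed
    then show "\<delta>' \<le> \<delta>" using M(1) \<open>0 < \<delta>'\<close> by (smt (verit) mult_nonneg_nonneg)
  qed
  obtain u where u: "C1_map A u" "\<And>x. x \<in> S \<Longrightarrow> \<bar>u x - h x\<bar> \<le> \<delta>'"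
    "\<And>x d v. x \<in> S \<Longrightarrow> d \<in> A \<Longrightarrow> x \<in> fst d \<Longrightarrow> \<bar>der d u x v\<bar> \<le> (2 * L + \<delta>') * gn d x v"
    using S \<delta>'(1) unfolding approximable_def by metis
  obtain w where w: "C1_map A w" "\<And>x. x \<in> gball c p (r / 2) \<Longrightarrow> \<bar>w x - h x\<bar> \<le> \<delta>'"
    and w'': "\<And>x v. x \<in> gball c p (r / 2) \<Longrightarrow> \<bar>der c w x v\<bar> \<le> 2 * L * gn c x v"
    using smooth_on_ball[OF good L \<delta>'(1) lip] by metis
  have w': "\<bar>der d w x v\<bar> \<le> 2 * L * gn d x v" if "x \<in> gball c p (r / 2)" "d \<in> A" "x \<in> fst d" for x d v
    using der_bound_transfer[OF w(1) that(2) cp(1) that(3), of "2 * L"] w''[OF that(1)] that(1)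
    by (auto simp: gball_def)
  note mult = C1_map_bilinear[OF bounded_bilinear_mult]
  note neg = C1_map_linear[OF bounded_linear_minus[OF bounded_linear_ident], OF u(1)]
  note diff = C1_map_add[OF w(1) neg(1)]
  note prod = mult[OF \<phi>(1) diff(1)]
  note whole = C1_map_add[OF u(1) prod(1)]
  define u' where "u' x = u x + \<phi> x * (w x + - u x)" for x
  have C1: "C1_map A u'" unfolding u'_def by (rule whole)
  have der: "der d u' x v = (1 - \<phi> x) * der d u x v + \<phi> x * der d w x v + der d \<phi> x v * (w x - u x)"
    if "d \<in> A" "x \<in> fst d" for d x v
    unfolding u'_def whole(2)[OF that] prod(2)[OF that] diff(2)[OF that] neg(2)[OF that]
    by (simp add: algebra_simps)
  have "\<bar>u' x - h x\<bar> \<le> \<delta> \<and> (\<forall>d\<in>A. x \<in> fst d \<longrightarrow> (\<forall>v. \<bar>der d u' x v\<bar> \<le> (2 * L + \<delta>) * gn d x v))"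
    if x: "x \<in> S \<union> gball c p (r / 4)" for x
  proof -
    \<comment> \<open>In the inner ball x may lie outside of S, so u is avoided: u' equals w on an
      open set. Outside of the half ball w is avoided, since \<phi> and its derivative vanish. In
      the remaining case both approximations are valid.\<close>
    consider (ball) "x \<in> gball c p (r / 4)" | (out) "x \<in> S" "x \<notin> gball c p (r / 2)"
      | (mid) "x \<in> S" "x \<in> gball c p (r / 2)" using x by blast
    then show ?thesis
    proof cases
      case ball
      then have x2: "x \<in> gball c p (r / 2)" using subsetD[OF gball_mono[of "r / 4" "r / 2"]] cp(3) by simp
      have eq: "u' y = w y" if "y \<in> gball c p (r / 4)" for y using \<phi>(3)[OF that] by (simp add: u'_def)
      have "\<bar>der d u' x v\<bar> \<le> (2 * L + \<delta>) * gn d x v" if d: "d \<in> A" "x \<in> fst d" for d v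
      proof -
        have "der d u' x v = der d w x v"
          by (rule der_eq_local[OF w(1) d open_gball[OF cp(1,2)] ball]) (simp add: eq)
        then show ?thesis
          using w'[OF x2 d, of v] mult_nonneg_nonneg[OF less_imp_le[OF \<delta>] gn_nonneg[OF d]]
          by (simp add: distrib_right add.commute add_increasing)
      qed
      then show ?thesis using eq[OF ball] w(2)[OF x2] \<delta>'(3) by simp
    next
      case out
      have "\<bar>der d u' x v\<bar> \<le> (2 * L + \<delta>) * gn d x v" if d: "d \<in> A" "x \<in> fst d" for d v
      proof -
        have "\<bar>der d u' x v\<bar> \<le> (2 * L + \<delta>') * gn d x v" using \<phi>(4)[OF out(2)] d u(3)[OF out(1) d] by (simp add: der)
        also have "\<dots> \<le> (2 * L + \<delta>) * gn d x v" using \<delta>'(3) gn_nonneg[OF d] by (intro mult_right_mono) auto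
        finally show ?thesis .
      qed
      then show ?thesis using \<phi>(4)[OF out(2)] u(2)[OF out(1)] \<delta>'(3) by (simp add: u'_def)
    next
      case mid
      have \<phi>01: "0 \<le> \<phi> x" "\<phi> x \<le> 1" using \<phi>(2) by auto
      have "\<bar>der d u' x v\<bar> \<le> (2 * L + \<delta>) * gn d x v" if d: "d \<in> A" "x \<in> fst d" for d v
      proof -
        let ?n = "gn d x v"
        have n: "0 \<le> ?n" by (rule gn_nonneg[OF d])
        have "\<bar>der d u' x v\<bar> \<le> (1 - \<phi> x) * \<bar>der d u x v\<bar> + \<phi> x * \<bar>der d w x v\<bar> + \<bar>der d \<phi> x v\<bar> * \<bar>w x - u x\<bar>"
          unfolding der[OF d] using \<phi>01
          by (intro order_trans[OF abs_triangle_ineq] add_mono order_trans[OF abs_triangle_ineq]) (auto simp: abs_mult)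
        also have "\<dots> \<le> (1 - \<phi> x) * ((2 * L + \<delta>') * ?n) + \<phi> x * ((2 * L + \<delta>') * ?n) + (M * ?n) * (2 * \<delta>')"
        proof (intro add_mono mult_left_mono mult_mono)
          show "\<bar>der d w x v\<bar> \<le> (2 * L + \<delta>') * ?n"
            using w'[OF mid(2) d, of v] mult_nonneg_nonneg[OF less_imp_le[OF \<delta>'(1)] n] by (simp add: distrib_right)
          show "\<bar>w x - u x\<bar> \<le> 2 * \<delta>'" using w(2)[OF mid(2)] u(2)[OF mid(1)] by linarith
        qed (use u(3)[OF mid(1) d] M d n \<phi>01 in auto)
        also have "\<dots> = (2 * L + (\<delta>' + 2 * M * \<delta>')) * ?n" by (simp add: algebra_simps)
        finally show ?thesis using \<delta>'(2) by simp
      qed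
      moreover have "\<bar>u' x - h x\<bar> \<le> \<delta>"
      proof -
        have "u' x - h x = (1 - \<phi> x) * (u x - h x) + \<phi> x * (w x - h x)" by (simp add: u'_def algebra_simps)
        also have "\<bar>\<dots>\<bar> \<le> (1 - \<phi> x) * \<bar>u x - h x\<bar> + \<phi> x * \<bar>w x - h x\<bar>"
          using \<phi>01 by (intro order_trans[OF abs_triangle_ineq]) (auto simp: abs_mult)
        also have "\<dots> \<le> (1 - \<phi> x) * \<delta>' + \<phi> x * \<delta>'"
          using u(2)[OF mid(1)] w(2)[OF mid(2)] \<phi>01 by (intro add_mono mult_left_mono) auto
        finally show ?thesis using \<delta>'(3) by (simp add: algebra_simps)
      qed
      ultimately show ?thesis by blast
    qed
  qed
  then show "\<exists>u. C1_map A u \<and> (\<forall>x\<in>S \<union> gball c p (r / 4). \<bar>u x - h x\<bar> \<le> \<delta> \<and>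
     (\<forall>d\<in>A. x \<in> fst d \<longrightarrow> (\<forall>v. \<bar>der d u x v\<bar> \<le> (2 * L + \<delta>) * gn d x v)))"
    using C1 by blast
qed

lemma approximable_UN:
  assumes "finite F" and S: "approximable h (2 * L) S" and L: "0 < L"
    and good: "\<And>i. i \<in> F \<Longrightarrow> good (c i) (p i) (r i)"
    and lip: "\<And>c p r y z. good c p r \<Longrightarrow> y \<in> gball c p r \<Longrightarrow> z \<in> gball c p r \<Longrightarrow>
      \<bar>h y - h z\<bar> \<le> L * gn c p (snd c y - snd c z)"
  shows "approximable h (2 * L) (S \<union> (\<Union>i\<in>F. gball (c i) (p i) (r i / 4)))"
  using assms(1) good
proof (induction rule: finite_induct)
  case empty
  then show ?case using S by simp
next
  case (insert i F)
  have "S \<union> (\<Union>i\<in>insert i F. gball (c i) (p i) (r i / 4))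
      = (S \<union> (\<Union>i\<in>F. gball (c i) (p i) (r i / 4))) \<union> gball (c i) (p i) (r i / 4)" by blast
  then show ?case
    using approximable_glue[OF insert.IH insert.prems[of i] L lip[OF insert.prems[of i]]] insert.prems by simp
qed

end

section \<open>Cutoff functions with small gradient\<close>

context complete_riemannian
begin

text \<open>1 - L times the chain distance from a, stopped at 0, is L-Lipschitz, and by
  \<open>relc_reach\<close> it vanishes outside of a compact set. A small slope L means a large
  radius 1 / L, and so balls of every size have to be relatively compact.\<close>

theorem cutoff_exists:
  assumes \<epsilon>: "0 < \<epsilon>"
  shows "\<exists>f::'m \<Rightarrow> real. C1_map A f \<and> (\<forall>x. 0 \<le> f x \<and> f x \<le> 1) \<and> (\<exists>K. compact K \<and> (\<forall>x. x \<notin> K \<longrightarrow> f x = 0)) \<and>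
    (\<exists>U. open U \<and> a \<in> U \<and> (\<forall>x\<in>U. f x = 1)) \<and>
    (\<forall>d\<in>A. \<forall>x\<in>fst d. \<forall>v. \<bar>der d f x v\<bar> \<le> \<epsilon> * gn d x v)"
proof -
  \<comment> \<open>16 is 4 times 4: the slope of q is at most 4, and smoothing leaves a gradient of
    at most 2 L + \<delta> \<le> 4 L.\<close>
  define L where "L = \<epsilon> / 16"
  have L: "0 < L" using \<epsilon> by (simp add: L_def)
  define R where "R = 1 / L"
  have R: "0 < R" "L * R = 1" using L by (auto simp: R_def)
  \<comment> \<open>R caps the infimum and also gives a value at points that no chain from a
    reaches.\<close>
  define X where "X y = insert R {l. reach a l y}" for y
  define \<rho> where "\<rho> y = Inf (X y)" for y
  have X: "X y \<noteq> {}" "bdd_below (X y)" for y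
    using R(1) reach_pos[of a _ y] by (auto simp: X_def intro!: bdd_belowI[of _ 0] less_imp_le)
  have \<rho>: "0 \<le> \<rho> y" "\<rho> y \<le> R" for y
  proof -
    show "0 \<le> \<rho> y" unfolding \<rho>_def using R(1) reach_pos[of a _ y]
      by (intro cInf_greatest X) (auto simp: X_def less_imp_le)
    show "\<rho> y \<le> R" unfolding \<rho>_def by (intro cInf_lower X) (simp add: X_def)
  qed
  have \<rho>_le: "\<rho> y \<le> l" if "reach a l y" for l y
    unfolding \<rho>_def using that by (intro cInf_lower X) (simp add: X_def)
  have \<rho>a: "\<rho> a = 0"
  proof (rule antisym)
    show "\<rho> a \<le> 0" by (rule field_le_epsilon) (auto intro!: \<rho>_le start)
  qed (rule \<rho>)
  have \<rho>R: "reach a R y" if "\<rho> y < R" for y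
  proof -
    obtain l where "l \<in> X y" "l < R" using cInf_lessD[OF X(1), of y R] \<open>\<rho> y < R\<close> by (auto simp: \<rho>_def)
    then show ?thesis using reach_mono[of a l y R] by (auto simp: X_def)
  qed
  have step: "\<rho> z \<le> \<rho> y + s" if "step y z s" for y z s
  proof -
    have "\<rho> z - s \<le> l" if "l \<in> X y" for l
      using that \<rho>_le[OF extend[OF _ \<open>step y z s\<close>]] \<rho>(2)[of z] step_pos[OF \<open>step y z s\<close>] by (fastforce simp: X_def)
    then have "\<rho> z - s \<le> \<rho> y" unfolding \<rho>_def[of y] by (intro cInf_greatest X)
    then show ?thesis by simp
  qed
  have lip\<rho>: "\<rho> z - \<rho> y \<le> gn c p (snd c z - snd c y)" if "good c p r" "y \<in> gball c p r" "z \<in> gball c p r" for c p r y z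
  proof (rule field_le_epsilon)
    fix e :: real assume "0 < e"
    then have "step y z (gn c p (snd c z - snd c y) + e)" unfolding step_def using that by (intro exI[of _ c] exI[of _ p] exI[of _ r]) simp
    from step[OF this] show "\<rho> z - \<rho> y \<le> gn c p (snd c z - snd c y) + e" by simp
  qed
  define h where "h y = 1 - L * \<rho> y" for y
  have lip: "\<bar>h y - h z\<bar> \<le> L * gn c p (snd c y - snd c z)" if "good c p r" "y \<in> gball c p r" "z \<in> gball c p r" for c p r y z
  proof -
    have "\<bar>\<rho> y - \<rho> z\<bar> \<le> gn c p (snd c y - snd c z)"
      using lip\<rho>[OF that(1,2,3)] lip\<rho>[OF that(1,3,2)] gn_minus_commute[OF goodD(1,2)[OF that(1)], of "snd c y" "snd c z"]
      by linarith
    moreover have "h y - h z = - (L * (\<rho> y - \<rho> z))" by (simp add: h_def algebra_simps)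
    ultimately show ?thesis using L by (simp add: abs_mult)
  qed
  define K where "K = closure {y. reach a R y}"
  have K: "compact K" unfolding K_def by (rule relc_closure[OF relc_reach[OF R(1)]])
  have h0: "h y = 0" if "y \<notin> K" for y
  proof -
    have "\<not> \<rho> y < R" using that \<rho>R[of y] closure_subset[of "{y. reach a R y}"] by (auto simp: K_def)
    then have "\<rho> y = R" using \<rho>(2)[of y] by simp
    then show ?thesis using R by (simp add: h_def)
  qed
  \<comment> \<open>Outside of K the zero function approximates without error; this starts the
    gluing, and finitely many balls take care of K.\<close>
  have out: "approximable h (2 * L) (- K)"
    unfolding approximable_def
  proof (intro allI impI exI[of _ "\<lambda>_. 0"] conjI ballI)
    show "\<bar>der d (\<lambda>_. 0) x v\<bar> \<le> (2 * L + \<delta>) * gn d x v" if "0 < \<delta>" "d \<in> A" "x \<in> fst d" for d x v \<delta>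
      using that L gn_nonneg[OF that(2,3), of v] by (simp add: der_const)
  qed (use h0 C1_map_const in auto)
  have "\<exists>c r. good c p r" for p using chart_exists good_exists by blast
  then obtain c r where good: "\<And>p. good (c p) p (r p)" by metis
  have "p \<in> gball (c p) p (r p / 4)" for p using goodD[OF good[of p]] by (intro gball_center) auto
  then have "K \<subseteq> (\<Union>p\<in>K. gball (c p) p (r p / 4))" by blast
  from compactE_image[OF K open_gball[OF goodD(1,2)[OF good]] this]
  obtain F where F: "F \<subseteq> K" "finite F" "K \<subseteq> (\<Union>p\<in>F. gball (c p) p (r p / 4))" by blast
  have "approximable h (2 * L) (- K \<union> (\<Union>p\<in>F. gball (c p) p (r p / 4)))"
    by (rule approximable_UN[OF F(2) out L good lip])
  moreover have "- K \<union> (\<Union>p\<in>F. gball (c p) p (r p / 4)) = UNIV" using F(3) by blast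
  ultimately have app: "approximable h (2 * L) UNIV" by simp
  define \<delta> where "\<delta> = min (1 / 8) (2 * L)"
  have \<delta>: "0 < \<delta>" "\<delta> \<le> 1 / 8" "\<delta> \<le> 2 * L" using L by (auto simp: \<delta>_def)
  obtain u where u: "C1_map A u" "\<And>x. \<bar>u x - h x\<bar> \<le> \<delta>"
    "\<And>x d v. d \<in> A \<Longrightarrow> x \<in> fst d \<Longrightarrow> \<bar>der d u x v\<bar> \<le> (2 * L + \<delta>) * gn d x v"
    using app \<delta>(1) unfolding approximable_def by auto
  \<comment> \<open>0 up to 1/4 and 1 from 3/4 on: this erases the approximation error of at most
    1/8 and makes f exactly 0 off K and exactly 1 near a.\<close>
  define q where "q t = smoothstep (2 * t - 1 / 2)" for t
  define q' where "q' t = smoothstep' (2 * t - 1 / 2) * 2" for t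
  have q: "(q has_real_derivative q' t) (at t)" for t
  proof -
    have "((\<lambda>t. 2 * t - 1 / 2 :: real) has_real_derivative 2) (at t)" by (auto intro!: derivative_eq_intros)
    from DERIV_chain2[OF smoothstep_deriv this] show ?thesis by (simp add: q_def[abs_def] q'_def)
  qed
  have cont_q': "continuous_on UNIV q'"
    unfolding q'_def by (intro continuous_intros continuous_on_compose2[OF continuous_smoothstep'[of UNIV]]) auto
  note qu = C1_map_real[OF q cont_q' u(1)]
  define f where "f x = q (u x)" for x
  have "\<bar>der d f x v\<bar> \<le> \<epsilon> * gn d x v" if d: "d \<in> A" "x \<in> fst d" for d x v
  proof -
    have "\<bar>der d f x v\<bar> = \<bar>q' (u x)\<bar> * \<bar>der d u x v\<bar>" unfolding f_def using qu(2)[OF d] by (simp add: abs_mult)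
    also have "\<dots> \<le> 4 * ((2 * L + \<delta>) * gn d x v)"
      using u(3)[OF d] smoothstep'_le smoothstep'_nonneg by (intro mult_mono) (auto simp: q'_def abs_mult)
    also have "\<dots> \<le> 4 * ((2 * L + 2 * L) * gn d x v)"
      using \<delta>(3) gn_nonneg[OF d] by (intro mult_left_mono mult_right_mono) auto
    also have "\<dots> = \<epsilon> * gn d x v" by (simp add: L_def)
    finally show ?thesis .
  qed
  moreover have "f x = 0" if "x \<notin> K" for x
    using u(2)[of x] h0[OF that] \<delta>(2) unfolding f_def q_def by (intro smoothstep_0) linarith
  moreover have "open (u -` {3/4<..})"
    using open_vimage[of "{3/4<..}" u] C1_map_continuous[OF u(1)] by simp
  moreover have "a \<in> u -` {3/4<..}" using u(2)[of a] \<rho>a \<delta>(2) by (simp add: h_def)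
  moreover have "f x = 1" if "x \<in> u -` {3/4<..}" for x
    using that by (auto simp: f_def q_def intro!: smoothstep_1)
  moreover have "0 \<le> f x \<and> f x \<le> 1" for x by (simp add: f_def q_def smoothstep_nonneg smoothstep_le)
  moreover have "C1_map A f" unfolding f_def by (rule qu(1))
  ultimately show ?thesis
    using K by (intro exI[of _ f] conjI allI ballI exI[of _ K] exI[of _ "u -` {3/4<..}"]) auto
qed

end

section \<open>Gram matrices of jets and operator norms\<close>

section \<open>Jet norms and matrix norms\<close>

context riemannian
begin

lemma jet_norm_eq: "jet_norm A g x p = sqrt ((norm (fst p))\<^sup>2 + (cot_norm A g x (snd p))\<^sup>2)"
proof -
  have "Re (cot_inner A g x S S) = (cot_norm A g x S)\<^sup>2" for S :: "'e \<Rightarrow> 'h::complex_hilbert_space"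
    unfolding cot_norm_def by (simp add: cot_inner_def cinner_self sum_nonneg)
  then show ?thesis by (simp add: jet_norm_def jet_inner_def cinner_self)
qed

lemma jet_norm_nonneg: "0 \<le> jet_norm A g x p"
  by (simp add: jet_norm_eq)

lemma norm_le_jet_norm: "norm (fst p) \<le> jet_norm A g x p"
  and cot_norm_le_jet_norm: "cot_norm A g x (snd p) \<le> jet_norm A g x p"
  unfolding jet_norm_eq by (simp_all add: real_le_rsqrt)

lemma jet_norm_le: "jet_norm A g x p \<le> norm (fst p) + cot_norm A g x (snd p)"
  unfolding jet_norm_eq using sqrt_sum_squares_le_sum cot_norm_nonneg norm_ge_zero by blast

lemma cot_norm_triangle: "cot_norm A g x (\<lambda>v. S v + T v) \<le> cot_norm A g x S + cot_norm A g x T"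
  unfolding cot_norm_L2
  by (rule order_trans[OF L2_set_mono L2_set_triangle_ineq]) (auto intro: norm_triangle_ineq)

lemma cot_norm_comp:
  assumes "\<And>v. norm (T v) \<le> C * norm (S v)" "0 \<le> C"
  shows "cot_norm A g x T \<le> C * cot_norm A g x S"
  unfolding cot_norm_L2 L2_set_right_distrib[OF assms(2)]
  using assms by (intro L2_set_mono) auto

lemma cot_norm_0: "cot_norm A g x (\<lambda>v. 0) = 0"
  by (simp add: cot_norm_L2 L2_set_def)

lemma jet_norm_triangle:
  "jet_norm A g x (a + b, \<lambda>v. S v + T v) \<le> jet_norm A g x (a, S) + jet_norm A g x (b, T)"
proof -
  have "jet_norm A g x (a + b, \<lambda>v. S v + T v)
      \<le> sqrt ((norm a + norm b)\<^sup>2 + (cot_norm A g x S + cot_norm A g x T)\<^sup>2)"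
    unfolding jet_norm_eq
    by (intro real_sqrt_le_mono add_mono power_mono) (simp_all add: norm_triangle_ineq cot_norm_triangle cot_norm_nonneg)
  also have "\<dots> \<le> jet_norm A g x (a, S) + jet_norm A g x (b, T)"
    unfolding jet_norm_eq fst_conv snd_conv by (rule real_sqrt_sum_squares_triangle_ineq)
  finally show ?thesis .
qed

lemma jet_norm_scaleC:
  "jet_norm A g x (c *\<^sub>C a, \<lambda>v. c *\<^sub>C S v) = cmod c * jet_norm A g x (a, S)"
proof -
  have "cot_norm A g x (\<lambda>v. c *\<^sub>C S v) = cmod c * cot_norm A g x S"
    unfolding cot_norm_L2 by (simp add: norm_scaleC L2_set_right_distrib)
  then show ?thesis
    by (simp add: jet_norm_eq norm_scaleC power_mult_distrib real_sqrt_mult flip: distrib_left)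
qed

lemma jet_inner_self: "jet_inner A g x p p = complex_of_real ((jet_norm A g x p)\<^sup>2)"
proof -
  have "cot_inner A g x S S = complex_of_real ((cot_norm A g x S)\<^sup>2)" for S :: "'e \<Rightarrow> 'h::complex_hilbert_space"
    unfolding cot_norm_L2 L2_set_def cot_inner_def by (simp add: cinner_self sum_nonneg)
  then show ?thesis by (simp add: jet_norm_eq jet_inner_def cinner_self)
qed

lemma jet_inner_le: "cmod (jet_inner A g x p q) \<le> jet_norm A g x p * jet_norm A g x q"
proof -
  have "cmod (cot_inner A g x (snd p) (snd q)) \<le> (\<Sum>e\<in>orthonormal_frame A g x. \<bar>norm (snd p e)\<bar> * \<bar>norm (snd q e)\<bar>)"
    unfolding cot_inner_def by (intro order_trans[OF norm_sum] sum_mono) (simp add: cmod_cinner_le)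
  also have "\<dots> \<le> cot_norm A g x (snd p) * cot_norm A g x (snd q)"
    unfolding cot_norm_L2 by (rule L2_set_mult_ineq)
  finally have "cmod (jet_inner A g x p q)
      \<le> norm (fst p) * norm (fst q) + cot_norm A g x (snd p) * cot_norm A g x (snd q)"
    unfolding jet_inner_def using norm_triangle_mono cmod_cinner_le by blast
  also have "\<dots> \<le> jet_norm A g x p * jet_norm A g x q"
  proof -
    have "(a * c + b * d)\<^sup>2 \<le> (a\<^sup>2 + b\<^sup>2) * (c\<^sup>2 + d\<^sup>2)" for a b c d :: real
      using zero_le_power2[of "a * d - b * c"] by (simp add: power2_eq_square algebra_simps)
    then have "\<bar>a * c + b * d\<bar> \<le> sqrt (a\<^sup>2 + b\<^sup>2) * sqrt (c\<^sup>2 + d\<^sup>2)" for a b c d :: real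
      by (metis real_sqrt_abs real_sqrt_le_mono real_sqrt_mult)
    then show ?thesis unfolding jet_norm_eq using abs_le_D1 by blast
  qed
  finally show ?thesis .
qed

definition jcomb :: "nat \<Rightarrow> (nat \<Rightarrow> complex) \<Rightarrow> (nat \<Rightarrow> 'h::complex_hilbert_space \<times> ('e \<Rightarrow> 'h)) \<Rightarrow> 'h \<times> ('e \<Rightarrow> 'h)" where
  "jcomb n v \<xi> = (\<Sum>j<n. v j *\<^sub>C fst (\<xi> j), \<lambda>e. \<Sum>j<n. v j *\<^sub>C snd (\<xi> j) e)"

lemma jet_inner_jcomb:
  "jet_inner A g x (jcomb n w \<xi>) (jcomb n v \<zeta>)
    = (\<Sum>i<n. \<Sum>j<n. cnj (w i) * v j * jet_inner A g x (\<xi> i) (\<zeta> j))"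
proof -
  have ip: "cinner (\<Sum>i<n. w i *\<^sub>C a i) (\<Sum>j<n. v j *\<^sub>C b j)
      = (\<Sum>i<n. \<Sum>j<n. cnj (w i) * v j * cinner (a i) (b j))" for a b :: "nat \<Rightarrow> 'b::complex_hilbert_space"
    by (simp add: cinner.sum_left cinner_scaleC_left)
      (simp add: cinner.sum_right cinner_scaleC_right sum_distrib_left mult_ac)
  have "cot_inner A g x (snd (jcomb n w \<xi>)) (snd (jcomb n v \<zeta>))
      = (\<Sum>e\<in>orthonormal_frame A g x. \<Sum>i<n. \<Sum>j<n. cnj (w i) * v j * cinner (snd (\<xi> i) e) (snd (\<zeta> j) e))"
    by (simp add: cot_inner_def jcomb_def ip)
  also have "\<dots> = (\<Sum>i<n. \<Sum>j<n. cnj (w i) * v j * cot_inner A g x (snd (\<xi> i)) (snd (\<zeta> j)))"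
    by (subst sum.swap, rule sum.cong[OF refl], subst sum.swap) (simp add: cot_inner_def sum_distrib_left)
  finally show ?thesis
    by (simp add: jet_inner_def jcomb_def ip distrib_left sum.distrib)
qed

lemma jcomb_scale: "jcomb n (\<lambda>j. c * v j) \<xi> = (c *\<^sub>C fst (jcomb n v \<xi>), \<lambda>e. c *\<^sub>C snd (jcomb n v \<xi>) e)"
  by (simp add: jcomb_def scaleC.sum_right scaleC_scaleC)

text \<open>The matrix \<langle>\<xi>,\<xi>\<rangle> is the Gram operator of the map T that sends v
  to the family of all \<open>jcomb n v (\<xi> k)\<close> with k < n. Hence
  \<open>hilbert_matrix_norm\<close> is the operator norm of T, as
  \<open>hilbert_matrix_norm_le\<close> and \<open>hilbert_matrix_norm_ge\<close> make
  precise.\<close>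

lemma gram_form:
  "(\<Sum>i<n. cnj (w i) * (\<Sum>j<n. (\<Sum>k<n. jet_inner A g x (\<xi> k i) (\<xi> k j)) * v j))
    = (\<Sum>k<n. jet_inner A g x (jcomb n w (\<xi> k)) (jcomb n v (\<xi> k)))"
proof -
  have "(\<Sum>i<n. cnj (w i) * (\<Sum>j<n. (\<Sum>k<n. jet_inner A g x (\<xi> k i) (\<xi> k j)) * v j))
      = (\<Sum>i<n. \<Sum>j<n. \<Sum>k<n. cnj (w i) * v j * jet_inner A g x (\<xi> k i) (\<xi> k j))"
    by (simp add: sum_distrib_left sum_distrib_right mult_ac)
  also have "\<dots> = (\<Sum>i<n. \<Sum>k<n. \<Sum>j<n. cnj (w i) * v j * jet_inner A g x (\<xi> k i) (\<xi> k j))"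
    by (rule sum.cong[OF refl]) (rule sum.swap)
  also have "\<dots> = (\<Sum>k<n. \<Sum>i<n. \<Sum>j<n. cnj (w i) * v j * jet_inner A g x (\<xi> k i) (\<xi> k j))"
    by (rule sum.swap)
  finally show ?thesis by (simp add: jet_inner_jcomb)
qed

end

text \<open>Without boundedness the real supremum in \<open>matrix_opnorm\<close> would carry no
  information.\<close>

lemma matrix_opnorm_bdd:
  fixes n :: nat
  shows "bdd_above ((\<lambda>v. sqrt (\<Sum>i<n. (cmod (\<Sum>j<n. a i j * v j))\<^sup>2)) ` {v. (\<Sum>j<n. (cmod (v j))\<^sup>2) \<le> 1})"
proof (rule bdd_aboveI2)
  fix v assume v: "v \<in> {v. (\<Sum>j<n. (cmod (v j))\<^sup>2) \<le> 1}"
  have v1: "cmod (v j) \<le> 1" if "j < n" for j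
  proof -
    have "(cmod (v j))\<^sup>2 \<le> (\<Sum>j<n. (cmod (v j))\<^sup>2)" using that by (intro member_le_sum) auto
    then have "(cmod (v j))\<^sup>2 \<le> 1\<^sup>2" using v by simp
    then show ?thesis by (rule power2_le_imp_le) simp
  qed
  have "cmod (\<Sum>j<n. a i j * v j) \<le> (\<Sum>j<n. cmod (a i j))" for i
    using v1 by (intro order_trans[OF norm_sum] sum_mono) (auto simp: norm_mult mult_left_le)
  then show "sqrt (\<Sum>i<n. (cmod (\<Sum>j<n. a i j * v j))\<^sup>2) \<le> sqrt (\<Sum>i<n. (\<Sum>j<n. cmod (a i j))\<^sup>2)"
    by (intro real_sqrt_le_mono sum_mono power_mono) auto
qed

lemma matrix_opnorm_nonneg: "0 \<le> matrix_opnorm n a"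
  unfolding matrix_opnorm_def
  by (rule cSUP_upper2[OF matrix_opnorm_bdd, of "\<lambda>_. 0"]) auto

context riemannian
begin

lemma hilbert_matrix_norm_le:
  assumes M: "0 \<le> M" and bd: "\<And>v. (\<Sum>k<n. (jet_norm A g x (jcomb n v (\<xi> k)))\<^sup>2) \<le> M\<^sup>2 * (\<Sum>j<n. (cmod (v j))\<^sup>2)"
  shows "hilbert_matrix_norm (jet_inner A g x) n \<xi> \<le> M"
proof -
  let ?P = "\<lambda>i j. \<Sum>k<n. jet_inner A g x (\<xi> k i) (\<xi> k j)"
  have bd': "L2_set (\<lambda>k. jet_norm A g x (jcomb n v (\<xi> k))) {..<n} \<le> M * L2_set (\<lambda>j. cmod (v j)) {..<n}" for v
    unfolding L2_set_def using real_sqrt_le_mono[OF bd[of v]] M by (simp add: real_sqrt_mult)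
  have "matrix_opnorm n ?P \<le> M\<^sup>2"
    unfolding matrix_opnorm_def
  proof (rule cSUP_least)
    show "{v :: nat \<Rightarrow> complex. (\<Sum>j<n. (cmod (v j))\<^sup>2) \<le> 1} \<noteq> {}" by (auto intro!: exI[of _ "\<lambda>_. 0"])
    fix v :: "nat \<Rightarrow> complex" assume v: "v \<in> {v. (\<Sum>j<n. (cmod (v j))\<^sup>2) \<le> 1}"
    define y where "y i = (\<Sum>j<n. ?P i j * v j)" for i
    define Y where "Y = L2_set (\<lambda>i. cmod (y i)) {..<n}"
    have v1: "L2_set (\<lambda>j. cmod (v j)) {..<n} \<le> 1" using v by (simp add: L2_set_def)
    have Y2: "Y\<^sup>2 = (\<Sum>i<n. (cmod (y i))\<^sup>2)" by (simp add: Y_def L2_set_def sum_nonneg)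
    \<comment> \<open>As y is the Gram operator applied to v, \<parallel>y\<parallel>^2 = \<langle>T
      y, T v\<rangle> \<le> M \<parallel>y\<parallel> M \<parallel>v\<parallel>.\<close>
    have "complex_of_real (Y\<^sup>2) = (\<Sum>i<n. cnj (y i) * y i)"
      unfolding Y2 of_real_sum complex_norm_square by (simp add: mult.commute)
    also have "\<dots> = (\<Sum>k<n. jet_inner A g x (jcomb n y (\<xi> k)) (jcomb n v (\<xi> k)))"
      using gram_form[where n = n and w = y and x = x and \<xi> = \<xi> and v = v] by (simp add: y_def)
    finally have "Y\<^sup>2 = cmod (\<Sum>k<n. jet_inner A g x (jcomb n y (\<xi> k)) (jcomb n v (\<xi> k)))"
      by (metis norm_of_real abs_of_nonneg zero_le_power2)
    also have "\<dots> \<le> (\<Sum>k<n. \<bar>jet_norm A g x (jcomb n y (\<xi> k))\<bar> * \<bar>jet_norm A g x (jcomb n v (\<xi> k))\<bar>)"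
      by (intro order_trans[OF norm_sum] sum_mono) (simp add: jet_inner_le jet_norm_nonneg)
    also have "\<dots> \<le> (M * Y) * (M * L2_set (\<lambda>j. cmod (v j)) {..<n})"
      unfolding Y_def
      by (rule order_trans[OF L2_set_mult_ineq]) (intro mult_mono bd' mult_nonneg_nonneg M L2_set_nonneg)
    also have "\<dots> \<le> (M * Y) * (M * 1)"
      using v1 M by (intro mult_left_mono) (auto simp: Y_def)
    finally have "Y * Y \<le> M\<^sup>2 * Y" by (simp add: power2_eq_square mult_ac)
    moreover have "0 \<le> Y" by (simp add: Y_def)
    ultimately have "Y \<le> M\<^sup>2" by (cases "Y = 0") (auto simp: mult_le_cancel_right)
    then show "sqrt (\<Sum>i<n. (cmod (\<Sum>j<n. ?P i j * v j))\<^sup>2) \<le> M\<^sup>2"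
      by (simp add: Y_def y_def L2_set_def)
  qed
  then have "sqrt (matrix_opnorm n ?P) \<le> sqrt (M\<^sup>2)" by (rule real_sqrt_le_mono)
  then show ?thesis using M by (simp add: hilbert_matrix_norm_def)
qed

text \<open>For a unit vector u, \<parallel>T u\<parallel>^2 is the value at u of the quadratic form
  of the Gram matrix, hence at most its operator norm; other vectors are normalized.\<close>

lemma hilbert_matrix_norm_ge:
  "(\<Sum>k<n. (jet_norm A g x (jcomb n v (\<xi> k)))\<^sup>2)
    \<le> (hilbert_matrix_norm (jet_inner A g x) n \<xi>)\<^sup>2 * (\<Sum>j<n. (cmod (v j))\<^sup>2)"
proof -
  let ?P = "\<lambda>i j. \<Sum>k<n. jet_inner A g x (\<xi> k i) (\<xi> k j)"
  define V where "V = L2_set (\<lambda>j. cmod (v j)) {..<n}"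
  have V2: "(\<Sum>j<n. (cmod (v j))\<^sup>2) = V\<^sup>2" by (simp add: V_def L2_set_def sum_nonneg)
  define u where "u j = complex_of_real (inverse V) * v j" for j
  have hm: "(hilbert_matrix_norm (jet_inner A g x) n \<xi>)\<^sup>2 = matrix_opnorm n ?P"
    by (simp add: hilbert_matrix_norm_def matrix_opnorm_nonneg)
  show ?thesis
  proof (cases "V = 0")
    case True
    then have "v j = 0" if "j < n" for j using that by (simp add: V_def L2_set_eq_0_iff)
    then have "jcomb n v (\<xi> k) = (0, \<lambda>_. 0)" for k by (simp add: jcomb_def)
    then show ?thesis using V2 by (simp add: jet_norm_eq cot_norm_0)
  next
    case False
    have "0 \<le> V" by (simp add: V_def)
    have "(\<Sum>j<n. (cmod (u j))\<^sup>2) = (inverse V)\<^sup>2 * (\<Sum>j<n. (cmod (v j))\<^sup>2)"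
      using \<open>0 \<le> V\<close> by (simp add: u_def norm_mult norm_inverse power_mult_distrib sum_distrib_left)
    then have u1: "(\<Sum>j<n. (cmod (u j))\<^sup>2) = 1" using V2 False by (simp add: power_inverse)
    have eq: "complex_of_real (\<Sum>k<n. (jet_norm A g x (jcomb n u (\<xi> k)))\<^sup>2)
        = (\<Sum>i<n. cnj (u i) * (\<Sum>j<n. ?P i j * u j))"
      by (simp add: gram_form jet_inner_self)
    have "(\<Sum>k<n. (jet_norm A g x (jcomb n u (\<xi> k)))\<^sup>2)
        = cmod (complex_of_real (\<Sum>k<n. (jet_norm A g x (jcomb n u (\<xi> k)))\<^sup>2))"
      by (simp only: norm_of_real abs_of_nonneg sum_nonneg zero_le_power2)
    also have "\<dots> = cmod (\<Sum>i<n. cnj (u i) * (\<Sum>j<n. ?P i j * u j))" by (simp only: eq)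
    also have "\<dots> \<le> (\<Sum>i<n. \<bar>cmod (u i)\<bar> * \<bar>cmod (\<Sum>j<n. ?P i j * u j)\<bar>)"
      by (intro order_trans[OF norm_sum] sum_mono) (simp add: norm_mult)
    also have "\<dots> \<le> L2_set (\<lambda>i. cmod (u i)) {..<n} * L2_set (\<lambda>i. cmod (\<Sum>j<n. ?P i j * u j)) {..<n}"
      by (rule L2_set_mult_ineq)
    also have "\<dots> = L2_set (\<lambda>i. cmod (\<Sum>j<n. ?P i j * u j)) {..<n}"
      using u1 by (simp add: L2_set_def)
    also have "\<dots> \<le> matrix_opnorm n ?P"
      unfolding matrix_opnorm_def L2_set_def by (rule cSUP_upper[OF _ matrix_opnorm_bdd]) (simp add: u1)
    finally have le: "(\<Sum>k<n. (jet_norm A g x (jcomb n u (\<xi> k)))\<^sup>2) \<le> matrix_opnorm n ?P" .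
    have v: "v = (\<lambda>j. complex_of_real V * u j)" using False by (simp add: u_def fun_eq_iff flip: mult.assoc of_real_mult)
    have "jet_norm A g x (jcomb n v (\<xi> k)) = V * jet_norm A g x (jcomb n u (\<xi> k))" for k
      using \<open>0 \<le> V\<close> by (subst v) (simp add: jcomb_scale jet_norm_scaleC)
    then have "(\<Sum>k<n. (jet_norm A g x (jcomb n v (\<xi> k)))\<^sup>2) = V\<^sup>2 * (\<Sum>k<n. (jet_norm A g x (jcomb n u (\<xi> k)))\<^sup>2)"
      by (simp add: power_mult_distrib sum_distrib_left)
    also have "\<dots> \<le> V\<^sup>2 * matrix_opnorm n ?P" using le by (intro mult_left_mono) auto
    finally show ?thesis using V2 hm by (simp add: mult.commute)
  qed
qed

lemma hilbert_matrix_norm_1: "hilbert_matrix_norm (jet_inner A g x) 1 \<xi> = jet_norm A g x (\<xi> 0 0)"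
proof (rule antisym)
  have *: "jet_norm A g x (jcomb 1 v (\<xi> 0)) = cmod (v 0) * jet_norm A g x (\<xi> 0 0)" for v
    using jet_norm_scaleC[of x "v 0" "fst (\<xi> 0 0)" "snd (\<xi> 0 0)"] by (simp add: jcomb_def)
  show "hilbert_matrix_norm (jet_inner A g x) 1 \<xi> \<le> jet_norm A g x (\<xi> 0 0)"
    by (rule hilbert_matrix_norm_le[OF jet_norm_nonneg]) (simp add: *[simplified] power_mult_distrib mult.commute)
  have "(jet_norm A g x (\<xi> 0 0))\<^sup>2 \<le> (hilbert_matrix_norm (jet_inner A g x) 1 \<xi>)\<^sup>2"
    using hilbert_matrix_norm_ge[where n = 1 and x = x and v = "\<lambda>_. 1" and \<xi> = \<xi>] by (simp add: *[simplified])
  then show "jet_norm A g x (\<xi> 0 0) \<le> hilbert_matrix_norm (jet_inner A g x) 1 \<xi>"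
    by (rule power2_le_imp_le) (simp add: hilbert_matrix_norm_def matrix_opnorm_nonneg)
qed

lemma linear_jcomb:
  assumes "\<And>j. j < n \<Longrightarrow> linear (snd (\<xi> j))"
  shows "linear (snd (jcomb n v \<xi>))"
  unfolding linear_iff using assms
  by (simp add: jcomb_def linear_add linear_cmul scaleC.add_right scaleC.scaleR_right sum.distrib scaleR_sum_right)

end

section \<open>Strongly differentiable families and the product rule\<close>

section \<open>Operator-valued functions\<close>

text \<open>Uniformly bounded operators applied to a remainder of order o(\<bar>q - p\<bar>) leave
  it of that order.\<close>

lemma has_derivative_zero_bound:
  fixes R :: "'a::real_normed_vector \<Rightarrow> 'b::real_normed_vector" and T :: "'a \<Rightarrow> 'c::real_normed_vector"
  assumes R: "(R has_derivative (\<lambda>_. 0)) (at p)" "R p = 0" and T: "\<And>q. norm (T q) \<le> C * norm (R q)"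
  shows "(T has_derivative (\<lambda>_. 0)) (at p)"
proof -
  have T0: "T p = 0" using T[of p] R(2) by simp
  have "((\<lambda>q. norm (R q) / norm (q - p)) \<longlongrightarrow> 0) (at p)"
    using R by (simp add: has_derivative_iff_norm)
  from tendsto_mult_right_zero[OF this, of C]
  have lim: "((\<lambda>q. C * (norm (R q) / norm (q - p))) \<longlongrightarrow> 0) (at p)" .
  have "((\<lambda>q. norm (T q) / norm (q - p)) \<longlongrightarrow> 0) (at p)"
    by (rule Lim_null_comparison[OF always_eventually lim])
      (use T in \<open>auto simp: divide_right_mono simp flip: times_divide_eq_right\<close>, simp add: divide_right_mono)
  then show ?thesis using T0 by (simp add: has_derivative_iff_norm)
qed

text \<open>Strong continuity with a continuous norm bound suffices for a varying argument: E x (f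
  x) is split into E x (f x - f a) and E x (f a).\<close>

lemma continuous_on_family:
  fixes E :: "'m::topological_space \<Rightarrow> 'h::real_normed_vector \<Rightarrow> 'g::real_normed_vector"
  assumes lin: "\<And>x. x \<in> S \<Longrightarrow> linear (E x)" and bd: "\<And>x \<xi>. x \<in> S \<Longrightarrow> norm (E x \<xi>) \<le> B x * norm \<xi>"
    and B: "continuous_on S B" and E: "\<And>\<xi>. continuous_on S (\<lambda>x. E x \<xi>)" and f: "continuous_on S f"
  shows "continuous_on S (\<lambda>x. E x (f x))"
  unfolding continuous_on_def
proof
  fix a assume a: "a \<in> S"
  have ev: "\<forall>\<^sub>F x in at a within S. x \<in> S" by (simp add: eventually_at_filter)
  have "((\<lambda>x. B x * norm (f x - f a)) \<longlongrightarrow> B a * norm (f a - f a)) (at a within S)"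
    using B f a unfolding continuous_on_def by (intro tendsto_intros) auto
  then have lim: "((\<lambda>x. B x * norm (f x - f a)) \<longlongrightarrow> 0) (at a within S)" by simp
  have "((\<lambda>x. E x (f x - f a)) \<longlongrightarrow> 0) (at a within S)"
    by (rule Lim_null_comparison[OF _ lim]) (use ev in eventually_elim, rule bd)
  moreover have "((\<lambda>x. E x (f a)) \<longlongrightarrow> E a (f a)) (at a within S)"
    using E a unfolding continuous_on_def by blast
  ultimately have "((\<lambda>x. E x (f x - f a) + E x (f a)) \<longlongrightarrow> 0 + E a (f a)) (at a within S)"
    by (rule tendsto_add)
  moreover have "\<forall>\<^sub>F x in at a within S. E x (f x - f a) + E x (f a) = E x (f x)"
    using ev by eventually_elim (simp add: linear_diff[OF lin])
  ultimately show "((\<lambda>x. E x (f x)) \<longlongrightarrow> E a (f a)) (at a within S)"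
    using tendsto_cong by fastforce
qed

context riemannian
begin

lemma strong_deriv_der: "strong_deriv A \<alpha> x \<xi> = der (chart_at A x) (\<lambda>y. blinfun_apply (\<alpha> y) \<xi>) x"
  by (simp add: strong_deriv_def diff_at_eq)

context
  fixes \<alpha> :: "'m \<Rightarrow> ('h::complex_hilbert_space \<Rightarrow>\<^sub>L 'g::complex_hilbert_space)"
  assumes sd: "strongly_differentiable A \<alpha>" and cl: "\<And>x. complex_linear (\<alpha> x)"
begin

lemma C1_eval: "C1_map A (\<lambda>y. blinfun_apply (\<alpha> y) \<xi>)"
  using sd by (simp add: strongly_differentiable_def)

lemma linear_der_eval:
  assumes "c \<in> A" "x \<in> fst c"
  shows "linear (\<lambda>\<xi>. der c (\<lambda>y. blinfun_apply (\<alpha> y) \<xi>) x v)"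
  unfolding linear_iff
  using C1_map_add(2)[OF C1_eval C1_eval assms] C1_map_linear(2)[OF bounded_linear_scaleR_right C1_eval assms]
  by (simp add: blinfun.add_right blinfun.scaleR_right)

lemma strong_deriv_add: "strong_deriv A \<alpha> x (\<xi> + \<zeta>) v = strong_deriv A \<alpha> x \<xi> v + strong_deriv A \<alpha> x \<zeta> v"
  unfolding strong_deriv_der by (rule linear_add[OF linear_der_eval[OF chart_at]])

lemma strong_deriv_0: "strong_deriv A \<alpha> x 0 v = 0"
  unfolding strong_deriv_der by (rule linear_0[OF linear_der_eval[OF chart_at]])

lemma strong_deriv_scaleC: "strong_deriv A \<alpha> x (k *\<^sub>C \<xi>) v = k *\<^sub>C strong_deriv A \<alpha> x \<xi> v"
  unfolding strong_deriv_der
  using C1_map_linear(2)[OF scaleC.bounded_linear_right[of k] C1_eval chart_at] cl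
  by (simp add: complex_linear_def)

lemma strong_deriv_sum:
  "strong_deriv A \<alpha> x (\<Sum>j\<in>J. u j *\<^sub>C \<xi> j) v = (\<Sum>j\<in>J. u j *\<^sub>C strong_deriv A \<alpha> x (\<xi> j) v)"
  by (induction J rule: infinite_finite_induct) (simp_all add: strong_deriv_0 strong_deriv_add strong_deriv_scaleC)

lemma pi_op_scaleC:
  "pi_op A \<alpha> x (k *\<^sub>C \<xi>, \<lambda>v. k *\<^sub>C S v) = (k *\<^sub>C fst (pi_op A \<alpha> x (\<xi>, S)), \<lambda>v. k *\<^sub>C snd (pi_op A \<alpha> x (\<xi>, S)) v)"
  using cl[of x] by (simp add: pi_op_def complex_linear_def strong_deriv_scaleC scaleC_add_right)

lemma pi_op_jcomb: "pi_op A \<alpha> x (jcomb n u \<xi>) = jcomb n u (\<lambda>j. pi_op A \<alpha> x (\<xi> j))"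
  by (simp add: pi_op_def jcomb_def complex_linear_sum[OF cl] strong_deriv_sum scaleC.add_right sum.distrib)

text \<open>Homogeneity of \<pi>(\<alpha>)(x) turns the supremum over the unit ball into a bound for
  all jets.\<close>

lemma jet_norm_pi_op_le:
  assumes le: "pi_opnorm A g \<alpha> x \<le> ennreal C" and C: "0 \<le> C" and lin: "linear (snd p)"
  shows "jet_norm A g x (pi_op A \<alpha> x p) \<le> C * jet_norm A g x p"
proof -
  let ?N = "jet_norm A g x p" and ?J = "jet_norm A g x (pi_op A \<alpha> x p)"
  have *: "t * ?J \<le> C" if t: "0 < t" "t * ?N \<le> 1" for t
  proof -
    let ?q = "(complex_of_real t *\<^sub>C fst p, \<lambda>v. complex_of_real t *\<^sub>C snd p v)"
    have "linear (snd ?q)" using linear_compose_scale_right[OF lin, of t] by (simp add: scaleR_scaleC)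
    moreover have "jet_norm A g x ?q = t * ?N" using t by (simp add: jet_norm_scaleC)
    ultimately have "ennreal (jet_norm A g x (pi_op A \<alpha> x ?q)) \<le> pi_opnorm A g \<alpha> x"
      unfolding pi_opnorm_def using t by (intro SUP_upper) simp
    also have "jet_norm A g x (pi_op A \<alpha> x ?q) = t * ?J"
      unfolding pi_op_scaleC using t by (simp add: jet_norm_scaleC)
    finally have "ennreal (t * ?J) \<le> ennreal C" using le by (rule order_trans)
    then show ?thesis using C by simp
  qed
  show ?thesis
  proof (cases "?N = 0")
    case False
    then have "0 < ?N" using jet_norm_nonneg[of x p] by simp
    then show ?thesis using *[of "1 / ?N"] by (simp add: field_simps)
  next
    case True
    \<comment> \<open>Scaling settles this case: multiples of p still have norm 0, but one of them
      would have an image of norm C + 1.\<close>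
    have "?J \<le> 0"
    proof (rule ccontr)
      assume "\<not> ?J \<le> 0"
      then show False using *[of "(C + 1) / ?J"] True C by simp
    qed
    then show ?thesis using True by simp
  qed
qed

text \<open>The lower triangular matrix is the sum of its two columns. The first is bounded by
  assumption, and so is its entry \<alpha>(x), which as \<alpha>(x) \<otimes> 1 forms the
  second.\<close>

lemma pi_opnorm_le:
  assumes C: "0 \<le> C" and le: "\<And>\<xi>. jet_norm A g x (blinfun_apply (\<alpha> x) \<xi>, strong_deriv A \<alpha> x \<xi>) \<le> C * norm \<xi>"
  shows "pi_opnorm A g \<alpha> x \<le> ennreal (2 * C)"
  unfolding pi_opnorm_def
proof (rule SUP_least, rule ennreal_leI)
  fix p :: "'h \<times> ('e \<Rightarrow> 'h)"
  assume "p \<in> {p. linear (snd p) \<and> jet_norm A g x p \<le> 1}"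
  then have p: "jet_norm A g x p \<le> 1" by simp
  have "norm (blinfun_apply (\<alpha> x) \<xi>) \<le> C * norm \<xi>" for \<xi>
    using norm_le_jet_norm[of "(blinfun_apply (\<alpha> x) \<xi>, strong_deriv A \<alpha> x \<xi>)" x] le[of \<xi>] by simp
  then have "cot_norm A g x (\<lambda>v. blinfun_apply (\<alpha> x) (snd p v)) \<le> C * cot_norm A g x (snd p)"
    using C by (intro cot_norm_comp)
  also have "\<dots> \<le> C * 1" using C p cot_norm_le_jet_norm[of x p] by (intro mult_left_mono) auto
  finally have 1: "jet_norm A g x (0, \<lambda>v. blinfun_apply (\<alpha> x) (snd p v)) \<le> C"
    by (simp add: jet_norm_eq cot_norm_nonneg)
  have 2: "jet_norm A g x (blinfun_apply (\<alpha> x) (fst p), strong_deriv A \<alpha> x (fst p)) \<le> C * 1"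
    using C p norm_le_jet_norm[of p x] by (intro order_trans[OF le] mult_left_mono) auto
  show "jet_norm A g x (pi_op A \<alpha> x p) \<le> 2 * C"
    using jet_norm_triangle[of x "blinfun_apply (\<alpha> x) (fst p)" 0 "strong_deriv A \<alpha> x (fst p)"
        "\<lambda>v. blinfun_apply (\<alpha> x) (snd p v)"] 1 2
    by (simp add: pi_op_def)
qed

lemma jet_bound:
  assumes "pi_opnorm A g \<alpha> x \<le> ennreal C" "0 \<le> C"
  shows "jet_norm A g x (blinfun_apply (\<alpha> x) \<xi>, strong_deriv A \<alpha> x \<xi>) \<le> C * norm \<xi>"
  using jet_norm_pi_op_le[OF assms, of "(\<xi>, \<lambda>_. 0)"]
  by (simp add: pi_op_def jet_norm_eq[of x "(\<xi>, \<lambda>_. 0)"] cot_norm_0 linear_iff blinfun.zero_right)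

context
  fixes C assumes C: "0 \<le> C"
    and bd: "\<And>x \<xi>. jet_norm A g x (blinfun_apply (\<alpha> x) \<xi>, strong_deriv A \<alpha> x \<xi>) \<le> C * norm \<xi>"
begin

lemma norm_eval_le: "norm (blinfun_apply (\<alpha> x) \<xi>) \<le> C * norm \<xi>"
  using norm_le_jet_norm[of "(blinfun_apply (\<alpha> x) \<xi>, strong_deriv A \<alpha> x \<xi>)" x] bd[of x \<xi>] by simp

lemma norm_der_eval_le:
  assumes c: "c \<in> A" "x \<in> fst c"
  shows "norm (der c (\<lambda>y. blinfun_apply (\<alpha> y) \<xi>) x v) \<le> C * gn c x v * norm \<xi>"
proof -
  have "norm (der (chart_at A x) (\<lambda>y. blinfun_apply (\<alpha> y) \<xi>) x w) \<le> C * norm \<xi> * gn (chart_at A x) x w" for w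
  proof -
    have "norm (strong_deriv A \<alpha> x \<xi> w) \<le> cot_norm A g x (strong_deriv A \<alpha> x \<xi>) * gn (chart_at A x) x w"
      unfolding strong_deriv_def by (intro norm_le_cot_norm linear_diff_at C1_eval)
    also have "\<dots> \<le> C * norm \<xi> * gn (chart_at A x) x w"
      using cot_norm_le_jet_norm[of x "(blinfun_apply (\<alpha> x) \<xi>, strong_deriv A \<alpha> x \<xi>)"] bd[of x \<xi>]
        gn_nonneg[OF chart_at] by (intro mult_right_mono) auto
    finally show ?thesis by (simp add: strong_deriv_der)
  qed
  from der_bound_transfer[OF C1_eval c(1) chart_at(1) c(2) chart_at(2) this, of v]
  show ?thesis by (simp add: mult_ac)
qed

text \<open>The difference \<open>\<alpha>(q) s(q) - \<alpha>(p) s(p)\<close> is split by means of the Taylor expansion of \<open>s\<close>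
  at \<open>p\<close>, since \<open>\<alpha>\<close> need not be differentiable in norm.\<close>

lemma has_der_apply:
  assumes s: "C1_map A s" and c: "c \<in> A" "x \<in> fst c"
  shows "(local_rep c (\<lambda>x. blinfun_apply (\<alpha> x) (s x)) has_derivative
    (\<lambda>v. der c (\<lambda>y. blinfun_apply (\<alpha> y) (s x)) x v + blinfun_apply (\<alpha> x) (der c s x v))) (at (snd c x))"
proof -
  let ?p = "snd c x" and ?D = "der c s x"
  let ?a = "local_rep c \<alpha>" and ?\<sigma> = "local_rep c s"
  \<comment> \<open>The remainder of the first order Taylor expansion of s in coordinates.\<close>
  define R where "R q = ?\<sigma> q - s x - ?D (q - ?p)" for q
  have s': "(?\<sigma> has_derivative ?D) (at ?p)" by (rule C1_map_has_der[OF s c])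
  have lin: "linear ?D" by (rule has_derivative_linear[OF s'])
  have ev: "((\<lambda>q. blinfun_apply (?a q) \<xi>) has_derivative der c (\<lambda>y. blinfun_apply (\<alpha> y) \<xi>) x) (at ?p)" for \<xi>
    using C1_map_has_der[OF C1_eval c] by (simp add: local_rep_def o_def)
  have "((\<lambda>q. ?D (q - ?p)) has_derivative ?D) (at ?p)"
  proof -
    have "((\<lambda>q. q - ?p) has_derivative (\<lambda>v. v)) (at ?p)" by (auto intro!: derivative_eq_intros)
    from has_derivative_compose[OF this bounded_linear_imp_has_derivative[OF linear_bounded[OF lin]]]
    show ?thesis .
  qed
  from has_derivative_diff[OF has_derivative_diff[OF s' has_derivative_const[of "s x"]] this]
  have "(R has_derivative (\<lambda>_. 0)) (at ?p)" by (simp add: R_def[abs_def])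
  moreover have "R ?p = 0" using linear_0[OF lin] by (simp add: R_def local_rep_coord[OF c])
  ultimately have t3: "((\<lambda>q. blinfun_apply (?a q) (R q)) has_derivative (\<lambda>_. 0)) (at ?p)"
    by (rule has_derivative_zero_bound[where C = C]) (simp add: local_rep_def norm_eval_le)
  \<comment> \<open>Differentiability is known for \<alpha> applied to fixed vectors, hence the
    basis expansion of the linear term of s.\<close>
  have "((\<lambda>q. ((q - ?p) \<bullet> b) *\<^sub>R blinfun_apply (?a q) (?D b)) has_derivative
      (\<lambda>v. (v \<bullet> b) *\<^sub>R blinfun_apply (\<alpha> x) (?D b))) (at ?p)" for b
  proof -
    have "((\<lambda>q. (q - ?p) \<bullet> b) has_derivative (\<lambda>v. v \<bullet> b)) (at ?p)" by (auto intro!: derivative_eq_intros)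
    from has_derivative_scaleR[OF this ev] show ?thesis by (simp add: local_rep_coord[OF c])
  qed
  then have t2: "((\<lambda>q. \<Sum>b\<in>ob. ((q - ?p) \<bullet> b) *\<^sub>R blinfun_apply (?a q) (?D b)) has_derivative
      (\<lambda>v. \<Sum>b\<in>ob. (v \<bullet> b) *\<^sub>R blinfun_apply (\<alpha> x) (?D b))) (at ?p)"
    by (rule has_derivative_sum)
  have exp: "(\<Sum>b\<in>ob. (v \<bullet> b) *\<^sub>R blinfun_apply a (?D b)) = blinfun_apply a (?D v)" for a :: "'h \<Rightarrow>\<^sub>L 'g" and v
    by (subst (2) std.linear_expand[OF lin]) (simp add: blinfun.sum_right blinfun.scaleR_right)
  have "local_rep c (\<lambda>x. blinfun_apply (\<alpha> x) (s x)) = (\<lambda>q. blinfun_apply (?a q) (s x) +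
      (\<Sum>b\<in>ob. ((q - ?p) \<bullet> b) *\<^sub>R blinfun_apply (?a q) (?D b)) + blinfun_apply (?a q) (R q))"
    unfolding exp by (simp add: fun_eq_iff R_def blinfun.diff_right) (simp add: local_rep_def)
  with has_derivative_add[OF has_derivative_add[OF ev t2] t3] show ?thesis by (simp add: exp)
qed

lemma der_apply:
  assumes s: "C1_map A s" and c: "c \<in> A" "x \<in> fst c"
  shows "der c (\<lambda>x. blinfun_apply (\<alpha> x) (s x)) x v
    = der c (\<lambda>y. blinfun_apply (\<alpha> y) (s x)) x v + blinfun_apply (\<alpha> x) (der c s x v)"
  by (simp add: der_eqI[OF has_der_apply[OF assms]])

text \<open>Both terms of the derivative are continuous by \<open>continuous_on_family\<close>, with
  the norm bounds \<open>C * gn c x v\<close> and C.\<close>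

lemma C1_map_apply:
  assumes s: "C1_map A s"
  shows "C1_map A (\<lambda>x. blinfun_apply (\<alpha> x) (s x))"
proof (rule C1_mapI[where D = "\<lambda>c x v. der c (\<lambda>y. blinfun_apply (\<alpha> y) (s x)) x v + blinfun_apply (\<alpha> x) (der c s x v)"], rule has_der_apply[OF s])
  fix c v assume c: "c \<in> A"
  have "continuous_on (fst c) (\<lambda>x. der c (\<lambda>y. blinfun_apply (\<alpha> y) (s x)) x v)"
  proof (rule continuous_on_family[where E = "\<lambda>x \<xi>. der c (\<lambda>y. blinfun_apply (\<alpha> y) \<xi>) x v"])
    show "continuous_on (fst c) (\<lambda>x. C * gn c x v)"
      unfolding gn_def by (intro continuous_intros continuous_metric[OF c order_refl])
    show "continuous_on (fst c) s" using C1_map_continuous[OF s] by (rule continuous_on_subset) simp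
  qed (use c in \<open>auto intro: linear_der_eval norm_der_eval_le C1_map_continuous_der C1_eval\<close>)
  moreover have "continuous_on (fst c) (\<lambda>x. blinfun_apply (\<alpha> x) (der c s x v))"
  proof (rule continuous_on_family[where E = "\<lambda>x. blinfun_apply (\<alpha> x)" and B = "\<lambda>_. C"])
    show "continuous_on (fst c) (\<lambda>x. blinfun_apply (\<alpha> x) \<xi>)" for \<xi>
      using C1_map_continuous[OF C1_eval] by (rule continuous_on_subset) simp
  qed (use c in \<open>auto intro: norm_eval_le C1_map_continuous_der s bounded_linear.linear blinfun.bounded_linear_right\<close>)
  ultimately show "continuous_on (fst c) (\<lambda>x. der c (\<lambda>y. blinfun_apply (\<alpha> y) (s x)) x v + blinfun_apply (\<alpha> x) (der c s x v))"
    by (rule continuous_on_add)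
qed

lemma jet_apply:
  assumes s: "C1_map A s"
  shows "(blinfun_apply (\<alpha> x) (s x), diff_at A (\<lambda>x. blinfun_apply (\<alpha> x) (s x)) x) = pi_op A \<alpha> x (s x, diff_at A s x)"
  by (simp add: pi_op_def fun_eq_iff diff_at_eq strong_deriv_der der_apply[OF s chart_at])

end

end

section \<open>Decaying C1 maps: closure properties and the case n = 1 of the norm\<close>

section \<open>The modules of sections\<close>

lemma C10I:
  assumes s: "C1_map A s"
    and decay: "\<And>\<epsilon>. 0 < \<epsilon> \<Longrightarrow> \<exists>K. compact K \<and> (\<forall>x. x \<notin> K \<longrightarrow> norm (s x) + cot_norm A g x (diff_at A s x) \<le> \<epsilon>)"
  shows "s \<in> C10 A g"
  unfolding C10_def
proof (intro CollectI conjI allI impI s)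
  fix \<epsilon> :: real assume \<epsilon>: "0 < \<epsilon>"
  \<comment> \<open>Half of \<epsilon>, as the supremum has to be strictly below \<epsilon>.\<close>
  then obtain K where K: "compact K" "\<And>x. x \<notin> K \<Longrightarrow> norm (s x) + cot_norm A g x (diff_at A s x) \<le> \<epsilon> / 2"
    using decay[of "\<epsilon> / 2"] by auto
  have "(SUP x\<in>- K. ennreal (norm (s x) + cot_norm A g x (diff_at A s x))) \<le> ennreal (\<epsilon> / 2)"
    using K(2) by (intro SUP_least ennreal_leI) auto
  also have "\<dots> < ennreal \<epsilon>" using \<epsilon> by (simp add: ennreal_lessI)
  finally show "\<exists>K. compact K \<and> (SUP x\<in>- K. ennreal (norm (s x) + cot_norm A g x (diff_at A s x))) < ennreal \<epsilon>"
    using K(1) by blast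
qed

lemma C10_C1: "s \<in> C10 A g \<Longrightarrow> C1_map A s"
  by (simp add: C10_def)

lemma C10_decay:
  assumes s: "s \<in> C10 A g" and \<epsilon>: "0 < \<epsilon>"
  shows "\<exists>K. compact K \<and> (\<forall>x. x \<notin> K \<longrightarrow> norm (s x) + cot_norm A g x (diff_at A s x) < \<epsilon>)"
proof -
  obtain K where K: "compact K" "(SUP x\<in>- K. ennreal (norm (s x) + cot_norm A g x (diff_at A s x))) < ennreal \<epsilon>"
    using assms by (auto simp: C10_def)
  have "norm (s x) + cot_norm A g x (diff_at A s x) < \<epsilon>" if "x \<notin> K" for x
  proof -
    have "ennreal (norm (s x) + cot_norm A g x (diff_at A s x)) < ennreal \<epsilon>"
      using that by (intro le_less_trans[OF SUP_upper K(2)]) simp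
    then show ?thesis by (subst (asm) ennreal_less_iff) (auto simp: cot_norm_nonneg)
  qed
  then show ?thesis using K(1) by blast
qed

lemma C10_dominated:
  assumes s: "s \<in> C10 A g" and t: "C1_map A t" and M: "0 \<le> M"
    and le: "\<And>x. norm (t x) + cot_norm A g x (diff_at A t x) \<le> M * (norm (s x) + cot_norm A g x (diff_at A s x))"
  shows "t \<in> C10 A g"
proof (rule C10I[OF t])
  fix \<epsilon> :: real assume \<epsilon>: "0 < \<epsilon>"
  then obtain K where K: "compact K"
    "\<And>x. x \<notin> K \<Longrightarrow> norm (s x) + cot_norm A g x (diff_at A s x) < \<epsilon> / (M + 1)"
    using C10_decay[OF s, of "\<epsilon> / (M + 1)"] M by auto
  have "norm (t x) + cot_norm A g x (diff_at A t x) \<le> \<epsilon>" if "x \<notin> K" for x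
  proof -
    have "norm (t x) + cot_norm A g x (diff_at A t x) \<le> M * (\<epsilon> / (M + 1))"
      using K(2)[OF that] M by (intro order_trans[OF le] mult_left_mono) auto
    also have "\<dots> \<le> (M + 1) * (\<epsilon> / (M + 1))" using M \<epsilon> by (intro mult_right_mono) auto
    finally show ?thesis using M by simp
  qed
  then show "\<exists>K. compact K \<and> (\<forall>x. x \<notin> K \<longrightarrow> norm (t x) + cot_norm A g x (diff_at A t x) \<le> \<epsilon>)"
    using K(1) by blast
qed

lemma diff_at_add: "C1_map A s \<Longrightarrow> C1_map A t \<Longrightarrow> diff_at A (\<lambda>x. s x + t x) x = (\<lambda>v. diff_at A s x v + diff_at A t x v)"
  by (simp add: fun_eq_iff diff_at_eq C1_map_add(2)[OF _ _ chart_at])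

lemma diff_at_linear: "bounded_linear b \<Longrightarrow> C1_map A s \<Longrightarrow> diff_at A (\<lambda>x. b (s x)) x = (\<lambda>v. b (diff_at A s x v))"
  by (simp add: fun_eq_iff diff_at_eq C1_map_linear(2)[OF _ _ chart_at])

lemma C10_add:
  assumes s: "s \<in> C10 A g" and t: "t \<in> C10 A g"
  shows "(\<lambda>x. s x + t x) \<in> C10 A g"
proof (rule C10I[OF C1_map_add(1)[OF C10_C1[OF s] C10_C1[OF t]]])
  fix \<epsilon> :: real assume "0 < \<epsilon>"
  then obtain K K' where K: "compact K" "\<And>x. x \<notin> K \<Longrightarrow> norm (s x) + cot_norm A g x (diff_at A s x) < \<epsilon> / 2"
    "compact K'" "\<And>x. x \<notin> K' \<Longrightarrow> norm (t x) + cot_norm A g x (diff_at A t x) < \<epsilon> / 2"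
    using C10_decay[OF s, of "\<epsilon> / 2"] C10_decay[OF t, of "\<epsilon> / 2"] by auto
  have "norm (s x + t x) + cot_norm A g x (diff_at A (\<lambda>x. s x + t x) x) \<le> \<epsilon>" if "x \<notin> K \<union> K'" for x
    unfolding diff_at_add[OF C10_C1[OF s] C10_C1[OF t]]
    using K(2,4)[of x] that norm_triangle_ineq[of "s x" "t x"]
      cot_norm_triangle[of x "diff_at A s x" "diff_at A t x"] by auto
  then show "\<exists>K. compact K \<and> (\<forall>x. x \<notin> K \<longrightarrow> norm (s x + t x) + cot_norm A g x (diff_at A (\<lambda>x. s x + t x) x) \<le> \<epsilon>)"
    using K by (intro exI[of _ "K \<union> K'"]) (auto intro: compact_Un)
qed

lemma C10_scaleC:
  assumes s: "s \<in> C10 A g"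
  shows "(\<lambda>x. k *\<^sub>C s x) \<in> C10 A g"
proof (rule C10_dominated[OF s])
  note C1 = C10_C1[OF s]
  show "C1_map A (\<lambda>x. k *\<^sub>C s x)" by (rule C1_map_linear(1)[OF scaleC.bounded_linear_right C1])
  have "cot_norm A g x (\<lambda>v. k *\<^sub>C diff_at A s x v) \<le> cmod k * cot_norm A g x (diff_at A s x)" for x
    by (rule cot_norm_comp) (simp_all add: norm_scaleC)
  then show "norm (k *\<^sub>C s x) + cot_norm A g x (diff_at A (\<lambda>x. k *\<^sub>C s x) x)
      \<le> cmod k * (norm (s x) + cot_norm A g x (diff_at A s x))" for x
    unfolding diff_at_linear[OF scaleC.bounded_linear_right C1] by (simp add: norm_scaleC distrib_left)
qed simp

text \<open>By the Leibniz rule the sum of the norms of value and differential is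
  submultiplicative.\<close>

lemma C10_mult:
  assumes f: "f \<in> C10 A g" and s: "s \<in> C10 A g"
  shows "(\<lambda>x. f x *\<^sub>C s x) \<in> C10 A g"
proof (rule C10I)
  note C1 = C10_C1[OF f] C10_C1[OF s]
  note mult = C1_map_bilinear[OF bounded_bilinear_scaleC C1]
  show "C1_map A (\<lambda>x. f x *\<^sub>C s x)" by (rule mult)
  fix \<epsilon> :: real assume \<epsilon>: "0 < \<epsilon>"
  then obtain K K' where K: "compact K" "\<And>x. x \<notin> K \<Longrightarrow> norm (f x) + cot_norm A g x (diff_at A f x) < 1"
    "compact K'" "\<And>x. x \<notin> K' \<Longrightarrow> norm (s x) + cot_norm A g x (diff_at A s x) < \<epsilon>"
    using C10_decay[OF f, of 1] C10_decay[OF s, of \<epsilon>] by auto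
  have "norm (f x *\<^sub>C s x) + cot_norm A g x (diff_at A (\<lambda>x. f x *\<^sub>C s x) x) \<le> \<epsilon>" if "x \<notin> K \<union> K'" for x
  proof -
    let ?F = "cot_norm A g x (diff_at A f x)" and ?S = "cot_norm A g x (diff_at A s x)"
    have "diff_at A (\<lambda>x. f x *\<^sub>C s x) x = (\<lambda>v. f x *\<^sub>C diff_at A s x v + diff_at A f x v *\<^sub>C s x)"
      by (simp add: fun_eq_iff diff_at_eq mult(2)[OF chart_at])
    then have "cot_norm A g x (diff_at A (\<lambda>x. f x *\<^sub>C s x) x)
        \<le> cot_norm A g x (\<lambda>v. f x *\<^sub>C diff_at A s x v) + cot_norm A g x (\<lambda>v. diff_at A f x v *\<^sub>C s x)"
      by (simp add: cot_norm_triangle)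
    also have "cot_norm A g x (\<lambda>v. f x *\<^sub>C diff_at A s x v) \<le> cmod (f x) * ?S"
      by (rule cot_norm_comp) (simp_all add: norm_scaleC)
    also have "cot_norm A g x (\<lambda>v. diff_at A f x v *\<^sub>C s x) \<le> norm (s x) * ?F"
      by (rule cot_norm_comp) (simp_all add: norm_scaleC mult.commute)
    finally have "norm (f x *\<^sub>C s x) + cot_norm A g x (diff_at A (\<lambda>x. f x *\<^sub>C s x) x)
        \<le> cmod (f x) * norm (s x) + (cmod (f x) * ?S + norm (s x) * ?F)" by (simp add: norm_scaleC)
    also have "\<dots> \<le> (cmod (f x) + ?F) * (norm (s x) + ?S)"
      by (simp add: algebra_simps cot_norm_nonneg)
    also have "\<dots> \<le> 1 * \<epsilon>"
      using K(2,4)[of x] that by (intro mult_mono) (auto simp: cot_norm_nonneg add_nonneg_nonneg)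
    finally show ?thesis by simp
  qed
  then show "\<exists>K. compact K \<and> (\<forall>x. x \<notin> K \<longrightarrow> norm (f x *\<^sub>C s x) + cot_norm A g x (diff_at A (\<lambda>x. f x *\<^sub>C s x) x) \<le> \<epsilon>)"
    using K by (intro exI[of _ "K \<union> K'"]) (auto intro: compact_Un)
qed

text \<open>At level n = 1 the matrix norm is the jet norm, so the completely bounded norm bounds
  the norm of \<beta>.\<close>

lemma cb_norm_unit:
  assumes cb: "cb_norm A g \<beta> \<le> ennreal C" and C: "0 \<le> C" and s: "s \<in> C10 A g"
    and unit: "\<And>y. jet_norm A g y (s y, diff_at A s y) \<le> 1"
  shows "jet_norm A g x (\<beta> s x, diff_at A (\<beta> s) x) \<le> C"
proof -
  have norm: "C10_matrix_norm A g 1 (\<lambda>i j. t) = (SUP x. ennreal (jet_norm A g x (t x, diff_at A t x)))"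
    for t :: "'m \<Rightarrow> 'c::complex_hilbert_space"
    unfolding C10_matrix_norm_def hilbert_matrix_norm_1 ..
  have "C10_matrix_norm A g 1 (\<lambda>i j. s) \<le> 1"
    unfolding norm using unit by (intro SUP_least) (simp add: ennreal_le_1)
  then have "C10_matrix_norm A g 1 (\<lambda>i j. \<beta> s) \<le> cb_norm A g \<beta>"
    unfolding cb_norm_def using s
    by (intro SUP_upper2[of 1] SUP_upper2[of "\<lambda>i j. s"]) auto
  then have "(SUP x. ennreal (jet_norm A g x (\<beta> s x, diff_at A (\<beta> s) x))) \<le> ennreal C"
    unfolding norm using cb by (rule order_trans)
  then have "ennreal (jet_norm A g x (\<beta> s x, diff_at A (\<beta> s) x)) \<le> ennreal C"
    by (meson SUP_upper UNIV_I order_trans)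
  then show ?thesis using C by simp
qed

end

section \<open>Well-definedness of \<open>Phi\<close>, its upper norm bound and adjoints\<close>

section \<open>The isomorphism\<close>

context riemannian
begin

lemma jcomb_cong: "(\<And>j. j < n \<Longrightarrow> \<xi> j = \<zeta> j) \<Longrightarrow> jcomb n v \<xi> = jcomb n v \<zeta>"
  by (simp add: jcomb_def)

lemma Phi_apply: "s \<in> C10 A g \<Longrightarrow> Phi A g \<alpha> s = (\<lambda>x. blinfun_apply (\<alpha> x) (s x))"
  by (simp add: Phi_def)

lemma C1bD:
  assumes "\<alpha> \<in> C1b A g"
  shows "strongly_differentiable A \<alpha>" "strongly_differentiable A (ptw_adj \<alpha>)" "complex_linear (\<alpha> x)"
    and "\<exists>C\<ge>0. C1b_norm A g \<alpha> = ennreal C \<and> (\<forall>x. pi_opnorm A g \<alpha> x \<le> ennreal C)"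
proof -
  show "strongly_differentiable A \<alpha>" "strongly_differentiable A (ptw_adj \<alpha>)" "complex_linear (\<alpha> x)"
    using assms by (auto simp: C1b_def star_strongly_differentiable_def)
  have "C1b_norm A g \<alpha> = ennreal (enn2real (C1b_norm A g \<alpha>))" using assms by (simp add: C1b_def)
  moreover have "pi_opnorm A g \<alpha> x \<le> C1b_norm A g \<alpha>" for x unfolding C1b_norm_def by (rule SUP_upper) simp
  ultimately show "\<exists>C\<ge>0. C1b_norm A g \<alpha> = ennreal C \<and> (\<forall>x. pi_opnorm A g \<alpha> x \<le> ennreal C)"
    by (metis enn2real_nonneg)
qed

lemma Phi_in_C10:
  fixes \<alpha> :: "'m \<Rightarrow> ('h::complex_hilbert_space \<Rightarrow>\<^sub>L 'g::complex_hilbert_space)"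
  assumes \<alpha>: "\<alpha> \<in> C1b A g" and s: "s \<in> C10 A g"
  shows "Phi A g \<alpha> s \<in> C10 A g"
proof -
  note sd = C1bD(1)[OF \<alpha>] and cl = C1bD(3)[OF \<alpha>]
  obtain C where C: "0 \<le> C" and le: "\<And>x. pi_opnorm A g \<alpha> x \<le> ennreal C" using C1bD(4)[OF \<alpha>] by blast
  note jb = jet_bound[OF sd cl le C]
  show ?thesis
    unfolding Phi_apply[OF s]
  proof (rule C10_dominated[OF s C1_map_apply[OF sd cl C jb C10_C1[OF s]]])
    fix x
    let ?t = "\<lambda>x. blinfun_apply (\<alpha> x) (s x)"
    have "norm (?t x) + cot_norm A g x (diff_at A ?t x) \<le> 2 * jet_norm A g x (?t x, diff_at A ?t x)"
      using norm_le_jet_norm[of "(?t x, diff_at A ?t x)" x] cot_norm_le_jet_norm[of x "(?t x, diff_at A ?t x)"] by simp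
    also have "\<dots> = 2 * jet_norm A g x (pi_op A \<alpha> x (s x, diff_at A s x))"
      by (simp add: jet_apply[OF sd cl C jb C10_C1[OF s]])
    also have "\<dots> \<le> 2 * (C * jet_norm A g x (s x, diff_at A s x))"
      using jet_norm_pi_op_le[OF sd cl le C, where p = "(s x, diff_at A s x)"] linear_diff_at[OF C10_C1[OF s]] by simp
    also have "\<dots> \<le> 2 * (C * (norm (s x) + cot_norm A g x (diff_at A s x)))"
      using jet_norm_le[of x "(s x, diff_at A s x)"] C by (intro mult_left_mono) auto
    finally show "norm (?t x) + cot_norm A g x (diff_at A ?t x) \<le> (2 * C) * (norm (s x) + cot_norm A g x (diff_at A s x))"
      by simp
  qed (use C in simp)
qed

text \<open>\<pi>(\<alpha>)(x) commutes with linear combinations of jets, so applying it to all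
  entries of a matrix obeys the same bound at every size n.\<close>

lemma cb_norm_Phi_le:
  fixes \<alpha> :: "'m \<Rightarrow> ('h::complex_hilbert_space \<Rightarrow>\<^sub>L 'g::complex_hilbert_space)"
  assumes \<alpha>: "\<alpha> \<in> C1b A g"
  shows "cb_norm A g (Phi A g \<alpha>) \<le> C1b_norm A g \<alpha>"
proof -
  note sd = C1bD(1)[OF \<alpha>] and cl = C1bD(3)[OF \<alpha>]
  obtain C where C: "0 \<le> C" and norm: "C1b_norm A g \<alpha> = ennreal C" and le: "\<And>x. pi_opnorm A g \<alpha> x \<le> ennreal C"
    using C1bD(4)[OF \<alpha>] by blast
  note jb = jet_bound[OF sd cl le C]
  have "C10_matrix_norm A g n (\<lambda>i j. Phi A g \<alpha> (s i j)) \<le> ennreal C"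
    if s: "\<And>i j. i < n \<Longrightarrow> j < n \<Longrightarrow> s i j \<in> C10 A g" and s1: "C10_matrix_norm A g n s \<le> 1" for n s
    unfolding C10_matrix_norm_def
  proof (intro SUP_least ennreal_leI hilbert_matrix_norm_le C)
    fix x v
    let ?\<xi> = "\<lambda>i j. (s i j x, diff_at A (s i j) x)"
    let ?h = "hilbert_matrix_norm (jet_inner A g x) n ?\<xi>"
    have h0: "0 \<le> ?h" by (simp add: hilbert_matrix_norm_def matrix_opnorm_nonneg)
    have "ennreal ?h \<le> C10_matrix_norm A g n s" unfolding C10_matrix_norm_def by (rule SUP_upper) simp
    then have "ennreal ?h \<le> ennreal 1" using s1 order_trans by fastforce
    then have h: "?h \<le> 1" by simp
    have jet: "jet_norm A g x (jcomb n v (\<lambda>j. (Phi A g \<alpha> (s k j) x, diff_at A (Phi A g \<alpha> (s k j)) x)))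
        \<le> C * jet_norm A g x (jcomb n v (?\<xi> k))" if "k < n" for k
    proof -
      have "jcomb n v (\<lambda>j. (Phi A g \<alpha> (s k j) x, diff_at A (Phi A g \<alpha> (s k j)) x))
          = jcomb n v (\<lambda>j. pi_op A \<alpha> x (?\<xi> k j))"
        using that s by (intro jcomb_cong) (simp add: Phi_apply jet_apply[OF sd cl C jb] C10_C1)
      also have "\<dots> = pi_op A \<alpha> x (jcomb n v (?\<xi> k))" by (rule pi_op_jcomb[OF sd cl, symmetric])
      finally show ?thesis
        using that s by (auto intro!: jet_norm_pi_op_le[OF sd cl le C] linear_jcomb linear_diff_at C10_C1)
    qed
    have "(\<Sum>k<n. (jet_norm A g x (jcomb n v (\<lambda>j. (Phi A g \<alpha> (s k j) x, diff_at A (Phi A g \<alpha> (s k j)) x))))\<^sup>2)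
        \<le> (\<Sum>k<n. (C * jet_norm A g x (jcomb n v (?\<xi> k)))\<^sup>2)"
      using jet by (intro sum_mono power_mono jet_norm_nonneg) auto
    also have "\<dots> = C\<^sup>2 * (\<Sum>k<n. (jet_norm A g x (jcomb n v (?\<xi> k)))\<^sup>2)"
      by (simp add: power_mult_distrib sum_distrib_left)
    also have "\<dots> \<le> C\<^sup>2 * (?h\<^sup>2 * (\<Sum>j<n. (cmod (v j))\<^sup>2))"
      by (intro mult_left_mono hilbert_matrix_norm_ge) simp
    also have "\<dots> \<le> C\<^sup>2 * (1 * (\<Sum>j<n. (cmod (v j))\<^sup>2))"
      using h h0 by (intro mult_left_mono mult_right_mono) (auto simp: power_le_one sum_nonneg)
    finally show "(\<Sum>k<n. (jet_norm A g x (jcomb n v (\<lambda>j. (Phi A g \<alpha> (s k j) x, diff_at A (Phi A g \<alpha> (s k j)) x))))\<^sup>2)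
        \<le> C\<^sup>2 * (\<Sum>j<n. (cmod (v j))\<^sup>2)" by simp
  qed
  then show ?thesis
    unfolding cb_norm_def norm by (intro SUP_least) auto
qed

lemma Phi_cb_module:
  fixes \<alpha> :: "'m \<Rightarrow> ('h::complex_hilbert_space \<Rightarrow>\<^sub>L 'g::complex_hilbert_space)"
  assumes \<alpha>: "\<alpha> \<in> C1b A g"
  shows "Phi A g \<alpha> \<in> cb_module_maps A g"
  unfolding cb_module_maps_def
proof (intro CollectI conjI ballI allI)
  show "Phi A g \<alpha> \<in> C10 A g \<rightarrow>\<^sub>E C10 A g"
    using Phi_in_C10[OF \<alpha>] by (intro PiE_I) (auto simp: Phi_def)
  show "Phi A g \<alpha> (\<lambda>x. s x + t x) = (\<lambda>x. Phi A g \<alpha> s x + Phi A g \<alpha> t x)" if "s \<in> C10 A g" "t \<in> C10 A g" for s t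
    using that by (simp add: Phi_apply C10_add blinfun.add_right)
  show "Phi A g \<alpha> (\<lambda>x. k *\<^sub>C s x) = (\<lambda>x. k *\<^sub>C Phi A g \<alpha> s x)" if "s \<in> C10 A g" for s k
    using that C1bD(3)[OF \<alpha>] by (simp add: Phi_apply C10_scaleC complex_linear_def)
  show "Phi A g \<alpha> (\<lambda>x. f x *\<^sub>C s x) = (\<lambda>x. f x *\<^sub>C Phi A g \<alpha> s x)" if "s \<in> C10 A g" "f \<in> C10 A g" for s f
    using that C1bD(3)[OF \<alpha>] by (simp add: Phi_apply C10_mult complex_linear_def)
  show "cb_norm A g (Phi A g \<alpha>) < \<infinity>"
    using cb_norm_Phi_le[OF \<alpha>] \<alpha> by (auto simp: C1b_def intro: le_less_trans)
qed

text \<open>The adjoint of \<pi>(\<alpha>)(x) is upper triangular and in general not \<pi> of the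
  adjoint family. The entries are therefore estimated one by one: the derivative of the adjoint
  along v is the adjoint of the derivative along v. The dimensional factor that appears only affects
  the size of the bound.\<close>

lemma ptw_adj_C1b:
  fixes \<alpha> :: "'m \<Rightarrow> ('h::complex_hilbert_space \<Rightarrow>\<^sub>L 'g::complex_hilbert_space)"
  assumes \<alpha>: "\<alpha> \<in> C1b A g"
  shows "ptw_adj \<alpha> \<in> C1b A g"
proof -
  note sd = C1bD(1)[OF \<alpha>] and sd' = C1bD(2)[OF \<alpha>] and cl = C1bD(3)[OF \<alpha>]
  obtain C where C: "0 \<le> C" and le: "\<And>x. pi_opnorm A g \<alpha> x \<le> ennreal C" using C1bD(4)[OF \<alpha>] by blast
  note jb = jet_bound[OF sd cl le C]
  let ?b = "ptw_adj \<alpha>"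
  have adj: "cinner (blinfun_apply (\<alpha> x) \<xi>) \<zeta> = cinner \<xi> (blinfun_apply (?b x) \<zeta>)" for x \<xi> \<zeta>
    unfolding ptw_adj_def by (rule cinner_hilbert_adj[OF cl])
  have cl': "complex_linear (?b x)" for x using complex_linear_adj[OF adj] .
  have adj_adj: "ptw_adj ?b = \<alpha>" by (rule ext) (simp add: ptw_adj_def hilbert_adj_adj[OF cl])
  \<comment> \<open>Cancels one factor \<parallel>y\<parallel> in the two estimates of
    \<parallel>y\<parallel>^2 below.\<close>
  have sq: "n \<le> M * m" if "n * n \<le> M * n * m" "0 \<le> n" "0 \<le> M" "0 \<le> m" for n M m :: real
    using that by (cases "n = 0") (auto simp: mult.assoc mult.left_commute[of M n m])
  have nb: "norm (blinfun_apply (?b x) \<zeta>) \<le> C * norm \<zeta>" for x \<zeta>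
  proof (rule sq)
    let ?y = "blinfun_apply (?b x) \<zeta>"
    have "norm ?y * norm ?y = cmod (cinner ?y ?y)" by (simp add: cinner_self norm_mult power2_eq_square)
    also have "\<dots> = cmod (cinner (blinfun_apply (\<alpha> x) ?y) \<zeta>)" by (simp add: adj)
    also have "\<dots> \<le> C * norm ?y * norm \<zeta>"
      by (rule order_trans[OF cmod_cinner_le]) (intro mult_right_mono norm_eval_le[OF sd cl C jb] norm_ge_zero)
    finally show "norm ?y * norm ?y \<le> C * norm ?y * norm \<zeta>" .
  qed (use C in auto)
  have db: "norm (strong_deriv A ?b x \<zeta> v) \<le> C * norm \<zeta> * gn (chart_at A x) x v" for x \<zeta> v
  proof -
    let ?c = "chart_at A x"
    \<comment> \<open>Both sides are the derivative of the same function, the pairing of \<alpha>(y)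
      \<xi> with \<zeta>.\<close>
    have der: "cinner (strong_deriv A \<alpha> x \<xi> v) \<zeta> = cinner \<xi> (strong_deriv A ?b x \<zeta> v)" for \<xi>
    proof -
      have "der ?c (\<lambda>y. cinner (blinfun_apply (\<alpha> y) \<xi>) \<zeta>) x v = cinner (strong_deriv A \<alpha> x \<xi> v) \<zeta>"
        unfolding strong_deriv_der
        by (rule C1_map_linear(2)[OF cinner.bounded_linear_left C1_eval[OF sd cl] chart_at])
      moreover have "der ?c (\<lambda>y. cinner \<xi> (blinfun_apply (?b y) \<zeta>)) x v = cinner \<xi> (strong_deriv A ?b x \<zeta> v)"
        unfolding strong_deriv_der
        by (rule C1_map_linear(2)[OF cinner.bounded_linear_right C1_eval[OF sd' cl'] chart_at])
      ultimately show ?thesis by (simp add: adj)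
    qed
    let ?y = "strong_deriv A ?b x \<zeta> v"
    have "norm ?y * norm ?y = cmod (cinner ?y ?y)" by (simp add: cinner_self norm_mult power2_eq_square)
    also have "\<dots> = cmod (cinner (strong_deriv A \<alpha> x ?y v) \<zeta>)" by (simp add: der)
    also have "\<dots> \<le> C * gn ?c x v * norm ?y * norm \<zeta>"
      unfolding strong_deriv_der[of \<alpha>]
      by (rule order_trans[OF cmod_cinner_le])
        (intro mult_right_mono norm_der_eval_le[OF sd cl C jb chart_at] norm_ge_zero)
    finally have "norm ?y \<le> C * gn ?c x v * norm \<zeta>"
      by (rule sq) (use C gn_nonneg[OF chart_at] in auto)
    then show ?thesis by (simp add: mult_ac)
  qed
  define C' where "C' = C + card ob * C"
  have C': "0 \<le> C'" using C by (simp add: C'_def)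
  have "jet_norm A g x (blinfun_apply (?b x) \<zeta>, strong_deriv A ?b x \<zeta>) \<le> C' * norm \<zeta>" for x \<zeta>
  proof -
    have "cot_norm A g x (strong_deriv A ?b x \<zeta>) \<le> card ob * (C * norm \<zeta>)"
      by (rule cot_norm_le_card) (use db C in auto)
    then have "jet_norm A g x (blinfun_apply (?b x) \<zeta>, strong_deriv A ?b x \<zeta>) \<le> C * norm \<zeta> + card ob * (C * norm \<zeta>)"
      using nb[of x \<zeta>] jet_norm_le[of x "(blinfun_apply (?b x) \<zeta>, strong_deriv A ?b x \<zeta>)"] by simp
    then show ?thesis by (simp add: C'_def algebra_simps)
  qed
  then have "pi_opnorm A g ?b x \<le> ennreal (2 * C')" for x
    by (rule pi_opnorm_le[OF sd' cl' C'])
  then have "C1b_norm A g ?b \<le> ennreal (2 * C')" unfolding C1b_norm_def by (intro SUP_least)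
  also have "\<dots> < \<infinity>" by simp
  finally show ?thesis
    using sd sd' cl' by (simp add: C1b_def star_strongly_differentiable_def adj_adj)
qed

lemma Phi_is_adjoint:
  assumes \<alpha>: "\<alpha> \<in> C1b A g"
  shows "is_adjoint A g (Phi A g \<alpha>) (Phi A g (ptw_adj \<alpha>))"
  unfolding is_adjoint_def
  using Phi_cb_module[OF ptw_adj_C1b[OF \<alpha>]] cinner_hilbert_adj[OF C1bD(3)[OF \<alpha>]]
  by (auto simp: hermitian_form_def Phi_apply ptw_adj_def)

end

section \<open>Lower norm bound, uniqueness of adjoints and bijectivity\<close>

context complete_riemannian
begin

text \<open>One f serves all \<xi>, so the section depends linearly on \<xi>. As 0 \<le> f \<le> 1
  and the gradient is at most \<epsilon>, its jets exceed \<parallel>\<xi>\<parallel> by a factor of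
  at most 1 + \<epsilon>.\<close>

lemma section_exists:
  assumes \<epsilon>: "0 < \<epsilon>"
  shows "\<exists>f::'m \<Rightarrow> real. (\<exists>U. open U \<and> a \<in> U \<and> (\<forall>x\<in>U. f x = 1)) \<and>
    (\<forall>\<xi>::'h::complex_hilbert_space. (\<lambda>x. f x *\<^sub>R \<xi>) \<in> C10 A g \<and>
      (\<forall>x. jet_norm A g x (f x *\<^sub>R \<xi>, diff_at A (\<lambda>x. f x *\<^sub>R \<xi>) x) \<le> (1 + \<epsilon>) * norm \<xi>))"
proof -
  obtain f :: "'m \<Rightarrow> real" and K U where f: "C1_map A f" "\<And>x. 0 \<le> f x \<and> f x \<le> 1"
    and K: "compact K" "\<And>x. x \<notin> K \<Longrightarrow> f x = 0" and U: "open U" "a \<in> U" "\<And>x. x \<in> U \<Longrightarrow> f x = 1"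
    and df: "\<And>d x v. d \<in> A \<Longrightarrow> x \<in> fst d \<Longrightarrow> \<bar>der d f x v\<bar> \<le> \<epsilon> * gn d x v"
    using cutoff_exists[OF \<epsilon>, of a] by auto
  have diff: "diff_at A (\<lambda>x. f x *\<^sub>R \<xi>) x = (\<lambda>v. der (chart_at A x) f x v *\<^sub>R \<xi>)" for \<xi> :: 'h and x
    using diff_at_linear[OF bounded_linear_scaleR_left f(1)] by (simp add: diff_at_eq)
  have "(\<lambda>x. f x *\<^sub>R \<xi>) \<in> C10 A g" for \<xi> :: 'h
  proof (rule C10I[OF C1_map_linear(1)[OF bounded_linear_scaleR_left f(1)]])
    fix e :: real assume "0 < e"
    have "norm (f x *\<^sub>R \<xi>) + cot_norm A g x (diff_at A (\<lambda>x. f x *\<^sub>R \<xi>) x) = 0" if x: "x \<notin> K" for x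
    proof -
      have "der (chart_at A x) f x v = der (chart_at A x) (\<lambda>x. 0) x v" for v
        by (rule der_eq_local[OF C1_map_const(1) chart_at, of "- K"])
          (use x K compact_imp_closed[OF K(1)] in auto)
      then show ?thesis using K(2)[OF x] by (simp add: diff der_const cot_norm_0)
    qed
    then show "\<exists>K. compact K \<and> (\<forall>x. x \<notin> K \<longrightarrow> norm (f x *\<^sub>R \<xi>) + cot_norm A g x (diff_at A (\<lambda>x. f x *\<^sub>R \<xi>) x) \<le> e)"
      using K(1) \<open>0 < e\<close> by (intro exI[of _ K]) auto
  qed
  moreover have "jet_norm A g x (f x *\<^sub>R \<xi>, diff_at A (\<lambda>x. f x *\<^sub>R \<xi>) x) \<le> (1 + \<epsilon>) * norm \<xi>" for \<xi> :: 'h and x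
  proof -
    have "cot_norm A g x (diff_at A (\<lambda>x. f x *\<^sub>R \<xi>) x) \<le> \<epsilon> * norm \<xi>"
      unfolding diff using \<epsilon> by (intro cot_norm_rank_one linear_der f(1) df chart_at) auto
    moreover have "norm (f x *\<^sub>R \<xi>) \<le> 1 * norm \<xi>"
      unfolding norm_scaleR using f(2)[of x] by (intro mult_right_mono) auto
    ultimately show ?thesis
      using jet_norm_le[of x "(f x *\<^sub>R \<xi>, diff_at A (\<lambda>x. f x *\<^sub>R \<xi>) x)"] by (simp add: algebra_simps)
  qed
  ultimately show ?thesis using U by blast
qed

text \<open>Sections take every value at every point, which underlies injectivity and the uniqueness
  of adjoints.\<close>

lemma section_value: "\<exists>s\<in>C10 A g. s a = (\<xi> :: 'h::complex_hilbert_space)"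
proof -
  obtain f :: "'m \<Rightarrow> real" where "f a = 1" "(\<lambda>x. f x *\<^sub>R \<xi>) \<in> C10 A g"
    using section_exists[where 'h = 'h, of 1 a] by auto
  then show ?thesis by (intro bexI[of _ "\<lambda>x. f x *\<^sub>R \<xi>"]) auto
qed

text \<open>By completeness \<open>\<xi>\<close> extends to a section of almost the same norm that is constant near \<open>x\<close>.\<close>

lemma jet_lower_bound:
  fixes \<alpha> :: "'m \<Rightarrow> ('h::complex_hilbert_space \<Rightarrow>\<^sub>L 'g::complex_hilbert_space)"
  assumes sd: "strongly_differentiable A \<alpha>" and cl: "\<And>x. complex_linear (\<alpha> x)" and C: "0 \<le> C"
    and cb: "cb_norm A g \<beta> \<le> ennreal C" and \<beta>: "\<And>s x. s \<in> C10 A g \<Longrightarrow> \<beta> s x = blinfun_apply (\<alpha> x) (s x)"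
    and \<beta>C1: "\<And>s. s \<in> C10 A g \<Longrightarrow> C1_map A (\<beta> s)"
  shows "jet_norm A g x (blinfun_apply (\<alpha> x) \<xi>, strong_deriv A \<alpha> x \<xi>) \<le> C * norm \<xi>"
proof -
  let ?J = "\<lambda>\<xi>. jet_norm A g x (blinfun_apply (\<alpha> x) \<xi>, strong_deriv A \<alpha> x \<xi>)"
  have small: "?J \<zeta> \<le> C" if \<zeta>: "norm \<zeta> < 1" for \<zeta>
  proof -
    \<comment> \<open>Then (1 + \<epsilon>) \<parallel>\<zeta>\<parallel> = 1 - \<epsilon>^2, so the
      extended section lies in the unit ball.\<close>
    define \<epsilon> where "\<epsilon> = 1 - norm \<zeta>"
    have \<epsilon>: "0 < \<epsilon>" using \<zeta> by (simp add: \<epsilon>_def)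
    have "(1 + \<epsilon>) * norm \<zeta> = 1 - \<epsilon>\<^sup>2" by (simp add: \<epsilon>_def power2_eq_square algebra_simps)
    then have le1: "(1 + \<epsilon>) * norm \<zeta> \<le> 1" by simp
    obtain f :: "'m \<Rightarrow> real" and U where U: "open U" "x \<in> U" "\<And>y. y \<in> U \<Longrightarrow> f y = 1"
      and f: "(\<lambda>x. f x *\<^sub>R \<zeta>) \<in> C10 A g"
        "\<And>y. jet_norm A g y (f y *\<^sub>R \<zeta>, diff_at A (\<lambda>x. f x *\<^sub>R \<zeta>) y) \<le> (1 + \<epsilon>) * norm \<zeta>"
      using section_exists[where 'h = 'h, OF \<epsilon>, of x] by metis
    let ?s = "\<lambda>x. f x *\<^sub>R \<zeta>"
    have eq: "\<beta> ?s y = blinfun_apply (\<alpha> y) \<zeta>" if "y \<in> U" for y using \<beta>[OF f(1)] U(3)[OF that] by simp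
    have "diff_at A (\<beta> ?s) x = strong_deriv A \<alpha> x \<zeta>"
      unfolding diff_at_eq strong_deriv_der
      by (rule ext, rule der_eq_local[OF \<beta>C1[OF f(1)] chart_at U(1,2), symmetric]) (rule eq)
    moreover have "jet_norm A g x (\<beta> ?s x, diff_at A (\<beta> ?s) x) \<le> C"
      by (rule cb_norm_unit[OF cb C f(1)]) (use f(2) le1 order_trans in blast)
    ultimately show ?thesis using eq[OF U(2)] by simp
  qed
  have scale: "?J (t *\<^sub>R \<xi>) = t * ?J \<xi>" if "0 \<le> t" for t
  proof -
    have "strong_deriv A \<alpha> x (t *\<^sub>R \<xi>) = (\<lambda>v. complex_of_real t *\<^sub>C strong_deriv A \<alpha> x \<xi> v)"
      unfolding scaleR_scaleC[of t \<xi>] by (rule ext) (rule strong_deriv_scaleC[OF sd cl])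
    then show ?thesis
      using that cl[of x] jet_norm_scaleC[of x "complex_of_real t"]
      by (simp add: complex_linear_def scaleR_scaleC)
  qed
  show ?thesis
  proof (cases "\<xi> = 0")
    case True
    then show ?thesis using scale[of 0] by simp
  next
    case False
    show ?thesis
    \<comment> \<open>\<open>small\<close> covers norms strictly below 1, so the bound is shown with
      a factor z < 1 and then for z \<rightarrow> 1.\<close>
    proof (rule field_le_mult_one_interval)
      fix z :: real assume z: "0 < z" "z < 1"
      have "(z / norm \<xi>) * ?J \<xi> \<le> C"
        using small[of "(z / norm \<xi>) *\<^sub>R \<xi>"] scale[of "z / norm \<xi>"] z False by simp
      then show "z * ?J \<xi> \<le> C * norm \<xi>" using False by (simp add: field_simps)
    qed
  qed
qed

text \<open>Phrased for any \<beta> that acts as \<alpha>, since in the proof of surjectivity the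
  finiteness of this very norm is yet to be shown.\<close>

lemma C1b_norm_le:
  fixes \<alpha> :: "'m \<Rightarrow> ('h::complex_hilbert_space \<Rightarrow>\<^sub>L 'g::complex_hilbert_space)"
  assumes sd: "strongly_differentiable A \<alpha>" and cl: "\<And>x. complex_linear (\<alpha> x)"
    and cb: "cb_norm A g \<beta> < \<infinity>" and \<beta>: "\<And>s x. s \<in> C10 A g \<Longrightarrow> \<beta> s x = blinfun_apply (\<alpha> x) (s x)"
    and \<beta>C1: "\<And>s. s \<in> C10 A g \<Longrightarrow> C1_map A (\<beta> s)"
  shows "C1b_norm A g \<alpha> \<le> 2 * cb_norm A g \<beta>"
proof -
  define C where "C = enn2real (cb_norm A g \<beta>)"
  have C: "0 \<le> C" "cb_norm A g \<beta> = ennreal C" using cb by (auto simp: C_def)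
  have "pi_opnorm A g \<alpha> x \<le> ennreal (2 * C)" for x
    by (intro pi_opnorm_le[OF sd cl C(1)] jet_lower_bound[OF sd cl C(1) _ \<beta> \<beta>C1]) (use C in auto)
  then have "C1b_norm A g \<alpha> \<le> ennreal (2 * C)" unfolding C1b_norm_def by (intro SUP_least)
  also have "\<dots> = 2 * cb_norm A g \<beta>" using C by (simp add: ennreal_mult)
  finally show ?thesis .
qed

text \<open>Pairing with sections of arbitrary value at x determines \<gamma> t x; outside of the
  module extensionality decides.\<close>

lemma adjoint_unique:
  fixes \<beta> :: "('m \<Rightarrow> 'h::complex_hilbert_space) \<Rightarrow> ('m \<Rightarrow> 'g::complex_hilbert_space)"
  assumes \<gamma>: "is_adjoint A g \<beta> \<gamma>" and \<gamma>': "is_adjoint A g \<beta> \<gamma>'"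
  shows "\<gamma> = \<gamma>'"
proof (rule PiE_ext)
  show "\<gamma> \<in> C10 A g \<rightarrow>\<^sub>E C10 A g" "\<gamma>' \<in> C10 A g \<rightarrow>\<^sub>E C10 A g"
    using assms by (auto simp: is_adjoint_def cb_module_maps_def)
  fix t :: "'m \<Rightarrow> 'g" assume t: "t \<in> C10 A g"
  show "\<gamma> t = \<gamma>' t"
  proof (rule ext, rule cinner_ext)
    fix x and \<xi> :: 'h
    obtain s where s: "s \<in> C10 A g" "s x = \<xi>" using section_value by blast
    have "hermitian_form s (\<gamma> t) x = hermitian_form s (\<gamma>' t) x"
      using \<gamma> \<gamma>' s(1) t unfolding is_adjoint_def by metis
    then show "cinner \<xi> (\<gamma> t x) = cinner \<xi> (\<gamma>' t x)" using s(2) by (simp add: hermitian_form_def)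
  qed
qed

lemma mor_adj_Phi:
  assumes \<alpha>: "\<alpha> \<in> C1b A g"
  shows "mor_adj A g (Phi A g \<alpha>) = Phi A g (ptw_adj \<alpha>)"
  unfolding mor_adj_def
proof (rule the_equality)
  show "is_adjoint A g (Phi A g \<alpha>) (Phi A g (ptw_adj \<alpha>))" by (rule Phi_is_adjoint[OF \<alpha>])
  then show "\<gamma> = Phi A g (ptw_adj \<alpha>)" if "is_adjoint A g (Phi A g \<alpha>) \<gamma>" for \<gamma>
    using adjoint_unique[OF that] by blast
qed

lemma inj_Phi: "inj_on (Phi A g) (C1b A g :: ('m \<Rightarrow> ('h::complex_hilbert_space \<Rightarrow>\<^sub>L 'g::complex_hilbert_space)) set)"
proof (rule inj_onI, rule ext, rule blinfun_eqI)
  fix \<alpha> \<alpha>' :: "'m \<Rightarrow> ('h \<Rightarrow>\<^sub>L 'g)" and x and \<xi> :: 'h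
  assume eq: "Phi A g \<alpha> = Phi A g \<alpha>'"
  obtain s where s: "s \<in> C10 A g" "s x = \<xi>" using section_value by blast
  show "blinfun_apply (\<alpha> x) \<xi> = blinfun_apply (\<alpha>' x) \<xi>"
    using fun_cong[OF fun_cong[OF eq], of s x] s by (simp add: Phi_apply)
qed

text \<open>The adjoint makes \<open>\<beta> s x\<close> depend on \<open>s x\<close> only: \<open>s x = 0\<close> does not make \<open>s\<close> a combination of
  sections with coefficients in \<open>C\<^sup>1\<^sub>0\<close> that vanish at \<open>x\<close>.\<close>

lemma pointwise_operator:
  fixes \<beta> :: "('m \<Rightarrow> 'h::complex_hilbert_space) \<Rightarrow> ('m \<Rightarrow> 'g::complex_hilbert_space)"
  assumes \<beta>: "\<beta> \<in> cb_module_maps A g"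
    and adj: "\<And>s t. s \<in> C10 A g \<Longrightarrow> t \<in> C10 A g \<Longrightarrow> hermitian_form (\<beta> s) t = hermitian_form s (\<gamma> t)"
  shows "\<exists>\<alpha> :: 'm \<Rightarrow> ('h \<Rightarrow>\<^sub>L 'g). strongly_differentiable A \<alpha> \<and> (\<forall>x. complex_linear (\<alpha> x)) \<and>
    (\<forall>s\<in>C10 A g. \<forall>x. \<beta> s x = blinfun_apply (\<alpha> x) (s x))"
proof -
  have add: "\<beta> (\<lambda>x. s x + t x) x = \<beta> s x + \<beta> t x" if "s \<in> C10 A g" "t \<in> C10 A g" for s t x
    using \<beta> that by (simp add: cb_module_maps_def)
  have scale: "\<beta> (\<lambda>x. k *\<^sub>C s x) x = k *\<^sub>C \<beta> s x" if "s \<in> C10 A g" for s k x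
    using \<beta> that by (simp add: cb_module_maps_def)
  have \<beta>C1: "C1_map A (\<beta> s)" if "s \<in> C10 A g" for s
    using \<beta> that C10_C1 by (auto simp: cb_module_maps_def)
  \<comment> \<open>Move \<beta> to the other side of the form, where only the value of s at x
    remains.\<close>
  have dep: "\<beta> s x = \<beta> s' x" if s: "s \<in> C10 A g" "s' \<in> C10 A g" "s x = s' x" for s s' x
  proof (rule cinner_ext)
    fix \<zeta> :: 'g
    obtain t where t: "t \<in> C10 A g" "t x = \<zeta>" using section_value by blast
    have "hermitian_form (\<beta> s) t x = hermitian_form (\<beta> s') t x"
      using adj[OF s(1) t(1)] adj[OF s(2) t(1)] s(3) by (simp add: hermitian_form_def)
    then have "cinner (\<beta> s x) \<zeta> = cinner (\<beta> s' x) \<zeta>" using t(2) by (simp add: hermitian_form_def)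
    then show "cinner \<zeta> (\<beta> s x) = cinner \<zeta> (\<beta> s' x)"
      using cinner_commute[of \<zeta> "\<beta> s x"] cinner_commute[of \<zeta> "\<beta> s' x"] by simp
  qed
  define C where "C = enn2real (cb_norm A g \<beta>)"
  have C: "0 \<le> C" "cb_norm A g \<beta> \<le> ennreal C"
    using \<beta> by (auto simp: C_def cb_module_maps_def)
  have "\<exists>f::'m \<Rightarrow> real. f x = 1 \<and> (\<forall>\<xi>::'h. (\<lambda>x. f x *\<^sub>R \<xi>) \<in> C10 A g \<and>
      (\<forall>y. jet_norm A g y (f y *\<^sub>R \<xi>, diff_at A (\<lambda>x. f x *\<^sub>R \<xi>) y) \<le> 2 * norm \<xi>))" for x
    using section_exists[where 'h = 'h, of 1 x] by auto
  then obtain F :: "'m \<Rightarrow> 'm \<Rightarrow> real" where F1: "\<And>x. F x x = 1"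
    and F: "\<And>x \<xi>. (\<lambda>y. F x y *\<^sub>R (\<xi>::'h)) \<in> C10 A g"
    and FJ: "\<And>x \<xi> y. jet_norm A g y (F x y *\<^sub>R (\<xi>::'h), diff_at A (\<lambda>y. F x y *\<^sub>R \<xi>) y) \<le> 2 * norm \<xi>"
    by metis
  \<comment> \<open>The cutoff varies with x in an uncontrolled way; by \<open>dep\<close> this has
    no influence on the values.\<close>
  define T where "T x \<xi> = \<beta> (\<lambda>y. F x y *\<^sub>R \<xi>) x" for x and \<xi> :: 'h
  have T: "\<beta> s x = T x (s x)" if "s \<in> C10 A g" for s x
    unfolding T_def by (rule dep[OF that F]) (simp add: F1)
  have T_add: "T x (\<xi> + \<zeta>) = T x \<xi> + T x \<zeta>" for x \<xi> \<zeta>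
    using T[OF C10_add[OF F[of x \<xi>] F[of x \<zeta>]], of x] add[OF F[of x \<xi>] F[of x \<zeta>], of x] by (simp add: T_def F1)
  have T_scale: "T x (k *\<^sub>C \<xi>) = k *\<^sub>C T x \<xi>" for x \<xi> k
    using T[OF C10_scaleC[OF F[of x \<xi>]], of k x] scale[OF F[of x \<xi>], of k x] by (simp add: T_def F1)
  \<comment> \<open>The section has norm at most 2 \<parallel>\<xi>\<parallel>, as the cutoffs were
    taken with \<epsilon> = 1; hence the 1/2.\<close>
  have T_small: "norm (T x \<xi>) \<le> C" if "norm \<xi> \<le> 1 / 2" for x \<xi>
  proof -
    let ?s = "\<lambda>y. F x y *\<^sub>R \<xi>"
    have "jet_norm A g x (\<beta> ?s x, diff_at A (\<beta> ?s) x) \<le> C"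
      using that by (intro cb_norm_unit[OF C(2,1) F] order_trans[OF FJ]) simp
    then show ?thesis using norm_le_jet_norm[of "(\<beta> ?s x, diff_at A (\<beta> ?s) x)" x] by (simp add: T_def)
  qed
  have T_scaleR: "T x (r *\<^sub>R \<xi>) = r *\<^sub>R T x \<xi>" for x r \<xi>
    using T_scale[of x "complex_of_real r" \<xi>] by (simp add: scaleR_scaleC)
  have "bounded_linear (T x)" for x
  proof (rule bounded_linear_intro[OF T_add T_scaleR])
    fix \<xi>
    show "norm (T x \<xi>) \<le> norm \<xi> * (2 * C)"
    proof (cases "\<xi> = 0")
      case True
      then show ?thesis using T_scaleR[of x 0 0] by simp
    next
      case False
      then show ?thesis
        using T_small[of "(1 / (2 * norm \<xi>)) *\<^sub>R \<xi>" x] by (simp add: T_scaleR field_simps)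
    qed
  qed
  then have app: "blinfun_apply (Blinfun (T x)) = T x" for x by (rule bounded_linear_Blinfun_apply)
  define \<alpha> where "\<alpha> x = Blinfun (T x)" for x
  have \<alpha>: "blinfun_apply (\<alpha> x) = T x" for x by (simp add: \<alpha>_def app)
  \<comment> \<open>Near a the function coincides with \<beta> of one single section, which is C1
    since \<beta> maps into the module.\<close>
  have "C1_map A (\<lambda>x. T x \<xi>)" for \<xi>
  proof (rule C1_map_localI)
    fix a
    obtain f :: "'m \<Rightarrow> real" and U where U: "open U" "a \<in> U" "\<And>x. x \<in> U \<Longrightarrow> f x = 1"
      and f: "(\<lambda>x. f x *\<^sub>R \<xi>) \<in> C10 A g"
      using section_exists[where 'h = 'h, of 1 a] zero_less_one by metis
    obtain c where c: "c \<in> A" "a \<in> fst c" using chart_exists by blast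
    let ?U = "U \<inter> fst c"
    have oU: "open ?U" using U(1) open_dom[OF c(1)] by blast
    have "Ck_on 1 (chart_image c) (local_rep c (\<beta> (\<lambda>x. f x *\<^sub>R \<xi>)))"
      using \<beta>C1[OF f] c(1) unfolding C1_map_def by blast
    then have "Ck_on 1 (snd c ` ?U) (local_rep c (\<beta> (\<lambda>x. f x *\<^sub>R \<xi>)))"
      by (rule Ck_on_1_mono) (auto simp: chart_image_def)
    then have "Ck_on 1 (snd c ` ?U) (local_rep c (\<lambda>x. T x \<xi>))"
      by (rule Ck_on_1_cong[OF open_coord[OF c(1) oU Int_lower2], rotated])
        (auto simp: local_rep_coord[OF c(1)] T[OF f] U(3))
    then show "\<exists>c\<in>A. \<exists>U. open U \<and> a \<in> U \<and> U \<subseteq> fst c \<and> Ck_on 1 (snd c ` U) (local_rep c (\<lambda>x. T x \<xi>))"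
      using c U(2) oU by blast
  qed
  then show ?thesis
    using T T_scale by (intro exI[of _ \<alpha>]) (auto simp: strongly_differentiable_def complex_linear_def \<alpha>)
qed

text \<open>\<open>pointwise_operator\<close> is applied to \<beta> and to its adjoint, as
  membership in \<open>C1b\<close> asks for strong differentiability of \<alpha> and of the adjoint
  family alike.\<close>

lemma surj_Phi:
  fixes \<beta> :: "('m \<Rightarrow> 'h::complex_hilbert_space) \<Rightarrow> ('m \<Rightarrow> 'g::complex_hilbert_space)"
  assumes "\<beta> \<in> Mor A g"
  shows "\<exists>\<alpha>\<in>C1b A g. Phi A g \<alpha> = \<beta>"
proof -
  obtain \<gamma> where \<beta>: "\<beta> \<in> cb_module_maps A g" and \<gamma>: "\<gamma> \<in> cb_module_maps A g"
    and adj: "\<And>s t. s \<in> C10 A g \<Longrightarrow> t \<in> C10 A g \<Longrightarrow> hermitian_form (\<beta> s) t = hermitian_form s (\<gamma> t)"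
    using assms unfolding Mor_def is_adjoint_def by blast
  have adj': "hermitian_form (\<gamma> t) s = hermitian_form t (\<beta> s)" if "t \<in> C10 A g" "s \<in> C10 A g" for s t
  proof (rule ext)
    fix x
    show "hermitian_form (\<gamma> t) s x = hermitian_form t (\<beta> s) x"
      using fun_cong[OF adj[OF that(2,1)], of x] cinner_commute[of "\<gamma> t x" "s x"] cinner_commute[of "t x" "\<beta> s x"]
      by (simp add: hermitian_form_def)
  qed
  obtain \<alpha> :: "'m \<Rightarrow> ('h \<Rightarrow>\<^sub>L 'g)" where sd: "strongly_differentiable A \<alpha>" and cl: "\<And>x. complex_linear (\<alpha> x)"
    and \<alpha>: "\<And>s x. s \<in> C10 A g \<Longrightarrow> \<beta> s x = blinfun_apply (\<alpha> x) (s x)"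
    using pointwise_operator[OF \<beta> adj] by blast
  obtain \<alpha>' :: "'m \<Rightarrow> ('g \<Rightarrow>\<^sub>L 'h)" where sd': "strongly_differentiable A \<alpha>'"
    and \<alpha>': "\<And>t x. t \<in> C10 A g \<Longrightarrow> \<gamma> t x = blinfun_apply (\<alpha>' x) (t x)"
    using pointwise_operator[OF \<gamma> adj'] by blast
  have "ptw_adj \<alpha> = \<alpha>'"
    unfolding ptw_adj_def
  proof (rule ext, rule hilbert_adj_eqI)
    fix x \<xi> \<zeta>
    obtain s :: "'m \<Rightarrow> 'h" where s: "s \<in> C10 A g" "s x = \<xi>" using section_value by blast
    obtain t :: "'m \<Rightarrow> 'g" where t: "t \<in> C10 A g" "t x = \<zeta>" using section_value by blast
    show "cinner (blinfun_apply (\<alpha> x) \<xi>) \<zeta> = cinner \<xi> (blinfun_apply (\<alpha>' x) \<zeta>)"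
      using fun_cong[OF adj[OF s(1) t(1)], of x] \<alpha>[OF s(1), of x] \<alpha>'[OF t(1), of x] s(2) t(2)
      by (simp add: hermitian_form_def)
  qed
  moreover have cb: "cb_norm A g \<beta> < \<infinity>" using \<beta> by (simp add: cb_module_maps_def)
  moreover have "C1_map A (\<beta> s)" if "s \<in> C10 A g" for s
    using \<beta> that C10_C1 by (auto simp: cb_module_maps_def)
  then have "C1b_norm A g \<alpha> \<le> 2 * cb_norm A g \<beta>" by (intro C1b_norm_le sd cl cb \<alpha>)
  then have "C1b_norm A g \<alpha> < \<infinity>"
    using cb by (auto intro: le_less_trans simp: ennreal_mult_less_top)
  ultimately have "\<alpha> \<in> C1b A g" using sd sd' cl by (simp add: C1b_def star_strongly_differentiable_def)
  moreover have "Phi A g \<alpha> = \<beta>"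
  proof (rule PiE_ext)
    show "Phi A g \<alpha> \<in> C10 A g \<rightarrow>\<^sub>E C10 A g" "\<beta> \<in> C10 A g \<rightarrow>\<^sub>E C10 A g"
      using Phi_cb_module[OF \<open>\<alpha> \<in> C1b A g\<close>] \<beta> by (auto simp: cb_module_maps_def)
    show "Phi A g \<alpha> s = \<beta> s" if "s \<in> C10 A g" for s
      using \<alpha>[OF that] by (simp add: Phi_apply[OF that] fun_eq_iff)
  qed
  ultimately show ?thesis by blast
qed

lemma Phi_Mor: "\<alpha> \<in> C1b A g \<Longrightarrow> Phi A g \<alpha> \<in> Mor A g"
  unfolding Mor_def using Phi_cb_module Phi_is_adjoint by blast

lemma bij_Phi:
  "bij_betw (Phi A g) (C1b A g :: ('m \<Rightarrow> ('h::complex_hilbert_space \<Rightarrow>\<^sub>L 'g::complex_hilbert_space)) set) (Mor A g)"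
  unfolding bij_betw_def
proof (intro conjI inj_Phi equalityI subsetI)
  fix \<beta> :: "('m \<Rightarrow> 'h) \<Rightarrow> ('m \<Rightarrow> 'g)" assume "\<beta> \<in> Mor A g"
  then show "\<beta> \<in> Phi A g ` C1b A g" using surj_Phi by blast
qed (use Phi_Mor in blast)

lemma C1b_norm_le_Phi:
  assumes \<alpha>: "\<alpha> \<in> C1b A g"
  shows "C1b_norm A g \<alpha> \<le> 2 * cb_norm A g (Phi A g \<alpha>)"
proof (rule C1b_norm_le[OF C1bD(1,3)[OF \<alpha>]])
  show "cb_norm A g (Phi A g \<alpha>) < \<infinity>" using Phi_cb_module[OF \<alpha>] by (simp add: cb_module_maps_def)
qed (use Phi_in_C10[OF \<alpha>] C10_C1 in \<open>auto simp: Phi_apply\<close>)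

end

theorem proposition3p4:
  fixes A :: "('m::{t2_space,second_countable_topology}, 'e::real_inner) chart set"
    and g :: "('m, 'e) local_metric"
  assumes "complete_riemannian_manifold A g"
    and "separable_space (euclidean :: 'h::complex_hilbert_space topology)"
    and "infinite_dimensional TYPE('h)"
    and "separable_space (euclidean :: 'g::complex_hilbert_space topology)"
    and "infinite_dimensional TYPE('g)"
  shows "bij_betw (Phi A g)
           (C1b A g :: ('m \<Rightarrow> ('h \<Rightarrow>\<^sub>L 'g)) set)
           (Mor A g :: (('m \<Rightarrow> 'h) \<Rightarrow> ('m \<Rightarrow> 'g)) set) \<and>
         (\<forall>\<alpha> \<in> (C1b A g :: ('m \<Rightarrow> ('h \<Rightarrow>\<^sub>L 'g)) set).
           ptw_adj \<alpha> \<in> C1b A g \<and>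
           mor_adj A g (Phi A g \<alpha>) = Phi A g (ptw_adj \<alpha>) \<and>
           cb_norm A g (Phi A g \<alpha>) \<le> C1b_norm A g \<alpha> \<and>
           C1b_norm A g \<alpha> \<le> 2 * cb_norm A g (Phi A g \<alpha>))"
proof -
  interpret complete_riemannian A g
    by unfold_locales (use assms(1) in \<open>auto simp: complete_riemannian_manifold_def\<close>)
  show ?thesis
    using bij_Phi ptw_adj_C1b mor_adj_Phi cb_norm_Phi_le C1b_norm_le_Phi by blast
qed

end
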